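(* In the star-interaction random graph process with $0<p<1$, $0<q<1$, $0<r<1$: for every fixed triple $(d,w_1,w_2)$ with either ($w_1=0$, $w_2\ge 1$, $1\le d\le w_2$) or ($w_1\ge 1$, $w_2\ge 0$, $N-1\le d\le w_1(N-1)+w_2$) there is a deterministic number $x_{d,w_1,w_2}\ge 0$ with $$\frac{X(n,d,w_1,w_2)}{V_n}\to x_{d,w_1,w_2}\quad\text{almost surely as }n\to\infty.$$ Setting $x_{d,w_1,w_2}=0$ for all triples outside this domain (including those with a negative entry), these numbers satisfy $$x_{N-1,1,0}=\frac{1-r}{\alpha_1+\beta+1}>0,\quad x_{d,1,0}=0\ (d\ne N-1),\qquad x_{1,0,1}=\frac{r}{\alpha_2+\beta+1}>0,\quad x_{d,0,1}=0\ (d\ne 1),$$ and for all other $(d,w_1,w_2)$ with $w_1,w_2\ge 0$, $w_1+w_2\ge 2$, $$x_{d,w_1,w_2}=\frac{\alpha_{11}(w_1-1)x_{d-1,w_1-1,w_2}+\alpha_{12}(w_1-1)x_{d,w_1-1,w_2}+\alpha_2(w_2-1)x_{d,w_1,w_2-1}+\beta_1x_{d-(N-1),w_1-1,w_2}+\beta_2x_{d-1,w_1,w_2-1}}{\alpha_1w_1+\alpha_2w_2+\beta+1}.$$ Moreover, whenever $x_{d,w_1,w_2}=0$ for a triple in the domain, there is $a>0$ (possibly depending on $d,w_1,w_2$) such that $X(n,d,w_1,w_2)/V_n=o(n^{-a})$ almost surely.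
   Context: Star-interaction random graph process. Fix an integer $N\ge 3$ and parameters $p\in(0,1]$, $r\in[0,1]$, $q\in[0,1]$. An $N$-star is a directed graph on $N$ vertices, one called central and $N-1$ called peripheral, with one directed edge from each peripheral vertex to the central vertex; $(N-1)$-stars are defined analogously on $N-1$ vertices. The $(N-1)$-star sub-graphs of an $N$-star are the $N-1$ stars obtained by deleting one peripheral vertex (keeping the same center). At time $0$ the graph is a single $N$-star of weight $1$, and each of its $N-1$ $(N-1)$-star sub-graphs has weight $1$. An interaction of $N$ vertices with a designated center means: one new directed edge is drawn from each of the $N-1$ other (peripheral) vertices to the center (multiple edges are allowed); if this $N$-star (same vertex set, same center) has never interacted before it receives weight $1$, otherwise its weight increases by $1$; likewise each of its $(N-1)$-star sub-graphs receives weight $1$ if new and otherwise its weight increases by $1$. (So the weight of an $N$-star is its number of interactions, and the weight of an $(N-1)$-star is the sum of the weights of the $N$-stars containing it.) At each step $n=1,2,\dots$, independently of the past choice of option: with probability $p$ a new vertex is added and then (I/1) with probability $r$ an existing $(N-1)$-star is chosen with probability proportional to its weight, and it interacts with the new vertex, the center of the chosen $(N-1)$-star being the center and the new vertex being peripheral; or (I/2) with probability $1-r$, $N-1$ distinct old vertices are chosen uniformly at random and interact with the new vertex, the new vertex being the center. With probability $1-p$ no vertex is added, and (II/1) with probability $q$ an existing $N$-star is chosen with probability proportional to its weight and interacts again (same center); or (II/2) with probability $1-q$, $N$ distinct old vertices are chosen uniformly at random, a center is chosen uniformly among them, and they interact. "Old vertices" at step $n$ are those present after step $n-1$. Notation: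 $V_n$ is the number of vertices after step $n$. The central weight $w_1$ of a vertex is the number of interactions in which it was the center (equal to its in-degree divided by $N-1$); its peripheral weight $w_2$ is the number of interactions in which it was peripheral (equal to its out-degree). Its degree $d$ is its number of distinct neighbours, i.e. the number of other vertices with which it has taken part in at least one common interaction. $X(n,d,w_1,w_2)$ is the number of vertices with degree $d$, central weight $w_1$ and peripheral weight $w_2$ after step $n$. Parameters: $\alpha_{11}=pr$, $\alpha_{12}=(1-p)q$, $\alpha_1=\alpha_{11}+\alpha_{12}$, $\alpha_2=pr\frac{N-2}{N-1}+(1-p)q$, $\beta_1=\frac{(1-p)(1-q)}{p}$, $\beta_2=(N-1)\left[(1-r)+\frac{(1-p)(1-q)}{p}\right]$, $\beta=\beta_1+\beta_2$.
   Formalization: The degree counts distinct vertices joined to the given one by an edge, not all co-participants in an interaction; with co-participants a vertex with w1=0, w2=1 would have degree N-1≥2, contradicting x_{1,0,1}>0. *)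

theory Defs
  imports "HOL-Probability.Probability" "HOL-Library.Landau_Symbols"
begin

text \<open>Vertices are natural numbers; after a step the vertex set is {..<V}.
  An N-star (or (N-1)-star) is a pair (c, T): centre c and set T of peripheral
  vertices (c not in T).  The state of the process is (V, W) where W is the
  multiset of N-star interactions performed so far (the multiplicity of an
  N-star is its weight).\<close>

type_synonym star = "nat \<times> nat set"
type_synonym sstate = "nat \<times> star multiset"

definition sub_stars :: "star \<Rightarrow> star multiset" where
  "sub_stars s = mset_set ((\<lambda>u. (fst s, snd s - {u})) ` snd s)"

text \<open>Multiset of (N-1)-stars, multiplicity = weight
  (= sum of weights of the N-stars containing it).\<close>
definition sub_star_weights :: "star multiset \<Rightarrow> star multiset" where
  "sub_star_weights W = \<Sum>\<^sub># (image_mset sub_stars W)"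

definition initial_state :: "nat \<Rightarrow> sstate" where
  "initial_state N = (N, {# (0, {1..<N}) #})"

definition step_kernel :: "nat \<Rightarrow> real \<Rightarrow> real \<Rightarrow> real \<Rightarrow> sstate \<Rightarrow> sstate pmf" where
  "step_kernel N p r q st = (case st of (V, W) \<Rightarrow>
     do { add \<leftarrow> bernoulli_pmf p;
          if add then
            do { b \<leftarrow> bernoulli_pmf r;
                 if b then
                   \<comment> \<open>I/1\<close>
                   map_pmf (\<lambda>(c, S). (Suc V, W + {# (c, insert V S) #}))
                     (pmf_of_multiset (sub_star_weights W))
                 else
                   \<comment> \<open>I/2\<close>
                   map_pmf (\<lambda>S. (Suc V, W + {# (V, S) #}))
                     (pmf_of_set {S. S \<subseteq> {..<V} \<and> card S = N - 1}) }
          else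
            do { b \<leftarrow> bernoulli_pmf q;
                 if b then
                   \<comment> \<open>II/1\<close>
                   map_pmf (\<lambda>s. (V, W + {# s #})) (pmf_of_multiset W)
                 else
                   \<comment> \<open>II/2\<close>
                   do { A \<leftarrow> pmf_of_set {A. A \<subseteq> {..<V} \<and> card A = N};
                        c \<leftarrow> pmf_of_set A;
                        return_pmf (V, W + {# (c, A - {c}) #}) } } })"

definition num_vertices :: "sstate \<Rightarrow> nat" where
  "num_vertices st = fst st"

definition central_weight :: "sstate \<Rightarrow> nat \<Rightarrow> nat" where
  "central_weight st v = size (filter_mset (\<lambda>s. fst s = v) (snd st))"

definition peripheral_weight :: "sstate \<Rightarrow> nat \<Rightarrow> nat" where
  "peripheral_weight st v = size (filter_mset (\<lambda>s. v \<in> snd s) (snd st))"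

text \<open>Degree: number of distinct vertices joined to v by an edge (in either
  direction); edges go from peripheral vertices to the centre.\<close>
definition degree :: "sstate \<Rightarrow> nat \<Rightarrow> nat" where
  "degree st v = card {u. u \<noteq> v \<and>
     (\<exists>s \<in># snd st. (fst s = v \<and> u \<in> snd s) \<or> (fst s = u \<and> v \<in> snd s))}"

definition Xcount :: "sstate \<Rightarrow> nat \<Rightarrow> nat \<Rightarrow> nat \<Rightarrow> nat" where
  "Xcount st d w1 w2 = card {v \<in> {..<num_vertices st}.
      degree st v = d \<and> central_weight st v = w1 \<and> peripheral_weight st v = w2}"

definition is_star_process ::
  "nat \<Rightarrow> real \<Rightarrow> real \<Rightarrow> real \<Rightarrow> 'w measure \<Rightarrow> (nat \<Rightarrow> 'w \<Rightarrow> sstate) \<Rightarrow> bool" where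
  "is_star_process N p r q M G \<longleftrightarrow>
     prob_space M \<and>
     (\<forall>n. G n \<in> measurable M (count_space UNIV)) \<and>
     measure M {\<omega> \<in> space M. G 0 \<omega> = initial_state N} = 1 \<and>
     (\<forall>n (h :: nat \<Rightarrow> sstate).
        measure M {\<omega> \<in> space M. \<forall>i \<le> Suc n. G i \<omega> = h i} =
        measure M {\<omega> \<in> space M. \<forall>i \<le> n. G i \<omega> = h i} *
          pmf (step_kernel N p r q (h n)) (h (Suc n)))"

definition alpha11 :: "real \<Rightarrow> real \<Rightarrow> real \<Rightarrow> real" where
  "alpha11 p r q = p * r"
definition alpha12 :: "real \<Rightarrow> real \<Rightarrow> real \<Rightarrow> real" where
  "alpha12 p r q = (1 - p) * q"
definition alpha1 :: "real \<Rightarrow> real \<Rightarrow> real \<Rightarrow> real" where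
  "alpha1 p r q = alpha11 p r q + alpha12 p r q"
definition alpha2 :: "nat \<Rightarrow> real \<Rightarrow> real \<Rightarrow> real \<Rightarrow> real" where
  "alpha2 N p r q = p * r * (real N - 2) / (real N - 1) + (1 - p) * q"
definition beta1 :: "real \<Rightarrow> real \<Rightarrow> real \<Rightarrow> real" where
  "beta1 p r q = (1 - p) * (1 - q) / p"
definition beta2 :: "nat \<Rightarrow> real \<Rightarrow> real \<Rightarrow> real \<Rightarrow> real" where
  "beta2 N p r q = (real N - 1) * ((1 - r) + (1 - p) * (1 - q) / p)"
definition beta :: "nat \<Rightarrow> real \<Rightarrow> real \<Rightarrow> real \<Rightarrow> real" where
  "beta N p r q = beta1 p r q + beta2 N p r q"

definition in_domain :: "nat \<Rightarrow> int \<Rightarrow> int \<Rightarrow> int \<Rightarrow> bool" where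
  "in_domain N d w1 w2 \<longleftrightarrow>
     (w1 = 0 \<and> w2 \<ge> 1 \<and> 1 \<le> d \<and> d \<le> w2) \<or>
     (w1 \<ge> 1 \<and> w2 \<ge> 0 \<and> int N - 1 \<le> d \<and> d \<le> w1 * (int N - 1) + w2)"

end

theory Submission
  imports Defs
begin

text \<open>With \<open>m = n + 1\<close> interactions performed after step \<open>n\<close>, the expected increment of the number \<open>X\<close> of
  vertices of a given type is linear in the type counts divided by \<open>m\<close> or by the number of vertices
  \<open>V\<close>, up to an error \<open>O(1 / V)\<close>. The recursion for \<open>x\<close> says that \<open>p * x * m\<close> solves the
  corresponding deterministic equation, where the own coefficient of a type is nonpositive. Hence the
  second moment of \<open>X - p * x * m\<close> is \<open>O(m powr (2 - \<epsilon>))\<close> for some \<open>\<epsilon> > 0\<close>, by induction on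
  the total weight of the type. Since \<open>X\<close> changes by a bounded amount in each step, Markov's inequality and
  the Borel--Cantelli lemma along a polynomially growing sequence of times turn this into an almost
  sure bound \<open>O(m powr (1 - a))\<close>, which yields both the limit and the rate.\<close>

section \<open>Uniform random subsets and expectations of finitely supported distributions\<close>

text \<open>The degree is the delicate coordinate, because the number of neighbours gained depends
  on how the new star overlaps the earlier ones. For the old vertices the overlap is forced under
  I/1, I/2 and II/1, so their types shift by fixed vectors and the drift is exact. Only II/2 can
  join an already adjacent pair by chance, and this alone causes the error O(1 / V). Preferential
  choices divide by the number m of interactions and uniform ones by V. The coefficients beta are
  the uniform rates divided by p, so p / V may be exchanged for 1 / m at the price of the
  fluctuation of V, which is a martingale treated by the same second moment lemma. The 1 in the
  denominator of the recursion is the growth of p * x * m by p * x per step. The process is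
  specified by probabilities of finite histories, but all moments are computed in the finitely
  supported laws of single times; the probability space returns only for the almost sure
  statements.\<close>

lemma sum_count_eq_sum_mset:
  fixes f :: "'a \<Rightarrow> real"
  shows "(\<Sum>x\<in>set_mset A. of_nat (count A x) * f x) = (\<Sum>x\<in>#A. f x)"
proof (induction A)
  case (add a A)
  have "(\<Sum>x\<in>set_mset (add_mset a A). of_nat (count (add_mset a A) x) * f x)
      = (\<Sum>x\<in>insert a (set_mset A). of_nat (count A x) * f x + (if x = a then f x else 0))"
    by (intro sum.cong) (auto simp: algebra_simps)
  also have "\<dots> = (\<Sum>x\<in>insert a (set_mset A). of_nat (count A x) * f x) + f a"
    by (simp add: sum.distrib)
  also have "(\<Sum>x\<in>insert a (set_mset A). of_nat (count A x) * f x) = (\<Sum>x\<in>set_mset A. of_nat (count A x) * f x)"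
    by (intro sum.mono_neutral_right) (auto simp: not_in_iff)
  finally show ?case using add by simp
qed simp

lemma expectation_pmf_of_multiset:
  fixes f :: "'a \<Rightarrow> real"
  assumes "A \<noteq> {#}"
  shows "measure_pmf.expectation (pmf_of_multiset A) f = (\<Sum>x\<in>#A. f x) / size A"
proof -
  have "measure_pmf.expectation (pmf_of_multiset A) f = (\<Sum>x\<in>set_mset A. (count A x / size A) * f x)"
    using assms by (subst integral_measure_pmf[of "set_mset A"]) auto
  also have "\<dots> = (\<Sum>x\<in>set_mset A. of_nat (count A x) * f x) / size A"
    by (simp add: sum_divide_distrib)
  also have "(\<Sum>x\<in>set_mset A. of_nat (count A x) * f x) = (\<Sum>x\<in>#A. f x)"
    by (rule sum_count_eq_sum_mset)
  finally show ?thesis .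
qed

lemma card_subsets_containing:
  assumes "finite S" "U \<subseteq> S" "card U \<le> k"
  shows "card {A. A \<subseteq> S \<and> card A = k \<and> U \<subseteq> A} = (card S - card U) choose (k - card U)"
proof -
  have fU: "finite U" using assms finite_subset by blast
  have "bij_betw (\<lambda>B. B \<union> U) {B. B \<subseteq> S - U \<and> card B = k - card U} {A. A \<subseteq> S \<and> card A = k \<and> U \<subseteq> A}"
  proof (rule bij_betwI[where g = "\<lambda>A. A - U"])
    show "(\<lambda>B. B \<union> U) \<in> {B. B \<subseteq> S - U \<and> card B = k - card U} \<rightarrow> {A. A \<subseteq> S \<and> card A = k \<and> U \<subseteq> A}"
    proof safe
      fix B assume B: "B \<subseteq> S - U" "card B = k - card U"
      have "finite B" using B(1) assms(1) by (meson finite_Diff finite_subset)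
      then have "card (B \<union> U) = card B + card U" using B(1) fU by (intro card_Un_disjoint) auto
      then show "card (B \<union> U) = k" using B(2) assms(3) by simp
    qed (use assms in auto)
    show "(\<lambda>A. A - U) \<in> {A. A \<subseteq> S \<and> card A = k \<and> U \<subseteq> A} \<rightarrow> {B. B \<subseteq> S - U \<and> card B = k - card U}"
      using fU by (auto simp: card_Diff_subset)
  qed auto
  then have "card {A. A \<subseteq> S \<and> card A = k \<and> U \<subseteq> A} = card {B. B \<subseteq> S - U \<and> card B = k - card U}"
    by (rule bij_betw_same_card[symmetric])
  also have "\<dots> = (card S - card U) choose (k - card U)"
    using assms fU by (subst n_subsets) (auto simp: card_Diff_subset)
  finally show ?thesis .
qed

lemma subsets_of_card_nonempty:
  assumes "finite S" "k \<le> card S"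
  shows "{A. A \<subseteq> S \<and> card A = k} \<noteq> {}" "finite {A. A \<subseteq> S \<and> card A = k}"
proof -
  show "{A. A \<subseteq> S \<and> card A = k} \<noteq> {}" using obtain_subset_with_card_n[OF assms(2)] by blast
  show "finite {A. A \<subseteq> S \<and> card A = k}" using assms(1) by (rule finite_subset[rotated, OF finite_Pow_iff[THEN iffD2]]) auto
qed

lemma expectation_uniform_subset_contains:
  assumes "finite S" "k \<le> card S" "U \<subseteq> S" "card U \<le> k"
  shows "measure_pmf.expectation (pmf_of_set {A. A \<subseteq> S \<and> card A = k}) (\<lambda>A. of_bool (U \<subseteq> A) :: real) =
           ((card S - card U) choose (k - card U)) / (card S choose k)"
proof -
  have "measure_pmf.expectation (pmf_of_set {A. A \<subseteq> S \<and> card A = k}) (\<lambda>A. of_bool (U \<subseteq> A) :: real)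
        = (\<Sum>A | A \<subseteq> S \<and> card A = k. of_bool (U \<subseteq> A)) / (card S choose k)"
    by (simp only: integral_pmf_of_set[OF subsets_of_card_nonempty[OF assms(1,2)]] n_subsets[OF assms(1)])
  also have "(\<Sum>A | A \<subseteq> S \<and> card A = k. of_bool (U \<subseteq> A)) = real (card {A. A \<subseteq> S \<and> card A = k \<and> U \<subseteq> A})"
    using subsets_of_card_nonempty(2)[OF assms(1,2)] by (simp add: sum_of_bool_eq Int_def conj_assoc)
  finally show ?thesis using card_subsets_containing[OF assms(1,3,4)] by simp
qed

lemma expectation_uniform_subset_mem:
  assumes "finite S" "k \<le> card S" "1 \<le> k" "v \<in> S"
  shows "measure_pmf.expectation (pmf_of_set {A. A \<subseteq> S \<and> card A = k}) (\<lambda>A. of_bool (v \<in> A) :: real) =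
           k / card S"
proof -
  have pos: "card S > 0" using assms by auto
  have "k * (card S choose k) = card S * ((card S - 1) choose (k - 1))"
    using assms pos by (metis One_nat_def Suc_pred' binomial_absorption mult.commute less_eq_Suc_le)
  then have "real k * real (card S choose k) = real (card S) * real ((card S - 1) choose (k - 1))"
    by (metis of_nat_mult)
  moreover have "card S choose k > 0" using assms by simp
  ultimately have "real ((card S - 1) choose (k - 1)) / real (card S choose k) = k / card S"
    using pos by (simp add: field_simps)
  then show ?thesis using expectation_uniform_subset_contains[of S k "{v}"] assms by simp
qed

lemma expectation_uniform_subset_pair:
  assumes "finite S" "k \<le> card S" "2 \<le> k" "v \<in> S" "u \<in> S" "u \<noteq> v"
  shows "measure_pmf.expectation (pmf_of_set {A. A \<subseteq> S \<and> card A = k}) (\<lambda>A. of_bool (v \<in> A \<and> u \<in> A) :: real) =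
           k * (real k - 1) / (card S * (real (card S) - 1))"
proof -
  \<comment> \<open>Shifting both sizes by 2 removes natural subtraction, so that binomial
    absorption can be applied twice.\<close>
  define n j where "n = card S - 2" and "j = k - 2"
  then have n: "card S = Suc (Suc n)" and j: "k = Suc (Suc j)" using assms(2,3) by auto
  have "real (Suc (Suc j)) * real (Suc j) * real (Suc (Suc n) choose Suc (Suc j)) =
        real (Suc (Suc n)) * real (Suc n) * real (n choose j)"
    using binomial_absorption[of "Suc j" "Suc (Suc n)"] binomial_absorption[of j "Suc n"]
    by (smt (verit) diff_Suc_1 mult.assoc mult.commute of_nat_mult)
  moreover have "Suc (Suc n) choose Suc (Suc j) > 0" using assms(2) n j by simp
  ultimately have "real (n choose j) / real (Suc (Suc n) choose Suc (Suc j)) =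
       real (Suc (Suc j)) * real (Suc j) / (real (Suc (Suc n)) * real (Suc n))"
    by (simp add: divide_simps mult_ac del: of_nat_Suc binomial_Suc_Suc)
  then show ?thesis using expectation_uniform_subset_contains[of S k "{v,u}"] assms
    by (simp add: n j del: binomial_Suc_Suc)
qed

lemma expectation_bind_pmf:
  fixes h :: "'b \<Rightarrow> real"
  assumes "finite (set_pmf p)" "\<And>x. x \<in> set_pmf p \<Longrightarrow> finite (set_pmf (f x))"
  shows "measure_pmf.expectation (bind_pmf p f) h =
           measure_pmf.expectation p (\<lambda>x. measure_pmf.expectation (f x) h)"
  using assms by (subst pmf_expectation_bind[OF assms(1)])
    (auto simp: integral_measure_pmf[OF assms(1)])

lemma expectation_bind_bernoulli:
  fixes h :: "'b \<Rightarrow> real"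
  assumes "0 \<le> p" "p \<le> 1" "\<And>x. finite (set_pmf (f x))"
  shows "measure_pmf.expectation (bind_pmf (bernoulli_pmf p) f) h =
           p * measure_pmf.expectation (f True) h + (1 - p) * measure_pmf.expectation (f False) h"
  using assms by (subst expectation_bind_pmf) auto

lemma expectation_mono_pmf:
  fixes f g :: "'a \<Rightarrow> real"
  assumes "finite (set_pmf P)" "\<And>x. x \<in> set_pmf P \<Longrightarrow> f x \<le> g x"
  shows "measure_pmf.expectation P f \<le> measure_pmf.expectation P g"
  using assms by (intro integral_mono_AE integrable_measure_pmf_finite) (auto simp: AE_measure_pmf_iff)

lemma expectation_cong_pmf:
  fixes f g :: "'a \<Rightarrow> real"
  assumes "\<And>x. x \<in> set_pmf P \<Longrightarrow> f x = g x"
  shows "measure_pmf.expectation P f = measure_pmf.expectation P g"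
  using assms by (intro integral_cong_AE) (auto simp: AE_measure_pmf_iff)

section \<open>Vertex types\<close>

definition nbrs :: "star multiset \<Rightarrow> nat \<Rightarrow> nat set" where
  "nbrs W v = {u. u \<noteq> v \<and> (\<exists>s \<in># W. (fst s = v \<and> u \<in> snd s) \<or> (fst s = u \<and> v \<in> snd s))}"

text \<open>The order is degree, central weight, peripheral weight. With integer entries the type
  before a shift is a plain difference without truncation, and triples with negative entries are
  simply types that no vertex has.\<close>

definition vtype :: "star multiset \<Rightarrow> nat \<Rightarrow> int \<times> int \<times> int" where
  "vtype W v = (int (card (nbrs W v)), int (size {#s \<in># W. fst s = v#}), int (size {#s \<in># W. v \<in> snd s#}))"

definition tcount :: "nat \<Rightarrow> star multiset \<Rightarrow> int \<times> int \<times> int \<Rightarrow> real" where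
  "tcount V W k = (\<Sum>v<V. of_bool (vtype W v = k))"

lemma Xcount_eq_tcount: "real (Xcount (V, W) d w1 w2) = tcount V W (int d, int w1, int w2)"
proof -
  have "degree (V, W) v = card (nbrs W v)" for v
    by (simp add: degree_def nbrs_def)
  then show ?thesis
    by (simp add: Xcount_def tcount_def vtype_def num_vertices_def central_weight_def
        peripheral_weight_def sum_of_bool_eq Int_def)
qed

lemma tcount_nonneg: "0 \<le> tcount V W k"
  unfolding tcount_def by (intro sum_nonneg) simp

lemma tcount_le: "tcount V W k \<le> real V"
proof -
  have "tcount V W k \<le> (\<Sum>v<V. 1)"
    unfolding tcount_def by (intro sum_mono) simp
  then show ?thesis by simp
qed

definition valid_star :: "nat \<Rightarrow> nat \<Rightarrow> star \<Rightarrow> bool" where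
  "valid_star N V s \<longleftrightarrow> fst s < V \<and> snd s \<subseteq> {..<V} \<and> fst s \<notin> snd s \<and> card (snd s) = N - 1"

text \<open>The invariant carried along the chain. The initial star counts as an interaction, hence
  \<open>Suc n\<close>. The upper bound on \<open>V\<close> gives linear growth of all counts, and
  the covering clause excludes vertices of total weight 0.\<close>

definition reachable :: "nat \<Rightarrow> nat \<Rightarrow> nat \<Rightarrow> star multiset \<Rightarrow> bool" where
  "reachable N n V W \<longleftrightarrow> N \<le> V \<and> V \<le> N + n \<and> size W = Suc n \<and> (\<forall>s \<in># W. valid_star N V s) \<and>
     (\<forall>v<V. \<exists>s \<in># W. v = fst s \<or> v \<in> snd s)"

lemma valid_star_finite: "valid_star N V s \<Longrightarrow> finite (snd s)"
  by (auto simp: valid_star_def intro: finite_subset)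

lemma nbrs_subset: "\<forall>s \<in># W. valid_star N V s \<Longrightarrow> nbrs W v \<subseteq> {..<V}"
  by (auto simp: nbrs_def valid_star_def)

lemma finite_nbrs: "\<forall>s \<in># W. valid_star N V s \<Longrightarrow> finite (nbrs W v)"
  by (rule finite_subset[OF nbrs_subset]) auto

lemma nbrs_fresh: "\<forall>s \<in># W. valid_star N V s \<Longrightarrow> nbrs W V = {}"
  by (auto simp: nbrs_def valid_star_def)

lemma fresh_not_in_nbrs: "\<forall>s \<in># W. valid_star N V s \<Longrightarrow> V \<notin> nbrs W v"
  by (auto simp: nbrs_def valid_star_def)

lemma vtype_fresh: "\<forall>s \<in># W. valid_star N V s \<Longrightarrow> vtype W V = (0, 0, 0)"
  by (subst vtype_def, subst nbrs_fresh) (force simp: valid_star_def)+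

lemma vtype_nonneg_pos:
  assumes "\<forall>v<V. \<exists>s \<in># W. v = fst s \<or> v \<in> snd s" "v < V" "vtype W v = (d, a, b)"
  shows "0 \<le> d" "0 \<le> a" "0 \<le> b" "1 \<le> a + b"
proof -
  obtain s where s: "s \<in># W" "v = fst s \<or> v \<in> snd s" using assms by blast
  have "s \<in># {#s \<in># W. fst s = v#} + {#s \<in># W. v \<in> snd s#}"
    using s by auto
  then have "size ({#s \<in># W. fst s = v#} + {#s \<in># W. v \<in> snd s#}) \<noteq> 0"
    by (metis empty_not_add_mset multi_member_split size_eq_0_iff_empty)
  then have "size {#s \<in># W. fst s = v#} + size {#s \<in># W. v \<in> snd s#} \<noteq> 0"
    unfolding size_union .
  then have "1 \<le> int (size {#s \<in># W. fst s = v#}) + int (size {#s \<in># W. v \<in> snd s#})"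
    by linarith
  then show "0 \<le> d" "0 \<le> a" "0 \<le> b" "1 \<le> a + b" using assms(3) unfolding vtype_def prod.inject by linarith+
qed

text \<open>Every vertex lies in some star and so has total weight at least 1. This serves as the
  base of the induction on total weight, where \<open>limit_freq\<close> vanishes as well.\<close>

lemma tcount_eq_0:
  assumes "reachable N n V W" "a < 0 \<or> b < 0 \<or> a + b < 1"
  shows "tcount V W (d, a, b) = 0"
proof -
  have "vtype W v \<noteq> (d, a, b)" if "v < V" for v
    using assms vtype_nonneg_pos[of V W v d a b] that unfolding reachable_def by fastforce
  then show ?thesis by (simp add: tcount_def)
qed

section \<open>Effect of one added star on types and counts\<close>

lemma vtype_add_other:
  "v \<noteq> fst s \<Longrightarrow> v \<notin> snd s \<Longrightarrow> vtype (add_mset s W) v = vtype W v"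
  by (simp add: vtype_def nbrs_def)

lemma vtype_add_center:
  assumes "fst s \<notin> snd s"
  shows "vtype (add_mset s W) (fst s) =
    (int (card (nbrs W (fst s) \<union> snd s)), fst (snd (vtype W (fst s))) + 1, snd (snd (vtype W (fst s))))"
proof -
  have "nbrs (add_mset s W) (fst s) = nbrs W (fst s) \<union> snd s"
    using assms by (auto simp: nbrs_def)
  then show ?thesis using assms by (simp add: vtype_def)
qed

lemma vtype_add_peripheral:
  assumes "fst s \<notin> snd s" "v \<in> snd s"
  shows "vtype (add_mset s W) v =
    (int (card (insert (fst s) (nbrs W v))), fst (snd (vtype W v)), snd (snd (vtype W v)) + 1)"
proof -
  have "nbrs (add_mset s W) v = insert (fst s) (nbrs W v)"
    using assms by (auto simp: nbrs_def)
  then show ?thesis using assms by (auto simp: vtype_def)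
qed

text \<open>Only members of the new star change type. If the centre shifts by \<open>sc\<close> and
  the peripheral vertices by \<open>sp\<close>, the count of \<open>k\<close> gains vertices from
  \<open>k - sc\<close> and \<open>k - sp\<close> and loses those that leave \<open>k\<close>;
  \<open>e\<close> pays for the stars that shift a vertex differently. By linearity the expectation
  then needs only the probability of each vertex to be central or peripheral.\<close>

lemma expected_tcount_shift:
  fixes P :: "star pmf" and W :: "star multiset" and sc sp :: "int \<times> int \<times> int"
  defines "T \<equiv> \<lambda>v. vtype W v"
  assumes fin: "finite (set_pmf P)"
    and err: "\<And>s v. s \<in> set_pmf P \<Longrightarrow> v < V \<Longrightarrow>
      \<bar>of_bool (vtype (add_mset s W) v = k) - (of_bool (T v = k)
        + of_bool (v = fst s) * (of_bool (T v = k - sc) - of_bool (T v = k))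
        + of_bool (v \<in> snd s) * (of_bool (T v = k - sp) - of_bool (T v = k)))\<bar> \<le> (e s v :: real)"
  shows "\<bar>measure_pmf.expectation P (\<lambda>s. \<Sum>v<V. of_bool (vtype (add_mset s W) v = k)) - (tcount V W k
        + (\<Sum>v<V. measure_pmf.expectation P (\<lambda>s. of_bool (v = fst s)) * (of_bool (T v = k - sc) - of_bool (T v = k)))
        + (\<Sum>v<V. measure_pmf.expectation P (\<lambda>s. of_bool (v \<in> snd s)) * (of_bool (T v = k - sp) - of_bool (T v = k))))\<bar>
     \<le> (\<Sum>v<V. measure_pmf.expectation P (\<lambda>s. e s v))"
proof -
  note int[simp] = integrable_measure_pmf_finite[OF fin]
  let ?A = "\<lambda>v. of_bool (T v = k - sc) - of_bool (T v = k) :: real"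
  let ?B = "\<lambda>v. of_bool (T v = k - sp) - of_bool (T v = k) :: real"
  let ?g = "\<lambda>s v. of_bool (vtype (add_mset s W) v = k) - (of_bool (T v = k)
        + of_bool (v = fst s) * ?A v + of_bool (v \<in> snd s) * ?B v) :: real"
  have eq: "measure_pmf.expectation P (\<lambda>s. \<Sum>v<V. of_bool (vtype (add_mset s W) v = k)) - (tcount V W k
        + (\<Sum>v<V. measure_pmf.expectation P (\<lambda>s. of_bool (v = fst s)) * ?A v)
        + (\<Sum>v<V. measure_pmf.expectation P (\<lambda>s. of_bool (v \<in> snd s)) * ?B v))
     = (\<Sum>v<V. measure_pmf.expectation P (\<lambda>s. ?g s v))"
    by (simp add: tcount_def T_def sum_subtractf sum.distrib del: sum_of_bool_eq)
  have "\<bar>\<Sum>v<V. measure_pmf.expectation P (\<lambda>s. ?g s v)\<bar> \<le> (\<Sum>v<V. \<bar>measure_pmf.expectation P (\<lambda>s. ?g s v)\<bar>)"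
    by (rule sum_abs)
  also have "\<dots> \<le> (\<Sum>v<V. measure_pmf.expectation P (\<lambda>s. \<bar>?g s v\<bar>))"
    by (rule sum_mono, rule integral_abs_bound)
  also have "\<dots> \<le> (\<Sum>v<V. measure_pmf.expectation P (\<lambda>s. e s v))"
    by (rule sum_mono, rule expectation_mono_pmf[OF fin], rule err) auto
  finally show ?thesis unfolding eq .
qed

lemma sum_tcount_const:
  "(\<Sum>v<V. c * (of_bool (vtype W v = k') - of_bool (vtype W v = k))) = c * (tcount V W k' - tcount V W k)"
  by (simp add: tcount_def sum_distrib_left[symmetric] sum_subtractf)

text \<open>Under preferential choice the probability of picking a vertex is proportional to a
  coordinate of its type. It is therefore constant on each type class, which is why the expected
  counts form a closed linear system.\<close>

lemma sum_tcount_central: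
  "(\<Sum>v<V. (c * real (size {#s \<in># W. fst s = v#})) * (of_bool (vtype W v = (d', a', b')) - of_bool (vtype W v = (d, a, b))))
    = c * (of_int a' * tcount V W (d', a', b') - of_int a * tcount V W (d, a, b))"
proof -
  have "(c * real (size {#s \<in># W. fst s = v#})) * (of_bool (vtype W v = (d', a', b')) - of_bool (vtype W v = (d, a, b)))
     = c * (of_int a' * of_bool (vtype W v = (d', a', b')) - of_int a * of_bool (vtype W v = (d, a, b)))" (is "?lhs v = ?rhs v") for v
    by (auto simp: vtype_def)
  then have "(\<Sum>v<V. ?lhs v) = (\<Sum>v<V. ?rhs v)"
    by (intro sum.cong) auto
  also have "\<dots> = c * (of_int a' * tcount V W (d', a', b') - of_int a * tcount V W (d, a, b))"
    by (simp only: tcount_def sum_distrib_left sum_subtractf right_diff_distrib)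
  finally show ?thesis .
qed

lemma sum_tcount_peripheral:
  "(\<Sum>v<V. (c * real (size {#s \<in># W. v \<in> snd s#})) * (of_bool (vtype W v = (d', a', b')) - of_bool (vtype W v = (d, a, b))))
    = c * (of_int b' * tcount V W (d', a', b') - of_int b * tcount V W (d, a, b))"
proof -
  have "(c * real (size {#s \<in># W. v \<in> snd s#})) * (of_bool (vtype W v = (d', a', b')) - of_bool (vtype W v = (d, a, b)))
     = c * (of_int b' * of_bool (vtype W v = (d', a', b')) - of_int b * of_bool (vtype W v = (d, a, b)))" (is "?lhs v = ?rhs v") for v
    by (auto simp: vtype_def)
  then have "(\<Sum>v<V. ?lhs v) = (\<Sum>v<V. ?rhs v)"
    by (intro sum.cong) auto
  also have "\<dots> = c * (of_int b' * tcount V W (d', a', b') - of_int b * tcount V W (d, a, b))"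
    by (simp only: tcount_def sum_distrib_left sum_subtractf right_diff_distrib)
  finally show ?thesis .
qed

lemma sum_mset_of_bool: "(\<Sum>s\<in>#W. of_bool (Q s)) = real (size {#s \<in># W. Q s#})"
  by (induction W) auto

lemma sum_mset_1: "(\<Sum>s\<in>#W. 1) = real (size W)"
  by (induction W) auto

lemma sum_sub_star_weights:
  fixes f :: "star \<Rightarrow> real"
  assumes "\<And>s. s \<in># W \<Longrightarrow> finite (snd s)"
  shows "(\<Sum>x\<in>#sub_star_weights W. f x) = (\<Sum>s\<in>#W. \<Sum>u\<in>snd s. f (fst s, snd s - {u}))"
  using assms
proof (induction W)
  case (add s W)
  \<comment> \<open>\<open>mset_set\<close> of an image forgets repetitions, so it matters that
    different deletions give different sub-stars.\<close>
  have inj: "inj_on (\<lambda>u. (fst s, snd s - {u})) (snd s)"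
    by (auto simp: inj_on_def)
  have "(\<Sum>x\<in>#sub_stars s. f x) = (\<Sum>u\<in>snd s. f (fst s, snd s - {u}))"
    unfolding sub_stars_def sum_unfold_sum_mset[symmetric] by (subst sum.reindex[OF inj]) simp
  then show ?case using add by (simp add: sub_star_weights_def)
qed (simp add: sub_star_weights_def)

lemma in_sub_star_weights:
  assumes "\<And>s. s \<in># W \<Longrightarrow> finite (snd s)"
  shows "x \<in># sub_star_weights W \<longleftrightarrow> (\<exists>s\<in>#W. \<exists>u\<in>snd s. x = (fst s, snd s - {u}))"
  using assms by (auto simp: sub_star_weights_def sub_stars_def)

section \<open>One step of the process\<close>

lemma vtype_shift_center:
  assumes "fst s \<notin> snd s" "v = fst s" "card (nbrs W v \<union> snd s) = card (nbrs W v) + j"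
  shows "vtype (add_mset s W) v = vtype W v + (int j, 1, 0)"
  using vtype_add_center[OF assms(1), of W] assms(2,3) by (simp add: vtype_def)

lemma vtype_shift_peripheral:
  assumes "fst s \<notin> snd s" "v \<in> snd s" "card (insert (fst s) (nbrs W v)) = card (nbrs W v) + j"
  shows "vtype (add_mset s W) v = vtype W v + (int j, 0, 1)"
  using vtype_add_peripheral[OF assms(1,2), of W] assms(3) by (simp add: vtype_def)

text \<open>The error-free case of the hypothesis of \<open>expected_tcount_shift\<close>: the roles
  of centre and peripheral vertex exclude each other, so at most one correction term is
  active.\<close>

lemma of_bool_vtype_shift:
  assumes "fst s \<notin> snd s"
    and "v = fst s \<Longrightarrow> vtype (add_mset s W) v = vtype W v + sc"
    and "v \<in> snd s \<Longrightarrow> vtype (add_mset s W) v = vtype W v + sp"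
  shows "of_bool (vtype (add_mset s W) v = k) = (of_bool (vtype W v = k)
        + of_bool (v = fst s) * (of_bool (vtype W v = k - sc) - of_bool (vtype W v = k))
        + of_bool (v \<in> snd s) * (of_bool (vtype W v = k - sp) - of_bool (vtype W v = k)) :: real)"
proof -
  consider "v = fst s" "v \<notin> snd s" | "v \<noteq> fst s" "v \<in> snd s" | "v \<noteq> fst s" "v \<notin> snd s"
    using assms(1) by auto
  then show ?thesis
  proof cases
    case 1
    then show ?thesis using assms(2) by (simp add: eq_diff_eq)
  next
    case 2
    then show ?thesis using assms(3) by (simp add: eq_diff_eq)
  next
    case 3
    then show ?thesis by (simp add: vtype_add_other)
  qed
qed

text \<open>This law and the next two are those of the added star alone, for the options I/1, I/2
  and II/2; option II/1 draws from \<open>pmf_of_multiset W\<close>. Whether the vertex count grows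
  is kept apart from the choice of the star.\<close>

definition grow_sub_star :: "nat \<Rightarrow> star multiset \<Rightarrow> star pmf" where
  "grow_sub_star V W = map_pmf (\<lambda>(c, S). (c, insert V S)) (pmf_of_multiset (sub_star_weights W))"

definition uniform_star_at_new :: "nat \<Rightarrow> nat \<Rightarrow> star pmf" where
  "uniform_star_at_new N V = map_pmf (\<lambda>S. (V, S)) (pmf_of_set {S. S \<subseteq> {..<V} \<and> card S = N - 1})"

definition uniform_star :: "nat \<Rightarrow> nat \<Rightarrow> star pmf" where
  "uniform_star N V = bind_pmf (pmf_of_set {A. A \<subseteq> {..<V} \<and> card A = N})
     (\<lambda>A. map_pmf (\<lambda>c. (c, A - {c})) (pmf_of_set A))"

lemma step_kernel_eq:
  "step_kernel N p r q (V, W) = bind_pmf (bernoulli_pmf p) (\<lambda>add.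
     if add then map_pmf (\<lambda>s. (Suc V, add_mset s W))
         (bind_pmf (bernoulli_pmf r) (\<lambda>b. if b then grow_sub_star V W else uniform_star_at_new N V))
     else map_pmf (\<lambda>s. (V, add_mset s W))
         (bind_pmf (bernoulli_pmf q) (\<lambda>b. if b then pmf_of_multiset W else uniform_star N V)))"
proof -
  have "(if add then bernoulli_pmf r \<bind> (\<lambda>b. if b then map_pmf (\<lambda>(c, S). (Suc V, W + {#(c, insert V S)#})) (pmf_of_multiset (sub_star_weights W))
            else map_pmf (\<lambda>S. (Suc V, W + {#(V, S)#})) (pmf_of_set {S. S \<subseteq> {..<V} \<and> card S = N - 1}))
          else bernoulli_pmf q \<bind> (\<lambda>b. if b then map_pmf (\<lambda>s. (V, W + {#s#})) (pmf_of_multiset W)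
            else pmf_of_set {A. A \<subseteq> {..<V} \<and> card A = N} \<bind> (\<lambda>A. pmf_of_set A \<bind> (\<lambda>c. return_pmf (V, W + {#(c, A - {c})#})))))
       = (if add then map_pmf (\<lambda>s. (Suc V, add_mset s W))
           (bind_pmf (bernoulli_pmf r) (\<lambda>b. if b then grow_sub_star V W else uniform_star_at_new N V))
          else map_pmf (\<lambda>s. (V, add_mset s W))
           (bind_pmf (bernoulli_pmf q) (\<lambda>b. if b then pmf_of_multiset W else uniform_star N V)))" for add
    unfolding if_distrib[of "\<lambda>x. map_pmf _ x"] map_bind_pmf grow_sub_star_def uniform_star_at_new_def uniform_star_def map_pmf_comp
    unfolding map_pmf_def by (simp add: case_prod_unfold cong: if_cong)
  then show ?thesis unfolding step_kernel_def prod.case by simp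
qed

section \<open>Expected type counts under each of the four options\<close>

locale reachable_state =
  fixes N n V :: nat and W :: "star multiset"
  assumes N3: "3 \<le> N" and reach: "reachable N n V W"
begin

lemma valid: "\<forall>s \<in># W. valid_star N V s"
  and size_W: "size W = Suc n" and V_ge: "N \<le> V" and V_le: "V \<le> N + n"
  and covered: "\<forall>v<V. \<exists>s \<in># W. v = fst s \<or> v \<in> snd s"
  using reach by (auto simp: reachable_def)

lemma finite_periphery: "s \<in># W \<Longrightarrow> finite (snd s)"
  using valid valid_star_finite by blast

lemma W_nonempty: "W \<noteq> {#}"
  using size_W by auto

lemma sum_over_sub_stars:
  fixes f :: "star \<Rightarrow> real"
  assumes "\<And>s. s \<in># W \<Longrightarrow> (\<Sum>u\<in>snd s. f (fst s, snd s - {u})) = c * g s"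
  shows "(\<Sum>x\<in>#sub_star_weights W. f x) = c * (\<Sum>s\<in>#W. g s)"
proof -
  have "(\<Sum>x\<in>#sub_star_weights W. f x) = (\<Sum>s\<in>#W. c * g s)"
    using assms by (subst sum_sub_star_weights) (auto intro!: finite_periphery arg_cong[of _ _ sum_mset] image_mset_cong)
  then show ?thesis by (simp add: sum_mset_distrib_left)
qed

lemma size_sub_star_weights: "real (size (sub_star_weights W)) = (real N - 1) * (real n + 1)"
proof -
  have "(\<Sum>x\<in>#sub_star_weights W. 1) = (real N - 1) * (\<Sum>s\<in>#W. 1)"
    by (rule sum_over_sub_stars) (use valid N3 in \<open>auto simp: valid_star_def of_nat_diff\<close>)
  then show ?thesis by (simp only: sum_mset_1 size_W) simp
qed

lemma sub_star_weights_nonempty: "sub_star_weights W \<noteq> {#}"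
proof
  assume "sub_star_weights W = {#}"
  then show False using size_sub_star_weights N3 by simp
qed

text \<open>All \<open>N - 1\<close> sub-stars of a star keep its centre, so this factor cancels
  against the total weight of the sub-stars.\<close>

lemma expectation_grow_sub_star_center:
  "measure_pmf.expectation (grow_sub_star V W) (\<lambda>s. of_bool (v = fst s))
     = 1 / (real n + 1) * real (size {#s \<in># W. fst s = v#})"
proof -
  have "(\<Sum>x\<in>#sub_star_weights W. of_bool (fst x = v) :: real) = (real N - 1) * (\<Sum>s\<in>#W. of_bool (fst s = v))"
    by (rule sum_over_sub_stars) (use valid N3 in \<open>auto simp: valid_star_def of_nat_diff\<close>)
  then have *: "(\<Sum>x\<in>#sub_star_weights W. of_bool (fst x = v)) = (real N - 1) * real (size {#s \<in># W. fst s = v#})"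
    by (simp only: sum_mset_of_bool)
  have "measure_pmf.expectation (grow_sub_star V W) (\<lambda>s. of_bool (v = fst s) :: real)
     = (\<Sum>x\<in>#sub_star_weights W. of_bool (fst x = v)) / ((real N - 1) * (real n + 1))"
    by (simp add: grow_sub_star_def expectation_pmf_of_multiset[OF sub_star_weights_nonempty]
        size_sub_star_weights case_prod_unfold eq_commute)
  then show ?thesis unfolding * using N3 by simp
qed

text \<open>A peripheral vertex survives in \<open>N - 2\<close> of the \<open>N - 1\<close>
  sub-stars, which is the origin of the fraction in \<open>alpha2\<close>. The new vertex
  \<open>V\<close> is always peripheral and must be excluded.\<close>

lemma expectation_grow_sub_star_peripheral:
  assumes "v < V"
  shows "measure_pmf.expectation (grow_sub_star V W) (\<lambda>s. of_bool (v \<in> snd s))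
     = (real N - 2) / (real N - 1) / (real n + 1) * real (size {#s \<in># W. v \<in> snd s#})"
proof -
  have "(\<Sum>x\<in>#sub_star_weights W. of_bool (v \<in> snd x) :: real) = (real N - 2) * (\<Sum>s\<in>#W. of_bool (v \<in> snd s))"
  proof (rule sum_over_sub_stars)
    fix s assume s: "s \<in># W"
    have c: "card (snd s) = N - 1" using valid s by (simp add: valid_star_def)
    have "(\<Sum>u\<in>snd s. of_bool (v \<in> snd s - {u}) :: real) = (\<Sum>u\<in>snd s - {v}. of_bool (v \<in> snd s))"
      using finite_periphery[OF s] by (intro sum.mono_neutral_cong_right) auto
    also have "\<dots> = (real N - 2) * of_bool (v \<in> snd s)"
      using c N3 by (auto simp: of_nat_diff card_Diff_singleton)
    finally show "(\<Sum>u\<in>snd s. of_bool (v \<in> snd (fst s, snd s - {u})) :: real) = (real N - 2) * of_bool (v \<in> snd s)"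
      by simp
  qed
  then have *: "(\<Sum>x\<in>#sub_star_weights W. of_bool (v \<in> snd x)) = (real N - 2) * real (size {#s \<in># W. v \<in> snd s#})"
    by (simp only: sum_mset_of_bool)
  have "measure_pmf.expectation (grow_sub_star V W) (\<lambda>s. of_bool (v \<in> snd s) :: real)
     = (\<Sum>x\<in>#sub_star_weights W. of_bool (v \<in> snd x)) / ((real N - 1) * (real n + 1))"
    using assms by (simp add: grow_sub_star_def expectation_pmf_of_multiset[OF sub_star_weights_nonempty]
        size_sub_star_weights case_prod_unfold)
  then show ?thesis unfolding * by (simp add: field_simps)
qed

lemma grow_sub_star_cases:
  assumes "s \<in> set_pmf (grow_sub_star V W)"
  obtains t u where "t \<in># W" "u \<in> snd t" "s = (fst t, insert V (snd t - {u}))"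
proof -
  obtain x where x: "x \<in># sub_star_weights W" "s = (fst x, insert V (snd x))"
    using assms sub_star_weights_nonempty by (auto simp: grow_sub_star_def)
  then obtain t u where "t \<in># W" "u \<in> snd t" "x = (fst t, snd t - {u})"
    using in_sub_star_weights[of W x] finite_periphery by blast
  then show thesis using that x(2) by simp
qed

lemma finite_grow_sub_star: "finite (set_pmf (grow_sub_star V W))"
  using sub_star_weights_nonempty by (simp add: grow_sub_star_def)

text \<open>The old members of the chosen sub-star are already joined to its centre. Hence the
  centre gains exactly one neighbour, the new vertex, and the old peripheral vertices gain none. The
  sum covers old vertices only; the new one is added in \<open>expected_tcount_step\<close>.\<close>

lemma expected_tcount_grow_sub_star:
  "measure_pmf.expectation (grow_sub_star V W) (\<lambda>s. \<Sum>v<V. of_bool (vtype (add_mset s W) v = (d, a, b)))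
    = tcount V W (d, a, b)
      + ((of_int a - 1) * tcount V W (d - 1, a - 1, b) - of_int a * tcount V W (d, a, b)) / (real n + 1)
      + (real N - 2) / (real N - 1) *
        ((of_int b - 1) * tcount V W (d, a, b - 1) - of_int b * tcount V W (d, a, b)) / (real n + 1)"
proof -
  let ?k = "(d, a, b)"
  have shift: "of_bool (vtype (add_mset s W) v = ?k) = (of_bool (vtype W v = ?k)
        + of_bool (v = fst s) * (of_bool (vtype W v = ?k - (1, 1, 0)) - of_bool (vtype W v = ?k))
        + of_bool (v \<in> snd s) * (of_bool (vtype W v = ?k - (0, 0, 1)) - of_bool (vtype W v = ?k)) :: real)"
    if s: "s \<in> set_pmf (grow_sub_star V W)" and v: "v < V" for s v
  proof (rule of_bool_vtype_shift)
    obtain t u where t: "t \<in># W" "u \<in> snd t" "s = (fst t, insert V (snd t - {u}))"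
      using s by (rule grow_sub_star_cases)
    have vt: "fst t \<notin> snd t" "fst t < V" using valid t(1) by (auto simp: valid_star_def)
    show ns: "fst s \<notin> snd s" using t vt by auto
    show "vtype (add_mset s W) v = vtype W v + (1, 1, 0)" if "v = fst s"
    proof -
      \<comment> \<open>The whole periphery of the original star \<open>t\<close>, the deleted
        vertex included, is adjacent to the centre, so only \<open>V\<close> is new.\<close>
      have "snd t \<subseteq> nbrs W v" using t vt that by (force simp: nbrs_def)
      then have "nbrs W v \<union> snd s = insert V (nbrs W v)" using t by auto
      then show ?thesis using vtype_shift_center[OF ns that, of W 1] finite_nbrs[OF valid] fresh_not_in_nbrs[OF valid] by simp
    qed
    show "vtype (add_mset s W) v = vtype W v + (0, 0, 1)" if "v \<in> snd s"
    proof -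
      have "fst s \<in> nbrs W v" using t vt that v by (force simp: nbrs_def)
      then show ?thesis using vtype_shift_peripheral[OF ns that, of W 0] by (simp add: insert_absorb)
    qed
  qed
  \<comment> \<open>With error term 0 the estimate is an equality.\<close>
  have "\<bar>measure_pmf.expectation (grow_sub_star V W) (\<lambda>s. \<Sum>v<V. of_bool (vtype (add_mset s W) v = ?k)) - (tcount V W ?k
        + (\<Sum>v<V. measure_pmf.expectation (grow_sub_star V W) (\<lambda>s. of_bool (v = fst s)) * (of_bool (vtype W v = ?k - (1, 1, 0)) - of_bool (vtype W v = ?k)))
        + (\<Sum>v<V. measure_pmf.expectation (grow_sub_star V W) (\<lambda>s. of_bool (v \<in> snd s)) * (of_bool (vtype W v = ?k - (0, 0, 1)) - of_bool (vtype W v = ?k))))\<bar>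
     \<le> (\<Sum>v<V. measure_pmf.expectation (grow_sub_star V W) (\<lambda>s. 0))"
    by (rule expected_tcount_shift[OF finite_grow_sub_star]) (subst shift, auto)
  moreover have "(\<Sum>v<V. measure_pmf.expectation (grow_sub_star V W) (\<lambda>s. of_bool (v = fst s)) * (of_bool (vtype W v = ?k - (1, 1, 0)) - of_bool (vtype W v = ?k)))
     = 1 / (real n + 1) * (of_int (a - 1) * tcount V W (d - 1, a - 1, b) - of_int a * tcount V W ?k)"
    unfolding expectation_grow_sub_star_center diff_Pair diff_zero by (rule sum_tcount_central)
  moreover have "(\<Sum>v<V. measure_pmf.expectation (grow_sub_star V W) (\<lambda>s. of_bool (v \<in> snd s)) * (of_bool (vtype W v = ?k - (0, 0, 1)) - of_bool (vtype W v = ?k)))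
     = (real N - 2) / (real N - 1) / (real n + 1) * (of_int (b - 1) * tcount V W (d, a, b - 1) - of_int b * tcount V W ?k)"
    by (subst sum_tcount_peripheral[symmetric]) (simp add: expectation_grow_sub_star_peripheral)
  ultimately show ?thesis by simp
qed

lemma set_uniform_star_at_new:
  "set_pmf (uniform_star_at_new N V) = (\<lambda>S. (V, S)) ` {S. S \<subseteq> {..<V} \<and> card S = N - 1}"
proof -
  have "N - 1 \<le> card {..<V}" using V_ge by simp
  from subsets_of_card_nonempty[OF finite_lessThan this] show ?thesis
    unfolding uniform_star_at_new_def by (simp add: set_pmf_of_set)
qed

lemma finite_uniform_star_at_new: "finite (set_pmf (uniform_star_at_new N V))"
proof -
  have "N - 1 \<le> card {..<V}" using V_ge by simp
  from subsets_of_card_nonempty(2)[OF finite_lessThan this] show ?thesis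
    unfolding set_uniform_star_at_new by simp
qed

text \<open>The centre is the new vertex, so every chosen old vertex gains one certain neighbour. No
  old vertex is central, and the shift \<open>(0, 0, 0)\<close> only fills that slot of the general
  lemma.\<close>

lemma expected_tcount_uniform_star_at_new:
  "measure_pmf.expectation (uniform_star_at_new N V) (\<lambda>s. \<Sum>v<V. of_bool (vtype (add_mset s W) v = (d, a, b)))
    = tcount V W (d, a, b) + (real N - 1) / real V * (tcount V W (d - 1, a, b - 1) - tcount V W (d, a, b))"
proof -
  let ?k = "(d, a, b)"
  let ?P = "uniform_star_at_new N V"
  have shift: "of_bool (vtype (add_mset s W) v = ?k) = (of_bool (vtype W v = ?k)
        + of_bool (v = fst s) * (of_bool (vtype W v = ?k - (0, 0, 0)) - of_bool (vtype W v = ?k))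
        + of_bool (v \<in> snd s) * (of_bool (vtype W v = ?k - (1, 0, 1)) - of_bool (vtype W v = ?k)) :: real)"
    if s: "s \<in> set_pmf ?P" and v: "v < V" for s v
  proof (rule of_bool_vtype_shift)
    obtain S where S: "s = (V, S)" "S \<subseteq> {..<V}" using s unfolding set_uniform_star_at_new by blast
    show ns: "fst s \<notin> snd s" using S by auto
    show "vtype (add_mset s W) v = vtype W v + (0, 0, 0)" if "v = fst s"
      using that v S by simp
    show "vtype (add_mset s W) v = vtype W v + (1, 0, 1)" if "v \<in> snd s"
      using vtype_shift_peripheral[OF ns that, of W 1] S finite_nbrs[OF valid] fresh_not_in_nbrs[OF valid] by simp
  qed
  have "\<bar>measure_pmf.expectation ?P (\<lambda>s. \<Sum>v<V. of_bool (vtype (add_mset s W) v = ?k)) - (tcount V W ?k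
        + (\<Sum>v<V. measure_pmf.expectation ?P (\<lambda>s. of_bool (v = fst s)) * (of_bool (vtype W v = ?k - (0, 0, 0)) - of_bool (vtype W v = ?k)))
        + (\<Sum>v<V. measure_pmf.expectation ?P (\<lambda>s. of_bool (v \<in> snd s)) * (of_bool (vtype W v = ?k - (1, 0, 1)) - of_bool (vtype W v = ?k))))\<bar>
     \<le> (\<Sum>v<V. measure_pmf.expectation ?P (\<lambda>s. 0))"
    by (rule expected_tcount_shift[OF finite_uniform_star_at_new]) (subst shift, auto)
  moreover have "measure_pmf.expectation ?P (\<lambda>s. of_bool (v \<in> snd s) :: real) = (real N - 1) / real V" if "v < V" for v
    using expectation_uniform_subset_mem[of "{..<V}" "N - 1" v] that V_ge N3
    by (simp add: uniform_star_at_new_def of_nat_diff)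
  then have "(\<Sum>v<V. measure_pmf.expectation ?P (\<lambda>s. of_bool (v \<in> snd s)) * (of_bool (vtype W v = ?k - (1, 0, 1)) - of_bool (vtype W v = ?k)))
     = (real N - 1) / real V * (tcount V W (d - 1, a, b - 1) - tcount V W ?k)"
    by (subst sum_tcount_const[symmetric]) simp
  ultimately show ?thesis by simp
qed

text \<open>A repeated star joins no new pair, so the weights grow while all degrees stay.\<close>

lemma expected_tcount_pmf_of_multiset:
  "measure_pmf.expectation (pmf_of_multiset W) (\<lambda>s. \<Sum>v<V. of_bool (vtype (add_mset s W) v = (d, a, b)))
    = tcount V W (d, a, b)
      + ((of_int a - 1) * tcount V W (d, a - 1, b) - of_int a * tcount V W (d, a, b)) / (real n + 1)
      + ((of_int b - 1) * tcount V W (d, a, b - 1) - of_int b * tcount V W (d, a, b)) / (real n + 1)"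
proof -
  let ?k = "(d, a, b)"
  let ?P = "pmf_of_multiset W"
  have fin: "finite (set_pmf ?P)" using W_nonempty by simp
  have shift: "of_bool (vtype (add_mset s W) v = ?k) = (of_bool (vtype W v = ?k)
        + of_bool (v = fst s) * (of_bool (vtype W v = ?k - (0, 1, 0)) - of_bool (vtype W v = ?k))
        + of_bool (v \<in> snd s) * (of_bool (vtype W v = ?k - (0, 0, 1)) - of_bool (vtype W v = ?k)) :: real)"
    if s: "s \<in> set_pmf ?P" and v: "v < V" for s v
  proof (rule of_bool_vtype_shift)
    have s: "s \<in># W" using s W_nonempty by simp
    show ns: "fst s \<notin> snd s" using valid s by (auto simp: valid_star_def)
    show "vtype (add_mset s W) v = vtype W v + (0, 1, 0)" if "v = fst s"
    proof -
      have "snd s \<subseteq> nbrs W v" using s ns that by (force simp: nbrs_def)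
      then show ?thesis using vtype_shift_center[OF ns that, of W 0] by (simp add: Un_absorb2)
    qed
    show "vtype (add_mset s W) v = vtype W v + (0, 0, 1)" if "v \<in> snd s"
    proof -
      have "fst s \<in> nbrs W v" using s ns that by (force simp: nbrs_def)
      then show ?thesis using vtype_shift_peripheral[OF ns that, of W 0] by (simp add: insert_absorb)
    qed
  qed
  have "\<bar>measure_pmf.expectation ?P (\<lambda>s. \<Sum>v<V. of_bool (vtype (add_mset s W) v = ?k)) - (tcount V W ?k
        + (\<Sum>v<V. measure_pmf.expectation ?P (\<lambda>s. of_bool (v = fst s)) * (of_bool (vtype W v = ?k - (0, 1, 0)) - of_bool (vtype W v = ?k)))
        + (\<Sum>v<V. measure_pmf.expectation ?P (\<lambda>s. of_bool (v \<in> snd s)) * (of_bool (vtype W v = ?k - (0, 0, 1)) - of_bool (vtype W v = ?k))))\<bar>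
     \<le> (\<Sum>v<V. measure_pmf.expectation ?P (\<lambda>s. 0))"
    by (rule expected_tcount_shift[OF fin]) (subst shift, auto)
  moreover have "measure_pmf.expectation ?P (\<lambda>s. of_bool (v = fst s) :: real) = 1 / (real n + 1) * real (size {#s \<in># W. fst s = v#})" for v
    by (simp add: expectation_pmf_of_multiset[OF W_nonempty] sum_mset_of_bool size_W eq_commute[of v] add.commute)
  then have "(\<Sum>v<V. measure_pmf.expectation ?P (\<lambda>s. of_bool (v = fst s)) * (of_bool (vtype W v = ?k - (0, 1, 0)) - of_bool (vtype W v = ?k)))
     = 1 / (real n + 1) * (of_int (a - 1) * tcount V W (d, a - 1, b) - of_int a * tcount V W ?k)"
    by (subst sum_tcount_central[symmetric]) simp
  moreover have "measure_pmf.expectation ?P (\<lambda>s. of_bool (v \<in> snd s) :: real) = 1 / (real n + 1) * real (size {#s \<in># W. v \<in> snd s#})" for v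
    by (simp add: expectation_pmf_of_multiset[OF W_nonempty] sum_mset_of_bool size_W add.commute)
  then have "(\<Sum>v<V. measure_pmf.expectation ?P (\<lambda>s. of_bool (v \<in> snd s)) * (of_bool (vtype W v = ?k - (0, 0, 1)) - of_bool (vtype W v = ?k)))
     = 1 / (real n + 1) * (of_int (b - 1) * tcount V W (d, a, b - 1) - of_int b * tcount V W ?k)"
    by (subst sum_tcount_peripheral[symmetric]) simp
  ultimately show ?thesis by simp
qed

lemma expectation_uniform_star:
  fixes h :: "star \<Rightarrow> real"
  shows "measure_pmf.expectation (uniform_star N V) h
    = measure_pmf.expectation (pmf_of_set {A. A \<subseteq> {..<V} \<and> card A = N}) (\<lambda>A. (\<Sum>c\<in>A. h (c, A - {c})) / real N)"
proof -
  have "N \<le> card {..<V}" using V_ge by simp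
  note ne = subsets_of_card_nonempty[OF finite_lessThan this]
  have ne2: "finite A \<and> A \<noteq> {}" if "A \<in> {A. A \<subseteq> {..<V} \<and> card A = N}" for A
    using that N3 by (auto intro: finite_subset)
  have "measure_pmf.expectation (uniform_star N V) h
    = measure_pmf.expectation (pmf_of_set {A. A \<subseteq> {..<V} \<and> card A = N})
       (\<lambda>A. measure_pmf.expectation (map_pmf (\<lambda>c. (c, A - {c})) (pmf_of_set A)) h)"
    unfolding uniform_star_def using ne ne2
    by (intro expectation_bind_pmf) (simp_all add: set_pmf_of_set del: mem_Collect_eq)
  also have "\<dots> = measure_pmf.expectation (pmf_of_set {A. A \<subseteq> {..<V} \<and> card A = N}) (\<lambda>A. (\<Sum>c\<in>A. h (c, A - {c})) / real N)"
  proof (rule expectation_cong_pmf)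
    fix A assume "A \<in> set_pmf (pmf_of_set {A. A \<subseteq> {..<V} \<and> card A = N})"
    then have A: "A \<in> {A. A \<subseteq> {..<V} \<and> card A = N}" unfolding set_pmf_of_set[OF ne] .
    show "measure_pmf.expectation (map_pmf (\<lambda>c. (c, A - {c})) (pmf_of_set A)) h = (\<Sum>c\<in>A. h (c, A - {c})) / real N"
      using ne2[OF A] A by (simp add: integral_pmf_of_set)
  qed
  finally show ?thesis .
qed

lemma uniform_star_cases:
  assumes "s \<in> set_pmf (uniform_star N V)"
  obtains A where "A \<subseteq> {..<V}" "card A = N" "fst s \<in> A" "snd s = A - {fst s}"
proof -
  have "N \<le> card {..<V}" using V_ge by simp
  note ne = subsets_of_card_nonempty[OF finite_lessThan this]
  obtain A where A: "A \<subseteq> {..<V}" "card A = N" and s: "s \<in> (\<lambda>c. (c, A - {c})) ` set_pmf (pmf_of_set A)"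
    using assms ne unfolding uniform_star_def by (auto simp: set_pmf_of_set)
  have "finite A" "A \<noteq> {}" using A N3 by (auto intro: finite_subset)
  then show thesis using that[OF A] s by (auto simp: set_pmf_of_set)
qed

lemma finite_uniform_star: "finite (set_pmf (uniform_star N V))"
proof (rule finite_subset)
  show "set_pmf (uniform_star N V) \<subseteq> {..<V} \<times> Pow {..<V}"
    by (auto elim!: uniform_star_cases)
qed auto

text \<open>Functions of the vertex set of the star do not see which member became the centre. This
  reduces the pair probabilities below to those of a uniform subset.\<close>

lemma expectation_uniform_star_set:
  fixes h :: "nat set \<Rightarrow> real"
  shows "measure_pmf.expectation (uniform_star N V) (\<lambda>s. h (insert (fst s) (snd s)))
    = measure_pmf.expectation (pmf_of_set {A. A \<subseteq> {..<V} \<and> card A = N}) h"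
  unfolding expectation_uniform_star
proof (rule expectation_cong_pmf)
  have "N \<le> card {..<V}" using V_ge by simp
  note ne = subsets_of_card_nonempty[OF finite_lessThan this]
  fix A assume "A \<in> set_pmf (pmf_of_set {A. A \<subseteq> {..<V} \<and> card A = N})"
  then have "card A = N" unfolding set_pmf_of_set[OF ne] by blast
  moreover have "(\<Sum>c\<in>A. h (insert (fst (c, A - {c})) (snd (c, A - {c})))) = (\<Sum>c\<in>A. h A)"
    by (intro sum.cong) (auto simp: insert_absorb)
  ultimately show "(\<Sum>c\<in>A. h (insert (fst (c, A - {c})) (snd (c, A - {c})))) / real N = h A"
    using N3 by simp
qed

lemma expectation_uniform_star_center:
  assumes "v < V"
  shows "measure_pmf.expectation (uniform_star N V) (\<lambda>s. of_bool (v = fst s) :: real) = 1 / real V"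
    and "measure_pmf.expectation (uniform_star N V) (\<lambda>s. of_bool (v \<in> snd s) :: real) = (real N - 1) / real V"
proof -
  let ?Q = "pmf_of_set {A. A \<subseteq> {..<V} \<and> card A = N}"
  have "N \<le> card {..<V}" using V_ge by simp
  note ne = subsets_of_card_nonempty[OF finite_lessThan this]
  have mem: "measure_pmf.expectation ?Q (\<lambda>A. of_bool (v \<in> A) :: real) = real N / real V"
    using expectation_uniform_subset_mem[of "{..<V}" N v] assms V_ge N3 by simp
  have A: "card A = N \<and> finite A" if "A \<in> set_pmf ?Q" for A
    using that unfolding set_pmf_of_set[OF ne] by (auto intro: finite_subset)
  have "measure_pmf.expectation (uniform_star N V) (\<lambda>s. of_bool (v = fst s) :: real)
     = measure_pmf.expectation ?Q (\<lambda>A. of_bool (v \<in> A) * (1 / real N))"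
    unfolding expectation_uniform_star
  proof (rule expectation_cong_pmf)
    fix A assume "A \<in> set_pmf ?Q"
    then have "finite A" using A by blast
    then have "(\<Sum>c\<in>A. of_bool (v = c) :: real) = of_bool (v \<in> A)"
      by (simp add: of_bool_def del: sum_of_bool_eq)
    then show "(\<Sum>c\<in>A. of_bool (v = fst (c, A - {c}))) / real N = of_bool (v \<in> A) * (1 / real N)" by simp
  qed
  then show "measure_pmf.expectation (uniform_star N V) (\<lambda>s. of_bool (v = fst s) :: real) = 1 / real V"
    using N3 by (simp add: mem)
  have "measure_pmf.expectation (uniform_star N V) (\<lambda>s. of_bool (v \<in> snd s) :: real)
     = measure_pmf.expectation ?Q (\<lambda>A. of_bool (v \<in> A) * ((real N - 1) / real N))"
    unfolding expectation_uniform_star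
  proof (rule expectation_cong_pmf)
    fix A assume "A \<in> set_pmf ?Q"
    note A = A[OF this]
    have "(\<Sum>c\<in>A. of_bool (v \<in> A - {c}) :: real) = (\<Sum>c\<in>A - {v}. of_bool (v \<in> A))"
      using A by (intro sum.mono_neutral_cong_right) auto
    also have "\<dots> = of_bool (v \<in> A) * (real N - 1)"
      using A N3 by (auto simp: card_Diff_singleton of_nat_diff)
    finally show "(\<Sum>c\<in>A. of_bool (v \<in> snd (c, A - {c}))) / real N = of_bool (v \<in> A) * ((real N - 1) / real N)" by simp
  qed
  then show "measure_pmf.expectation (uniform_star N V) (\<lambda>s. of_bool (v \<in> snd s) :: real) = (real N - 1) / real V"
    using N3 by (simp add: mem)
qed

text \<open>A uniform star contains a given pair of neighbours with probability of order \<open>1 / V\<^sup>2\<close>,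
  so the event that it repeats an edge at a vertex of bounded degree only costs \<open>O(1 / V)\<close>.\<close>
lemma expected_tcount_uniform_star:
  "\<bar>measure_pmf.expectation (uniform_star N V) (\<lambda>s. \<Sum>v<V. of_bool (vtype (add_mset s W) v = (d, a, b)))
    - (tcount V W (d, a, b) + 1 / real V * (tcount V W (d - (int N - 1), a - 1, b) - tcount V W (d, a, b))
      + (real N - 1) / real V * (tcount V W (d - 1, a, b - 1) - tcount V W (d, a, b)))\<bar>
    \<le> 2 * real (nat d) * (real N)\<^sup>2 / real V"
proof -
  let ?k = "(d, a, b)"
  let ?P = "uniform_star N V"
  \<comment> \<open>One unit is charged for every neighbour of \<open>v\<close> that meets
    \<open>v\<close> in the star. Vertices of degree above \<open>d\<close> can be left out because
    degrees never decrease; the remaining ones have at most \<open>nat d\<close> neighbours, so a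
    union bound over pairs suffices.\<close>
  let ?e = "\<lambda>s v. of_bool (card (nbrs W v) \<le> nat d) *
    (\<Sum>u\<in>nbrs W v. of_bool (v \<in> insert (fst s) (snd s) \<and> u \<in> insert (fst s) (snd s))) :: real"
  have err: "\<bar>of_bool (vtype (add_mset s W) v = ?k) - (of_bool (vtype W v = ?k)
        + of_bool (v = fst s) * (of_bool (vtype W v = ?k - (int N - 1, 1, 0)) - of_bool (vtype W v = ?k))
        + of_bool (v \<in> snd s) * (of_bool (vtype W v = ?k - (1, 0, 1)) - of_bool (vtype W v = ?k)))\<bar> \<le> ?e s v"
    (is "\<bar>?D\<bar> \<le> _") if s: "s \<in> set_pmf ?P" and v: "v < V" for s v
  proof -
    obtain A where A: "A \<subseteq> {..<V}" "card A = N" "fst s \<in> A" "snd s = A - {fst s}"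
      using s by (rule uniform_star_cases)
    have fA: "finite A" using A(1) finite_subset by blast
    have ns: "fst s \<notin> snd s" and ins: "insert (fst s) (snd s) = A" using A by auto
    have fn: "finite (nbrs W v)" by (rule finite_nbrs[OF valid])
    have e0: "0 \<le> ?e s v" by (intro mult_nonneg_nonneg sum_nonneg) auto
    consider "v \<notin> A" | "v \<in> A" "nbrs W v \<inter> A = {}" | "v \<in> A" "nat d < card (nbrs W v)"
      | "v \<in> A" "nbrs W v \<inter> A \<noteq> {}" "card (nbrs W v) \<le> nat d" by linarith
    then show ?thesis
    proof cases
      case 1
      then have "v \<noteq> fst s" "v \<notin> snd s" using A by auto
      then have "?D = 0" by (simp add: vtype_add_other)
      then show ?thesis using e0 by simp
    next
      case 2
      have "?D = 0"
      proof (subst of_bool_vtype_shift[OF ns])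
        show "vtype (add_mset s W) v = vtype W v + (int N - 1, 1, 0)" if "v = fst s"
        proof -
          have "card (nbrs W v \<union> snd s) = card (nbrs W v) + card (snd s)"
            using 2 A fn fA by (intro card_Un_disjoint) auto
          then have "card (nbrs W v \<union> snd s) = card (nbrs W v) + (N - 1)" using A fA by (simp add: card_Diff_singleton)
          from vtype_shift_center[OF ns that this] show ?thesis using N3 by (simp add: of_nat_diff)
        qed
        have "fst s \<notin> nbrs W v" using 2 A by blast
        then show "vtype (add_mset s W) v = vtype W v + (1, 0, 1)" if "v \<in> snd s"
          using vtype_shift_peripheral[OF ns that, of W 1] fn by simp
      qed simp
      then show ?thesis using e0 by simp
    next
      case 3
      \<comment> \<open>The degree of \<open>v\<close> already exceeds \<open>d\<close>, so
        \<open>v\<close> has type \<open>k\<close> neither before nor after the step, nor one of the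
        two smaller types: all four indicators vanish.\<close>
      have "d < int (card (nbrs W v))" using 3 by linarith
      moreover have "card (nbrs W v) \<le> card (nbrs W v \<union> snd s)" "card (nbrs W v) \<le> card (insert (fst s) (nbrs W v))"
        using fn fA A by (auto intro!: card_mono)
      ultimately have "vtype (add_mset s W) v \<noteq> ?k" "vtype W v \<noteq> ?k - (int N - 1, 1, 0)" "vtype W v \<noteq> ?k - (1, 0, 1)"
        "vtype W v \<noteq> ?k"
        using vtype_add_center[OF ns, of W] vtype_add_peripheral[OF ns, of v W] 3 A N3
        by (cases "v = fst s"; auto simp: vtype_def)+
      then show ?thesis using e0 by simp
    next
      case 4
      then obtain u where u: "u \<in> nbrs W v" "u \<in> A" by blast
      have "of_bool (v \<in> A \<and> u \<in> A) \<le> (\<Sum>u\<in>nbrs W v. of_bool (v \<in> A \<and> u \<in> A) :: real)"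
        by (rule member_le_sum[OF u(1)]) (use fn in auto)
      then have "1 \<le> ?e s v" using 4 u ins by simp
      moreover have "\<bar>?D\<bar> \<le> 1" using 4 A ns by (cases "v = fst s") (auto simp: of_bool_def)
      ultimately show ?thesis by linarith
    qed
  qed
  have Vpos: "2 \<le> V" using V_ge N3 by simp
  have e: "measure_pmf.expectation ?P (\<lambda>s. ?e s v) \<le> real (nat d) * (2 * (real N)\<^sup>2 / (real V)\<^sup>2)" for v
  proof -
    have pair: "measure_pmf.expectation ?P (\<lambda>s. of_bool (v \<in> insert (fst s) (snd s) \<and> u \<in> insert (fst s) (snd s)) :: real) \<le> 2 * (real N)\<^sup>2 / (real V)\<^sup>2"
      if u: "u \<in> nbrs W v" for u
    proof -
      have uv: "u < V" "u \<noteq> v" "v < V" using u valid by (auto simp: nbrs_def valid_star_def)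
      \<comment> \<open>The factor 2 comes from \<open>V - 1 \<ge> V / 2\<close>.\<close>
      have "real N * (real N - 1) / (real V * (real V - 1)) \<le> real N * real N / (real V * (real V / 2))"
        using Vpos N3 by (intro frac_le mult_mono mult_nonneg_nonneg mult_pos_pos) auto
      moreover have "measure_pmf.expectation ?P (\<lambda>s. of_bool (v \<in> insert (fst s) (snd s) \<and> u \<in> insert (fst s) (snd s)) :: real)
        = real N * (real N - 1) / (real V * (real V - 1))"
        unfolding expectation_uniform_star_set[of "\<lambda>A. of_bool (v \<in> A \<and> u \<in> A)"]
        using expectation_uniform_subset_pair[of "{..<V}" N v u] uv V_ge N3 by simp
      ultimately show ?thesis by (simp add: power2_eq_square mult_ac)
    qed
    have "measure_pmf.expectation ?P (\<lambda>s. ?e s v) = of_bool (card (nbrs W v) \<le> nat d) *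
      (\<Sum>u\<in>nbrs W v. measure_pmf.expectation ?P (\<lambda>s. of_bool (v \<in> insert (fst s) (snd s) \<and> u \<in> insert (fst s) (snd s))))"
      by (subst integral_mult_right_zero, subst Bochner_Integration.integral_sum)
        (simp_all only: integrable_measure_pmf_finite[OF finite_uniform_star])
    also have "\<dots> \<le> of_bool (card (nbrs W v) \<le> nat d) * (real (card (nbrs W v)) * (2 * (real N)\<^sup>2 / (real V)\<^sup>2))"
      by (intro mult_left_mono sum_bounded_above pair) auto
    also have "\<dots> \<le> real (nat d) * (2 * (real N)\<^sup>2 / (real V)\<^sup>2)"
      by (cases "card (nbrs W v) \<le> nat d") (auto intro!: divide_right_mono mult_right_mono)
    finally show ?thesis .
  qed
  have "\<bar>measure_pmf.expectation ?P (\<lambda>s. \<Sum>v<V. of_bool (vtype (add_mset s W) v = ?k)) - (tcount V W ?k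
        + (\<Sum>v<V. measure_pmf.expectation ?P (\<lambda>s. of_bool (v = fst s)) * (of_bool (vtype W v = ?k - (int N - 1, 1, 0)) - of_bool (vtype W v = ?k)))
        + (\<Sum>v<V. measure_pmf.expectation ?P (\<lambda>s. of_bool (v \<in> snd s)) * (of_bool (vtype W v = ?k - (1, 0, 1)) - of_bool (vtype W v = ?k))))\<bar>
     \<le> (\<Sum>v<V. measure_pmf.expectation ?P (\<lambda>s. ?e s v))"
    by (rule expected_tcount_shift[OF finite_uniform_star]) (rule err)
  moreover have "(\<Sum>v<V. measure_pmf.expectation ?P (\<lambda>s. of_bool (v = fst s)) * (of_bool (vtype W v = ?k - (int N - 1, 1, 0)) - of_bool (vtype W v = ?k)))
     = 1 / real V * (tcount V W (d - (int N - 1), a - 1, b) - tcount V W ?k)"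
    by (subst sum_tcount_const[symmetric]) (simp add: expectation_uniform_star_center)
  moreover have "(\<Sum>v<V. measure_pmf.expectation ?P (\<lambda>s. of_bool (v \<in> snd s)) * (of_bool (vtype W v = ?k - (1, 0, 1)) - of_bool (vtype W v = ?k)))
     = (real N - 1) / real V * (tcount V W (d - 1, a, b - 1) - tcount V W ?k)"
    by (subst sum_tcount_const[symmetric]) (simp add: expectation_uniform_star_center)
  moreover have "(\<Sum>v<V. measure_pmf.expectation ?P (\<lambda>s. ?e s v)) \<le> real (card {..<V}) * (real (nat d) * (2 * (real N)\<^sup>2 / (real V)\<^sup>2))"
    by (rule sum_bounded_above) (rule e)
  moreover have "real (card {..<V}) * (real (nat d) * (2 * (real N)\<^sup>2 / (real V)\<^sup>2)) = 2 * real (nat d) * (real N)\<^sup>2 / real V"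
    using Vpos by (simp add: power2_eq_square field_simps)
  ultimately show ?thesis by linarith
qed

end

section \<open>Invariance under a step and the combined drift\<close>

lemma valid_star_mono: "valid_star N V s \<Longrightarrow> V \<le> V' \<Longrightarrow> valid_star N V' s"
  by (fastforce simp: valid_star_def)

text \<open>Only the members of the star change type, and at most one vertex is new. The constant is
  not sharp.\<close>

lemma tcount_add_star_le:
  assumes "finite (snd s)" "card (snd s) = N - 1" "V' = V \<or> V' = Suc V"
  shows "\<bar>tcount V' (add_mset s W) k - tcount V W k\<bar> \<le> real N + 2"
proof -
  define B where "B = insert (fst s) (snd s)"
  have "\<bar>of_bool (vtype (add_mset s W) v = k) - of_bool (vtype W v = k)\<bar> \<le> (of_bool (v \<in> B) :: real)" for v
    by (cases "v \<in> B") (auto simp: vtype_add_other B_def)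
  then have "\<bar>\<Sum>v<V. of_bool (vtype (add_mset s W) v = k) - of_bool (vtype W v = k)\<bar> \<le> (\<Sum>v<V. of_bool (v \<in> B) :: real)"
    by (intro order_trans[OF sum_abs] sum_mono)
  also have "\<dots> = real (card ({..<V} \<inter> B))"
    by simp
  also have "\<dots> \<le> real (card B)"
    using assms(1) unfolding B_def by (intro of_nat_mono card_mono) auto
  also have "\<dots> \<le> real N + 1"
    using card_insert_le_m1[of "Suc N" "snd s" "fst s"] assms(2) by (simp add: B_def)
  finally have "\<bar>tcount V (add_mset s W) k - tcount V W k\<bar> \<le> real N + 1"
    by (simp add: tcount_def sum_subtractf del: sum_of_bool_eq)
  moreover have "\<bar>tcount V' (add_mset s W) k - tcount V (add_mset s W) k\<bar> \<le> 1"
    using assms(3) by (auto simp: tcount_def simp del: sum_of_bool_eq)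
  ultimately show ?thesis by linarith
qed

context reachable_state
begin

text \<open>The type of the new vertex is deterministic here. It supplies the source term
  \<open>r\<close> at \<open>(1, 0, 1)\<close>.\<close>

lemma valid_star_grow_sub_star:
  assumes "s \<in> set_pmf (grow_sub_star V W)"
  shows "valid_star N (Suc V) s" "V \<in> snd s" "vtype (add_mset s W) V = (1, 0, 1)"
proof -
  obtain t u where t: "t \<in># W" "u \<in> snd t" "s = (fst t, insert V (snd t - {u}))"
    using assms by (rule grow_sub_star_cases)
  have vt: "fst t \<notin> snd t" "fst t < V" "snd t \<subseteq> {..<V}" "card (snd t) = N - 1" "finite (snd t)"
    using valid t(1) valid_star_finite by (auto simp: valid_star_def)
  have "card (insert V (snd t - {u})) = N - 1"
    using vt t N3 by (subst card_insert_disjoint) (auto simp: card_Diff_singleton)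
  then show "valid_star N (Suc V) s" using vt t by (auto simp: valid_star_def)
  show "V \<in> snd s" using t by simp
  then show "vtype (add_mset s W) V = (1, 0, 1)"
  proof -
    assume "V \<in> snd s"
    moreover have "fst s \<notin> snd s" using t vt by auto
    ultimately have "vtype (add_mset s W) V = vtype W V + (int 1, 0, 1)"
      using nbrs_fresh[OF valid] by (intro vtype_shift_peripheral) auto
    then show ?thesis using vtype_fresh[OF valid] by simp
  qed
qed

text \<open>The new vertex is a centre with \<open>N - 1\<close> fresh neighbours, which supplies
  the source term \<open>1 - r\<close> at \<open>(int N - 1, 1, 0)\<close>.\<close>

lemma valid_star_uniform_star_at_new:
  assumes "s \<in> set_pmf (uniform_star_at_new N V)"
  shows "valid_star N (Suc V) s" "fst s = V" "vtype (add_mset s W) V = (int N - 1, 1, 0)"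
proof -
  obtain S where S: "s = (V, S)" "S \<subseteq> {..<V}" "card S = N - 1"
    using assms unfolding set_uniform_star_at_new by auto
  then show "valid_star N (Suc V) s" "fst s = V" by (auto simp: valid_star_def)
  show "vtype (add_mset s W) V = (int N - 1, 1, 0)"
  proof -
    have "fst s \<notin> snd s" using S by auto
    then have "vtype (add_mset s W) V = vtype W V + (int (N - 1), 1, 0)"
      using S nbrs_fresh[OF valid] by (intro vtype_shift_center) auto
    then show ?thesis using vtype_fresh[OF valid] N3 by (simp add: of_nat_diff)
  qed
qed

lemma valid_star_uniform_star:
  assumes "s \<in> set_pmf (uniform_star N V)"
  shows "valid_star N V s"
proof -
  obtain A where A: "A \<subseteq> {..<V}" "card A = N" "fst s \<in> A" "snd s = A - {fst s}"
    using assms by (rule uniform_star_cases)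
  then have "finite A" using finite_subset by blast
  then show ?thesis using A by (auto simp: valid_star_def card_Diff_singleton)
qed

lemma step_kernel_cases:
  assumes "st' \<in> set_pmf (step_kernel N p r q (V, W))"
  obtains s V' where "st' = (V', add_mset s W)" "V' = V \<or> V' = Suc V"
    "valid_star N V' s" "V' = Suc V \<Longrightarrow> V = fst s \<or> V \<in> snd s"
proof -
  consider (new) s where "st' = (Suc V, add_mset s W)" "s \<in> set_pmf (grow_sub_star V W) \<union> set_pmf (uniform_star_at_new N V)"
    | (old) s where "st' = (V, add_mset s W)" "s \<in> set_mset W \<union> set_pmf (uniform_star N V)"
    using assms W_nonempty unfolding step_kernel_eq by (auto split: if_splits)
  then show thesis
  proof cases
    case new
    then show thesis
      using that[of "Suc V" s] valid_star_grow_sub_star[of s] valid_star_uniform_star_at_new[of s] by auto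
  next
    case old
    then show thesis using that[of V s] valid valid_star_uniform_star[of s] by auto
  qed
qed

lemma reachable_step:
  assumes "(V', W') \<in> set_pmf (step_kernel N p r q (V, W))"
  shows "reachable N (Suc n) V' W'"
proof -
  obtain s where s: "W' = add_mset s W" "V' = V \<or> V' = Suc V"
    "valid_star N V' s" "V' = Suc V \<Longrightarrow> V = fst s \<or> V \<in> snd s"
    using assms by (elim step_kernel_cases) auto
  have "valid_star N V' t" if "t \<in># W" for t
    using valid that s(2) valid_star_mono[of N V t V'] by auto
  moreover have "\<exists>t\<in>#W'. v = fst t \<or> v \<in> snd t" if "v < V'" for v
  proof (cases "v < V")
    case True
    then show ?thesis using covered s(1) by auto
  next
    case False
    then have "V' = Suc V" "v = V" using s(2) that by auto
    then show ?thesis using s(1,4) by auto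
  qed
  ultimately show ?thesis using s size_W V_ge V_le by (auto simp: reachable_def)
qed

lemma finite_step_kernel: "finite (set_pmf (step_kernel N p r q (V, W)))"
  unfolding step_kernel_eq using W_nonempty finite_grow_sub_star finite_uniform_star_at_new finite_uniform_star
  by auto

lemma expectation_step_kernel:
  fixes f :: "sstate \<Rightarrow> real"
  assumes "0 \<le> p" "p \<le> 1" "0 \<le> r" "r \<le> 1" "0 \<le> q" "q \<le> 1"
  shows "measure_pmf.expectation (step_kernel N p r q (V, W)) f =
    p * (r * measure_pmf.expectation (grow_sub_star V W) (\<lambda>s. f (Suc V, add_mset s W))
         + (1 - r) * measure_pmf.expectation (uniform_star_at_new N V) (\<lambda>s. f (Suc V, add_mset s W)))
    + (1 - p) * (q * measure_pmf.expectation (pmf_of_multiset W) (\<lambda>s. f (V, add_mset s W))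
         + (1 - q) * measure_pmf.expectation (uniform_star N V) (\<lambda>s. f (V, add_mset s W)))"
proof -
  have fin: "finite (set_pmf (if b then grow_sub_star V W else uniform_star_at_new N V))"
    "finite (set_pmf (if b then pmf_of_multiset W else uniform_star N V))" for b
    using W_nonempty finite_grow_sub_star finite_uniform_star_at_new finite_uniform_star by auto
  have fin2: "finite (set_pmf (bind_pmf (bernoulli_pmf z) (\<lambda>b. if b then grow_sub_star V W else uniform_star_at_new N V)))"
    "finite (set_pmf (bind_pmf (bernoulli_pmf z) (\<lambda>b. if b then pmf_of_multiset W else uniform_star N V)))" for z
    unfolding set_bind_pmf by (rule finite_UN_I[OF finite], rule fin)+
  show ?thesis
    unfolding step_kernel_eq
    apply (subst expectation_bind_bernoulli)
       apply (simp_all add: assms fin2 if_split del: set_bind_pmf)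
    apply (subst (1 2) expectation_bind_bernoulli)
    apply (simp_all add: assms fin if_split)
    done
qed

lemma expectation_num_vertices_step:
  assumes "0 \<le> p" "p \<le> 1" "0 \<le> r" "r \<le> 1" "0 \<le> q" "q \<le> 1"
  shows "measure_pmf.expectation (step_kernel N p r q (V, W)) (\<lambda>st. real (fst st)) = real V + p"
  unfolding expectation_step_kernel[OF assms] by (simp add: algebra_simps)

text \<open>The preferential options contribute the part divided by \<open>n + 1\<close>, the
  uniform ones the part divided by \<open>V\<close>. The latter is written with an explicit factor
  \<open>p\<close>, since \<open>p / V\<close> is comparable to \<open>1 / (n + 1)\<close>. The
  error is that of option II/2 alone.\<close>

lemma expected_tcount_step:
  assumes p: "0 < p" "p \<le> 1" and r: "0 \<le> r" "r \<le> 1" and q: "0 \<le> q" "q \<le> 1"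
  shows "\<bar>measure_pmf.expectation (step_kernel N p r q (V, W)) (\<lambda>st. tcount (fst st) (snd st) (d, a, b))
    - (tcount V W (d, a, b) + p * ((1 - r) * of_bool ((d, a, b) = (int N - 1, 1, 0)) + r * of_bool ((d, a, b) = (1, 0, 1)))
      + (alpha11 p r q * (of_int a - 1) * tcount V W (d - 1, a - 1, b)
         + alpha12 p r q * (of_int a - 1) * tcount V W (d, a - 1, b)
         + alpha2 N p r q * (of_int b - 1) * tcount V W (d, a, b - 1)
         - (alpha1 p r q * of_int a + alpha2 N p r q * of_int b) * tcount V W (d, a, b)) / (real n + 1)
      + p * (beta1 p r q * tcount V W (d - (int N - 1), a - 1, b) + beta2 N p r q * tcount V W (d - 1, a, b - 1)
         - beta N p r q * tcount V W (d, a, b)) / real V)\<bar>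
    \<le> 2 * real (nat d) * (real N)\<^sup>2 / real V"
proof -
  let ?k = "(d, a, b)"
  let ?T = "tcount V W"
  let ?S = "\<lambda>s. \<Sum>v<V. of_bool (vtype (add_mset s W) v = ?k) :: real"
  have tc: "tcount V (add_mset s W) ?k = ?S s" "tcount (Suc V) (add_mset s W) ?k = ?S s + of_bool (vtype (add_mset s W) V = ?k)" for s
    by (simp_all add: tcount_def del: sum_of_bool_eq)
  have E1: "measure_pmf.expectation (grow_sub_star V W) (\<lambda>s. tcount (Suc V) (add_mset s W) ?k)
     = measure_pmf.expectation (grow_sub_star V W) ?S + of_bool (?k = (1, 0, 1))"
  proof -
    have "measure_pmf.expectation (grow_sub_star V W) (\<lambda>s. tcount (Suc V) (add_mset s W) ?k)
      = measure_pmf.expectation (grow_sub_star V W) (\<lambda>s. ?S s + of_bool (?k = (1, 0, 1)))"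
      by (rule expectation_cong_pmf) (simp only: tc valid_star_grow_sub_star eq_commute[of "(1, 0, 1)"])
    then show ?thesis
      by (simp add: Bochner_Integration.integral_add[OF integrable_measure_pmf_finite[OF finite_grow_sub_star] integrable_measure_pmf_finite[OF finite_grow_sub_star]] del: sum_of_bool_eq)
  qed
  have E2: "measure_pmf.expectation (uniform_star_at_new N V) (\<lambda>s. tcount (Suc V) (add_mset s W) ?k)
     = measure_pmf.expectation (uniform_star_at_new N V) ?S + of_bool (?k = (int N - 1, 1, 0))"
  proof -
    have "measure_pmf.expectation (uniform_star_at_new N V) (\<lambda>s. tcount (Suc V) (add_mset s W) ?k)
      = measure_pmf.expectation (uniform_star_at_new N V) (\<lambda>s. ?S s + of_bool (?k = (int N - 1, 1, 0)))"
      by (rule expectation_cong_pmf) (simp only: tc valid_star_uniform_star_at_new eq_commute[of "(int N - 1, 1, 0)"])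
    then show ?thesis
      by (simp add: Bochner_Integration.integral_add[OF integrable_measure_pmf_finite[OF finite_uniform_star_at_new] integrable_measure_pmf_finite[OF finite_uniform_star_at_new]] del: sum_of_bool_eq)
  qed
  \<comment> \<open>\<open>F4\<close> is the value that option II/2 would have if its star never
    repeated a pair; the true value \<open>E4\<close> stays opaque during the algebra.\<close>
  define F4 where "F4 = ?T ?k + 1 / real V * (?T (d - (int N - 1), a - 1, b) - ?T ?k)
      + (real N - 1) / real V * (?T (d - 1, a, b - 1) - ?T ?k)"
  define E4 where "E4 = measure_pmf.expectation (uniform_star N V) ?S"
  have E4: "\<bar>E4 - F4\<bar> \<le> 2 * real (nat d) * (real N)\<^sup>2 / real V"
    unfolding E4_def F4_def by (rule expected_tcount_uniform_star)
  define m w where "m = 1 / (real n + 1)" and "w = 1 / real V"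
  have m: "x / (real n + 1) = x * m" and w: "x / real V = x * w" for x by (simp_all add: m_def w_def)
  define h where "h = (real N - 2) / (real N - 1)"
  \<comment> \<open>Multiplication by \<open>p\<close> clears the only denominators, so that the
    comparison of coefficients becomes polynomial.\<close>
  have coeffs: "alpha2 N p r q = p * r * h + (1 - p) * q" "p * beta1 p r q = (1 - p) * (1 - q)"
    "p * beta2 N p r q = (real N - 1) * (p * (1 - r) + (1 - p) * (1 - q))"
    using p by (auto simp: alpha2_def beta1_def beta2_def h_def field_simps)
  have "measure_pmf.expectation (step_kernel N p r q (V, W)) (\<lambda>st. tcount (fst st) (snd st) ?k)
     = p * (r * (?T ?k + ((of_int a - 1) * ?T (d - 1, a - 1, b) - of_int a * ?T ?k) * m
         + h * ((of_int b - 1) * ?T (d, a, b - 1) - of_int b * ?T ?k) * m + of_bool (?k = (1, 0, 1)))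
       + (1 - r) * (?T ?k + (real N - 1) * w * (?T (d - 1, a, b - 1) - ?T ?k) + of_bool (?k = (int N - 1, 1, 0))))
     + (1 - p) * (q * (?T ?k + ((of_int a - 1) * ?T (d, a - 1, b) - of_int a * ?T ?k) * m
         + ((of_int b - 1) * ?T (d, a, b - 1) - of_int b * ?T ?k) * m) + (1 - q) * E4)"
    using p r q unfolding E4_def
    by (subst expectation_step_kernel)
      (simp_all only: fst_conv snd_conv E1 E2 expected_tcount_grow_sub_star expected_tcount_uniform_star_at_new
        expected_tcount_pmf_of_multiset tc(1) m w h_def less_imp_le)
  also have "\<dots> = ?T ?k + p * ((1 - r) * of_bool (?k = (int N - 1, 1, 0)) + r * of_bool (?k = (1, 0, 1)))
      + (alpha11 p r q * (of_int a - 1) * ?T (d - 1, a - 1, b)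
         + alpha12 p r q * (of_int a - 1) * ?T (d, a - 1, b)
         + (p * r * h + (1 - p) * q) * (of_int b - 1) * ?T (d, a, b - 1)
         - (alpha1 p r q * of_int a + (p * r * h + (1 - p) * q) * of_int b) * ?T ?k) * m
      + ((1 - p) * (1 - q) * ?T (d - (int N - 1), a - 1, b) + (real N - 1) * (p * (1 - r) + (1 - p) * (1 - q)) * ?T (d - 1, a, b - 1)
         - ((1 - p) * (1 - q) + (real N - 1) * (p * (1 - r) + (1 - p) * (1 - q))) * ?T ?k) * w
      + (1 - p) * (1 - q) * (E4 - F4)"
    unfolding alpha1_def alpha11_def alpha12_def F4_def w by (simp add: algebra_simps)
  also have "\<dots> = ?T ?k + p * ((1 - r) * of_bool (?k = (int N - 1, 1, 0)) + r * of_bool (?k = (1, 0, 1)))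
      + (alpha11 p r q * (of_int a - 1) * ?T (d - 1, a - 1, b)
         + alpha12 p r q * (of_int a - 1) * ?T (d, a - 1, b)
         + alpha2 N p r q * (of_int b - 1) * ?T (d, a, b - 1)
         - (alpha1 p r q * of_int a + alpha2 N p r q * of_int b) * ?T ?k) * m
      + p * (beta1 p r q * ?T (d - (int N - 1), a - 1, b) + beta2 N p r q * ?T (d - 1, a, b - 1)
         - beta N p r q * ?T ?k) * w
      + (1 - p) * (1 - q) * (E4 - F4)"
    unfolding coeffs(1) beta_def right_diff_distrib distrib_left distrib_right mult.assoc[symmetric] coeffs(2)
    unfolding mult.assoc[symmetric] coeffs(2,3) by (simp add: algebra_simps)
  finally have eq: "measure_pmf.expectation (step_kernel N p r q (V, W)) (\<lambda>st. tcount (fst st) (snd st) ?k) = \<dots>" .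
  have "\<bar>(1 - p) * (1 - q) * (E4 - F4)\<bar> = ((1 - p) * (1 - q)) * \<bar>E4 - F4\<bar>"
    using p q by (simp add: abs_mult)
  also have "\<dots> \<le> 1 * \<bar>E4 - F4\<bar>"
    using p q by (intro mult_right_mono mult_le_one) auto
  finally show ?thesis using E4 unfolding eq m w by simp
qed

end

section \<open>Second moments along finitely supported Markov chains\<close>

text \<open>With finite supports every expectation is a finite sum, so integrability is automatic.
  The chain may be inhomogeneous in its test functions, not in its kernel.\<close>

locale finite_chain =
  fixes K :: "'s \<Rightarrow> 's pmf" and law :: "nat \<Rightarrow> 's pmf"
  assumes law_Suc: "law (Suc n) = bind_pmf (law n) K"
    and finite_law: "finite (set_pmf (law n))"
    and finite_K: "s \<in> set_pmf (law n) \<Longrightarrow> finite (set_pmf (K s))"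
begin

abbreviation E :: "nat \<Rightarrow> ('s \<Rightarrow> real) \<Rightarrow> real" where
  "E n f \<equiv> measure_pmf.expectation (law n) f"

lemma integrable_law: "integrable (measure_pmf (law n)) (f :: 's \<Rightarrow> real)"
  by (rule integrable_measure_pmf_finite[OF finite_law])

definition decays :: "(nat \<Rightarrow> 's \<Rightarrow> real) \<Rightarrow> real \<Rightarrow> bool" where
  "decays Z \<eta> \<longleftrightarrow> (\<exists>B. \<forall>n. E n (\<lambda>s. \<bar>Z n s\<bar>) \<le> B * (real n + 1) powr (- \<eta>))"

lemma decaysE:
  assumes "decays Z \<eta>"
  obtains B where "0 \<le> B" "\<And>n. E n (\<lambda>s. \<bar>Z n s\<bar>) \<le> B * (real n + 1) powr (- \<eta>)"
proof -
  obtain B where B: "\<And>n. E n (\<lambda>s. \<bar>Z n s\<bar>) \<le> B * (real n + 1) powr (- \<eta>)"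
    using assms unfolding decays_def by blast
  have "0 \<le> E 0 (\<lambda>s. \<bar>Z 0 s\<bar>)" by (rule integral_nonneg_AE) simp
  also have "\<dots> \<le> B" using B[of 0] by simp
  finally show thesis using that B by blast
qed

lemma decays_mono:
  assumes "decays Z \<eta>" "\<theta> \<le> \<eta>"
  shows "decays Z \<theta>"
proof -
  obtain B where B: "0 \<le> B" "\<And>n. E n (\<lambda>s. \<bar>Z n s\<bar>) \<le> B * (real n + 1) powr (- \<eta>)"
    using assms(1) by (rule decaysE) (rule that)
  have "E n (\<lambda>s. \<bar>Z n s\<bar>) \<le> B * (real n + 1) powr (- \<theta>)" for n
    by (rule order_trans[OF B(2)]) (use B(1) assms(2) in \<open>auto intro!: mult_left_mono powr_mono\<close>)
  then show ?thesis unfolding decays_def by blast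
qed

lemma decays_add:
  assumes "decays Z \<eta>" "decays Z' \<eta>"
  shows "decays (\<lambda>n s. Z n s + Z' n s) \<eta>"
proof -
  obtain B where B: "\<And>n. E n (\<lambda>s. \<bar>Z n s\<bar>) \<le> B * (real n + 1) powr (- \<eta>)"
    using assms(1) by (rule decaysE) (rule that)
  obtain B' where B': "\<And>n. E n (\<lambda>s. \<bar>Z' n s\<bar>) \<le> B' * (real n + 1) powr (- \<eta>)"
    using assms(2) by (rule decaysE) (rule that)
  have "E n (\<lambda>s. \<bar>Z n s + Z' n s\<bar>) \<le> (B + B') * (real n + 1) powr (- \<eta>)" for n
  proof -
    have "E n (\<lambda>s. \<bar>Z n s + Z' n s\<bar>) \<le> E n (\<lambda>s. \<bar>Z n s\<bar> + \<bar>Z' n s\<bar>)"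
      by (rule expectation_mono_pmf[OF finite_law]) simp
    also have "\<dots> = E n (\<lambda>s. \<bar>Z n s\<bar>) + E n (\<lambda>s. \<bar>Z' n s\<bar>)"
      by (rule Bochner_Integration.integral_add) (rule integrable_law)+
    finally show ?thesis using B[of n] B'[of n] by (simp add: algebra_simps)
  qed
  then show ?thesis unfolding decays_def by blast
qed

lemma decays_cmult:
  assumes "decays Z \<eta>"
  shows "decays (\<lambda>n s. c * Z n s) \<eta>"
proof -
  obtain B where B: "\<And>n. E n (\<lambda>s. \<bar>Z n s\<bar>) \<le> B * (real n + 1) powr (- \<eta>)"
    using assms by (rule decaysE) (rule that)
  have "E n (\<lambda>s. \<bar>c * Z n s\<bar>) \<le> \<bar>c\<bar> * B * (real n + 1) powr (- \<eta>)" for n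
    using mult_left_mono[OF B[of n], of "\<bar>c\<bar>"] by (simp add: abs_mult mult_ac)
  then show ?thesis unfolding decays_def by blast
qed

lemma decays_abs: "decays Z \<eta> \<Longrightarrow> decays (\<lambda>n s. \<bar>Z n s\<bar>) \<eta>"
  by (simp add: decays_def)

lemma decays_inverse: "decays (\<lambda>n s. 1 / (real n + 1)) 1"
  unfolding decays_def by (rule exI[of _ 1]) (simp add: powr_minus powr_one field_simps)

text \<open>A linear bound on \<open>Y\<close> gives the case \<open>\<epsilon> = 0\<close>, so
  \<open>\<epsilon>\<close> measures what is gained over it. The value 1 is the order of a
  martingale with bounded increments.\<close>

definition l2_bounded :: "(nat \<Rightarrow> 's \<Rightarrow> real) \<Rightarrow> real \<Rightarrow> bool" where
  "l2_bounded Y \<epsilon> \<longleftrightarrow> (\<exists>B. \<forall>n. E n (\<lambda>s. (Y n s)\<^sup>2) \<le> B * (real n + 1) powr (2 - \<epsilon>))"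

text \<open>A weighted arithmetic-geometric mean inequality plays the role of Cauchy--Schwarz,
  pointwise before expectations are taken.\<close>

lemma l2_bounded_decays:
  assumes "l2_bounded Y \<epsilon>"
  shows "decays (\<lambda>n s. Y n s / (real n + 1)) (\<epsilon> / 2)"
proof -
  obtain B where B: "\<And>n. E n (\<lambda>s. (Y n s)\<^sup>2) \<le> B * (real n + 1) powr (2 - \<epsilon>)"
    using assms unfolding l2_bounded_def by blast
  have "E n (\<lambda>s. \<bar>Y n s / (real n + 1)\<bar>) \<le> (B + 1) / 2 * (real n + 1) powr (- (\<epsilon> / 2))" for n
  proof -
    \<comment> \<open>This weight balances the two terms: \<open>c\<close> times the normalised
      second moment and \<open>1 / c\<close> both have order
      \<open>m powr (- (\<epsilon> / 2))\<close>.\<close>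
    define c where "c = (real n + 1) powr (\<epsilon> / 2)"
    define m where "m = real n + 1"
    have m: "m > 0" and c: "c > 0" by (auto simp: m_def c_def)
    have "c * c = m powr \<epsilon>" by (simp add: c_def m_def flip: powr_add)
    then have cc: "m powr (2 - \<epsilon>) * (c * c) = m\<^sup>2"
      using m by (simp add: powr_diff powr_numeral)
    have "\<bar>Y n s / m\<bar> \<le> c / (2 * m\<^sup>2) * (Y n s)\<^sup>2 + 1 / (2 * c)" for s
    proof -
      have "0 \<le> (c * \<bar>Y n s\<bar> - m)\<^sup>2 / (2 * c * m\<^sup>2)" using c by simp
      also have "\<dots> = c / (2 * m\<^sup>2) * (Y n s)\<^sup>2 + 1 / (2 * c) - \<bar>Y n s\<bar> / m"
        using m c by (simp add: power2_eq_square field_simps)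
      finally show ?thesis using m by (simp add: abs_divide)
    qed
    then have "E n (\<lambda>s. \<bar>Y n s / m\<bar>) \<le> E n (\<lambda>s. c / (2 * m\<^sup>2) * (Y n s)\<^sup>2 + 1 / (2 * c))"
      by (intro expectation_mono_pmf finite_law)
    also have "\<dots> = c / (2 * m\<^sup>2) * E n (\<lambda>s. (Y n s)\<^sup>2) + 1 / (2 * c)"
      by (subst Bochner_Integration.integral_add) (auto intro: integrable_law)
    also have "\<dots> \<le> c / (2 * m\<^sup>2) * (B * m powr (2 - \<epsilon>)) + 1 / (2 * c)"
      using B[of n] c by (intro add_right_mono mult_left_mono) (auto simp: m_def)
    also have "\<dots> = (B + 1) / 2 * (1 / c)"
    proof -
      have h: "c * m powr (2 - \<epsilon>) = m\<^sup>2 * (1 / c)" using cc c by (simp add: field_simps)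
      have "c / (2 * m\<^sup>2) * (B * m powr (2 - \<epsilon>)) = B / (2 * m\<^sup>2) * (c * m powr (2 - \<epsilon>))"
        by simp
      also have "\<dots> = B / 2 * (1 / c)"
        unfolding h using m by simp
      finally show ?thesis by (simp add: distrib_right add_divide_distrib)
    qed
    also have "1 / c = m powr (- (\<epsilon> / 2))" by (simp add: c_def m_def powr_minus_divide)
    finally show ?thesis by (simp add: m_def)
  qed
  then show ?thesis unfolding decays_def by blast
qed

lemma expectation_law_Suc:
  fixes f :: "'s \<Rightarrow> real"
  shows "E (Suc n) f = E n (\<lambda>s. measure_pmf.expectation (K s) f)"
  unfolding law_Suc by (rule expectation_bind_pmf[OF finite_law finite_K])

text \<open>The crude bound \<open>\<bar>Y n\<bar> \<le> C (n + 1)\<close> is used to estimate the drift contribution to the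
  second moment; this halves the exponent at each application but needs no martingale theory.\<close>
lemma l2_bounded_of_drift:
  assumes C: "\<And>n s. s \<in> set_pmf (law n) \<Longrightarrow> \<bar>Y n s\<bar> \<le> C * (real n + 1)"
    and lip: "\<And>n s t. s \<in> set_pmf (law n) \<Longrightarrow> t \<in> set_pmf (K s) \<Longrightarrow> \<bar>Y (Suc n) t - Y n s\<bar> \<le> C"
    and g: "\<And>n. 0 \<le> g n"
    and drift: "\<And>n s. s \<in> set_pmf (law n) \<Longrightarrow>
        \<bar>measure_pmf.expectation (K s) (Y (Suc n)) - Y n s + g n * Y n s\<bar> \<le> R n s"
    and R: "decays R \<epsilon>" and \<epsilon>: "\<epsilon> \<le> 1"
  shows "l2_bounded Y \<epsilon>"
proof -
  obtain D where D: "0 \<le> D" "\<And>n. E n (\<lambda>s. \<bar>R n s\<bar>) \<le> D * (real n + 1) powr (- \<epsilon>)"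
    using R by (rule decaysE) (rule that)
  obtain s0 where "s0 \<in> set_pmf (law 0)" using set_pmf_not_empty by fast
  then have C0: "0 \<le> C" using C[of s0 0] by simp
  have step: "measure_pmf.expectation (K s) (\<lambda>t. (Y (Suc n) t)\<^sup>2) \<le> (Y n s)\<^sup>2 + (2 * C * (real n + 1) * \<bar>R n s\<bar> + C\<^sup>2)"
    if s: "s \<in> set_pmf (law n)" for n s
  proof -
    note int = integrable_measure_pmf_finite[OF finite_K[OF s]]
    let ?y = "Y n s"
    let ?\<delta> = "measure_pmf.expectation (K s) (Y (Suc n)) - ?y"
    \<comment> \<open>The squared increment is at most \<open>C\<^sup>2\<close>; expanding it leaves
      an expression linear in \<open>Y (Suc n)\<close>, to which the drift hypothesis
      applies.\<close>
    have "measure_pmf.expectation (K s) (\<lambda>t. (Y (Suc n) t)\<^sup>2)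
        \<le> measure_pmf.expectation (K s) (\<lambda>t. 2 * ?y * Y (Suc n) t + (C\<^sup>2 - ?y\<^sup>2))"
    proof (rule expectation_mono_pmf[OF finite_K[OF s]])
      fix t assume "t \<in> set_pmf (K s)"
      then have "\<bar>Y (Suc n) t - ?y\<bar>\<^sup>2 \<le> C\<^sup>2" using lip[OF s] by (intro power_mono) auto
      then show "(Y (Suc n) t)\<^sup>2 \<le> 2 * ?y * Y (Suc n) t + (C\<^sup>2 - ?y\<^sup>2)"
        by (simp add: power2_eq_square algebra_simps)
    qed
    also have "\<dots> = 2 * ?y * measure_pmf.expectation (K s) (Y (Suc n)) + (C\<^sup>2 - ?y\<^sup>2)"
      by (subst Bochner_Integration.integral_add) (auto intro: int)
    also have "\<dots> = ?y\<^sup>2 + 2 * (?y * ?\<delta>) + C\<^sup>2"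
      by (simp add: power2_eq_square algebra_simps)
    also have "?y * ?\<delta> \<le> C * (real n + 1) * \<bar>R n s\<bar>"
    proof -
      \<comment> \<open>The restoring part of the drift enters as \<open>- g n * ?y\<^sup>2\<close>
        and is dropped, so its size is irrelevant and only its sign counts.\<close>
      have "?y * ?\<delta> = ?y * (?\<delta> + g n * ?y) - g n * ?y\<^sup>2" by (simp add: power2_eq_square algebra_simps)
      also have "\<dots> \<le> \<bar>?y * (?\<delta> + g n * ?y)\<bar>" using g[of n] by (smt (verit) mult_nonneg_nonneg zero_le_power2)
      also have "\<dots> = \<bar>?y\<bar> * \<bar>?\<delta> + g n * ?y\<bar>" by (rule abs_mult)
      also have "\<dots> \<le> (C * (real n + 1)) * \<bar>R n s\<bar>"
        using C[OF s] drift[OF s] C0 by (intro mult_mono) auto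
      finally show ?thesis .
    qed
    finally show ?thesis by simp
  qed
  define B where "B = 2 * C * D + C\<^sup>2"
  have B0: "0 \<le> B" unfolding B_def using C0 D(1) by simp
  have rec: "E (Suc n) (\<lambda>s. (Y (Suc n) s)\<^sup>2) \<le> E n (\<lambda>s. (Y n s)\<^sup>2) + B * (real n + 1) powr (1 - \<epsilon>)" for n
  proof -
    have "E (Suc n) (\<lambda>s. (Y (Suc n) s)\<^sup>2) \<le> E n (\<lambda>s. (Y n s)\<^sup>2 + (2 * C * (real n + 1) * \<bar>R n s\<bar> + C\<^sup>2))"
      unfolding expectation_law_Suc by (rule expectation_mono_pmf[OF finite_law step])
    also have "\<dots> = E n (\<lambda>s. (Y n s)\<^sup>2) + (2 * C * (real n + 1) * E n (\<lambda>s. \<bar>R n s\<bar>) + C\<^sup>2)"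
      by (subst Bochner_Integration.integral_add, rule integrable_law, rule integrable_law,
          subst Bochner_Integration.integral_add, rule integrable_law, rule integrable_law) simp
    also have "2 * C * (real n + 1) * E n (\<lambda>s. \<bar>R n s\<bar>) \<le> 2 * C * (real n + 1) * (D * (real n + 1) powr (- \<epsilon>))"
      using D(2)[of n] C0 by (intro mult_left_mono) auto
    also have "\<dots> = 2 * C * D * (real n + 1) powr (1 - \<epsilon>)"
      by (simp add: powr_diff powr_minus field_simps)
    also have "C\<^sup>2 \<le> C\<^sup>2 * (real n + 1) powr (1 - \<epsilon>)"
      using \<epsilon> ge_one_powr_ge_zero[of "real n + 1" "1 - \<epsilon>"] by (intro mult_le_cancel_left1[THEN iffD2]) auto
    finally show ?thesis by (simp add: B_def algebra_simps)
  qed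
  \<comment> \<open>The summand \<open>C\<^sup>2\<close> covers time 0. The induction step is
    \<open>m powr (2 - \<epsilon>) + m powr (1 - \<epsilon>) = (m + 1) * m powr (1 - \<epsilon>)
    \<le> (m + 1) powr (2 - \<epsilon>)\<close>, where \<open>\<epsilon> \<le> 1\<close> is
    used.\<close>
  have "E n (\<lambda>s. (Y n s)\<^sup>2) \<le> (B + C\<^sup>2) * (real n + 1) powr (2 - \<epsilon>)" for n
  proof (induction n)
    case 0
    have "E 0 (\<lambda>s. (Y 0 s)\<^sup>2) \<le> E 0 (\<lambda>s. C\<^sup>2)"
    proof (rule expectation_mono_pmf[OF finite_law])
      fix s assume "s \<in> set_pmf (law 0)"
      then have "\<bar>Y 0 s\<bar>\<^sup>2 \<le> C\<^sup>2" using C[of s 0] by (intro power_mono) auto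
      then show "(Y 0 s)\<^sup>2 \<le> C\<^sup>2" by simp
    qed
    then show ?case using B0 by simp
  next
    case (Suc n)
    let ?m = "real n + 1"
    have "E (Suc n) (\<lambda>s. (Y (Suc n) s)\<^sup>2) \<le> (B + C\<^sup>2) * ?m powr (2 - \<epsilon>) + (B + C\<^sup>2) * ?m powr (1 - \<epsilon>)"
    proof -
      have "B * ?m powr (1 - \<epsilon>) \<le> (B + C\<^sup>2) * ?m powr (1 - \<epsilon>)" by (intro mult_right_mono) auto
      then show ?thesis using rec[of n] Suc by linarith
    qed
    also have "?m powr (2 - \<epsilon>) = ?m * ?m powr (1 - \<epsilon>)"
      using powr_add[of ?m 1 "1 - \<epsilon>"] by simp
    also have "(B + C\<^sup>2) * (?m * ?m powr (1 - \<epsilon>)) + (B + C\<^sup>2) * ?m powr (1 - \<epsilon>) = (B + C\<^sup>2) * ((?m + 1) * ?m powr (1 - \<epsilon>))"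
      by (simp add: algebra_simps)
    also have "\<dots> \<le> (B + C\<^sup>2) * ((?m + 1) * (?m + 1) powr (1 - \<epsilon>))"
      using B0 \<epsilon> by (intro mult_left_mono powr_mono2) auto
    also have "(?m + 1) * (?m + 1) powr (1 - \<epsilon>) = (?m + 1) powr (2 - \<epsilon>)"
      using powr_add[of "?m + 1" 1 "1 - \<epsilon>"] by simp
    finally show ?case by (simp add: add_ac)
  qed
  then show ?thesis unfolding l2_bounded_def by blast
qed

end

section \<open>Deviations of the type counts\<close>

lemma reachable_initial:
  assumes "3 \<le> N"
  shows "reachable N 0 (fst (initial_state N)) (snd (initial_state N))"
  using assms by (auto simp: reachable_def initial_state_def valid_star_def)

section \<open>The chain of states, the vertex number and the limiting frequencies\<close>

locale star_params =
  fixes N :: nat and p r q :: real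
  assumes N3: "3 \<le> N" and p: "0 < p" "p \<le> 1" and r: "0 \<le> r" "r \<le> 1" and q: "0 \<le> q" "q \<le> 1"
begin

text \<open>The law of the state at a single time. It allows moments to be computed without any
  process; \<open>prob_eq_pmf\<close> later identifies it with the law of
  \<open>G n\<close>.\<close>

primrec state_law :: "nat \<Rightarrow> sstate pmf" where
  "state_law 0 = return_pmf (initial_state N)"
| "state_law (Suc n) = bind_pmf (state_law n) (step_kernel N p r q)"

lemma reachable_state_law:
  assumes "st \<in> set_pmf (state_law n)"
  shows "reachable_state N n (fst st) (snd st)"
  using assms
proof (induction n arbitrary: st)
  case 0
  then show ?case using reachable_initial N3 by (simp add: reachable_state_def)
next
  case (Suc n)
  then obtain st0 where st0: "st0 \<in> set_pmf (state_law n)" "st \<in> set_pmf (step_kernel N p r q st0)"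
    by auto
  interpret reachable_state N n "fst st0" "snd st0" by (rule Suc.IH[OF st0(1)])
  show ?case using reachable_step[of "fst st" "snd st" p r q] st0(2) N3 by (simp add: reachable_state_def)
qed

sublocale finite_chain "step_kernel N p r q" state_law
proof
  show fin: "finite (set_pmf (step_kernel N p r q st))" if "st \<in> set_pmf (state_law n)" for n st
    using reachable_state.finite_step_kernel[OF reachable_state_law[OF that], of p r q] by simp
  show "finite (set_pmf (state_law n))" for n
    by (induction n) (auto intro: fin)
qed simp

lemma step_kernel_lipschitz:
  assumes "st \<in> set_pmf (state_law n)" "st' \<in> set_pmf (step_kernel N p r q st)"
  shows "\<bar>tcount (fst st') (snd st') k - tcount (fst st) (snd st) k\<bar> \<le> real N + 2"
    and "\<bar>real (fst st') - real (fst st)\<bar> \<le> 1"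
proof -
  interpret reachable_state N n "fst st" "snd st" by (rule reachable_state_law[OF assms(1)])
  have "st' \<in> set_pmf (step_kernel N p r q (fst st, snd st))" using assms(2) by simp
  then obtain s V' where s: "st' = (V', add_mset s (snd st))" "V' = fst st \<or> V' = Suc (fst st)" "valid_star N V' s"
    by (rule step_kernel_cases)
  show "\<bar>tcount (fst st') (snd st') k - tcount (fst st) (snd st) k\<bar> \<le> real N + 2"
    unfolding s(1) fst_conv snd_conv
    by (rule tcount_add_star_le[OF valid_star_finite[OF s(3)] _ s(2)]) (use s(3) in \<open>simp add: valid_star_def\<close>)
  show "\<bar>real (fst st') - real (fst st)\<bar> \<le> 1" using s by auto
qed

definition vertex_dev :: "nat \<Rightarrow> sstate \<Rightarrow> real" where
  "vertex_dev n st = real (fst st) - p * (real n + 1)"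

lemma vertex_dev_le:
  assumes "st \<in> set_pmf (state_law n)"
  shows "\<bar>vertex_dev n st\<bar> \<le> (real N + 2) * (real n + 1)"
proof -
  interpret reachable_state N n "fst st" "snd st" by (rule reachable_state_law[OF assms])
  have "real (fst st) \<le> real N + real n" using V_le by linarith
  also have "\<dots> \<le> (real N + 2) * (real n + 1)" by (simp add: algebra_simps)
  finally have "real (fst st) \<le> (real N + 2) * (real n + 1)" .
  moreover have "p * (real n + 1) \<le> (real N + 2) * (real n + 1)" "0 \<le> p * (real n + 1)"
    using p by (auto intro!: mult_right_mono)
  ultimately show ?thesis unfolding vertex_dev_def by linarith
qed

lemma vertex_dev_lipschitz:
  assumes "st \<in> set_pmf (state_law n)" "st' \<in> set_pmf (step_kernel N p r q st)"
  shows "\<bar>vertex_dev (Suc n) st' - vertex_dev n st\<bar> \<le> real N + 2"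
  using step_kernel_lipschitz(2)[OF assms] p N3 by (simp add: vertex_dev_def algebra_simps)

text \<open>A vertex is added with probability \<open>p\<close> whatever the state, so the deviation
  is a martingale: there is no drift and the best exponent 1 results.\<close>

lemma l2_bounded_vertex_dev: "l2_bounded vertex_dev 1"
proof (rule l2_bounded_of_drift[where g = "\<lambda>_. 0" and R = "\<lambda>_ _. 0" and C = "real N + 2"])
  fix n st assume st: "st \<in> set_pmf (state_law n)"
  interpret reachable_state N n "fst st" "snd st" by (rule reachable_state_law[OF st])
  have "measure_pmf.expectation (step_kernel N p r q st) (\<lambda>st'. real (fst st') - p * (real (Suc n) + 1))
    = measure_pmf.expectation (step_kernel N p r q st) (\<lambda>st'. real (fst st')) - p * (real (Suc n) + 1)"
    using finite_K[OF st] by (subst Bochner_Integration.integral_diff) (auto intro: integrable_measure_pmf_finite)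
  also have "\<dots> = real (fst st) + p - p * (real (Suc n) + 1)"
    using expectation_num_vertices_step[of p r q] p r q by simp
  finally show "\<bar>measure_pmf.expectation (step_kernel N p r q st) (vertex_dev (Suc n)) - vertex_dev n st + 0 * vertex_dev n st\<bar> \<le> 0"
    unfolding vertex_dev_def by (simp add: algebra_simps)
qed (auto simp: vertex_dev_le vertex_dev_lipschitz decays_def intro!: exI[of _ 0])

text \<open>One equation covers start values and recursion. At total weight 1 all recursive calls
  fall into the zero branch and only the source terms remain; at larger weight the source terms
  vanish. The recursion is on \<open>a + b\<close>, and \<open>d\<close> may be any integer.\<close>

function limit_freq :: "int \<Rightarrow> int \<Rightarrow> int \<Rightarrow> real" where
  "limit_freq d a b = (if a < 0 \<or> b < 0 \<or> a + b < 1 then 0 else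
     ((1 - r) * of_bool ((d, a, b) = (int N - 1, 1, 0)) + r * of_bool ((d, a, b) = (1, 0, 1))
      + alpha11 p r q * (of_int a - 1) * limit_freq (d - 1) (a - 1) b
      + alpha12 p r q * (of_int a - 1) * limit_freq d (a - 1) b
      + alpha2 N p r q * (of_int b - 1) * limit_freq d a (b - 1)
      + beta1 p r q * limit_freq (d - (int N - 1)) (a - 1) b
      + beta2 N p r q * limit_freq (d - 1) a (b - 1))
     / (alpha1 p r q * of_int a + alpha2 N p r q * of_int b + beta N p r q + 1))"
  by pat_completeness auto
termination by (relation "Wellfounded.measure (\<lambda>(d, a, b). nat (a + b))") auto

declare limit_freq.simps [simp del]

lemma params_nonneg: "0 \<le> alpha11 p r q" "0 \<le> alpha12 p r q" "0 \<le> alpha1 p r q" "0 \<le> alpha2 N p r q"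
  "0 \<le> beta1 p r q" "0 \<le> beta2 N p r q" "0 \<le> beta N p r q"
proof -
  show "0 \<le> alpha11 p r q" "0 \<le> alpha12 p r q" "0 \<le> beta1 p r q"
    using p q r by (auto simp: alpha11_def alpha12_def beta1_def)
  then show "0 \<le> alpha1 p r q" by (simp add: alpha1_def)
  show "0 \<le> alpha2 N p r q" using p q r N3 by (auto simp: alpha2_def)
  have "0 \<le> (1 - p) * (1 - q) / p" using p q by simp
  then show "0 \<le> beta2 N p r q" using r N3 by (auto simp: beta2_def)
  with \<open>0 \<le> beta1 p r q\<close> show "0 \<le> beta N p r q" by (simp add: beta_def)
qed

definition type_dev :: "int \<times> int \<times> int \<Rightarrow> nat \<Rightarrow> sstate \<Rightarrow> real" where
  "type_dev k n st = tcount (fst st) (snd st) k - p * (case k of (d, a, b) \<Rightarrow> limit_freq d a b) * (real n + 1)"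

text \<open>One constant that serves both as growth rate and as Lipschitz bound, as
  \<open>l2_bounded_of_drift\<close> requires.\<close>

definition dev_bound :: "int \<times> int \<times> int \<Rightarrow> real" where
  "dev_bound k = real N + 2 + \<bar>case k of (d, a, b) \<Rightarrow> limit_freq d a b\<bar>"

lemma type_dev_le:
  assumes "st \<in> set_pmf (state_law n)"
  shows "\<bar>type_dev k n st\<bar> \<le> dev_bound k * (real n + 1)"
proof -
  interpret reachable_state N n "fst st" "snd st" by (rule reachable_state_law[OF assms])
  let ?x = "case k of (d, a, b) \<Rightarrow> limit_freq d a b"
  have "tcount (fst st) (snd st) k \<le> real N + real n" using V_le tcount_le[of "fst st" "snd st" k] by linarith
  also have "\<dots> \<le> (real N + 2) * (real n + 1)" by (simp add: algebra_simps)
  finally have "\<bar>tcount (fst st) (snd st) k\<bar> \<le> (real N + 2) * (real n + 1)" using tcount_nonneg[of "fst st" "snd st" k] by simp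
  moreover have "\<bar>p * ?x * (real n + 1)\<bar> \<le> 1 * \<bar>?x\<bar> * (real n + 1)"
    unfolding abs_mult using p by (intro mult_mono) auto
  ultimately show ?thesis unfolding type_dev_def dev_bound_def distrib_right by linarith
qed

lemma type_dev_lipschitz:
  assumes "st \<in> set_pmf (state_law n)" "st' \<in> set_pmf (step_kernel N p r q st)"
  shows "\<bar>type_dev k (Suc n) st' - type_dev k n st\<bar> \<le> dev_bound k"
proof -
  let ?x = "case k of (d, a, b) \<Rightarrow> limit_freq d a b"
  have "type_dev k (Suc n) st' - type_dev k n st = tcount (fst st') (snd st') k - tcount (fst st) (snd st) k - p * ?x"
    by (simp add: type_dev_def algebra_simps)
  moreover have "\<bar>p * ?x\<bar> \<le> 1 * \<bar>?x\<bar>" unfolding abs_mult using p by (intro mult_right_mono) auto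
  ultimately show ?thesis using step_kernel_lipschitz(1)[OF assms, of k] unfolding dev_bound_def by linarith
qed

text \<open>\<open>p * x\<close> solves the stationary equation of the drift, so only deviations of smaller types,
  the fluctuation of the number of vertices and the \<open>O(1 / V)\<close> correction remain.\<close>
lemma type_dev_drift:
  assumes st: "st \<in> set_pmf (state_law n)" and ab: "0 \<le> a" "0 \<le> b" "1 \<le> a + b"
  defines "m \<equiv> real n + 1"
  shows "\<bar>measure_pmf.expectation (step_kernel N p r q st) (type_dev (d, a, b) (Suc n)) - type_dev (d, a, b) n st
      + (alpha1 p r q * of_int a + alpha2 N p r q * of_int b + beta N p r q) / m * type_dev (d, a, b) n st\<bar>
    \<le> alpha11 p r q * \<bar>of_int a - 1\<bar> * \<bar>type_dev (d - 1, a - 1, b) n st / m\<bar>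
      + alpha12 p r q * \<bar>of_int a - 1\<bar> * \<bar>type_dev (d, a - 1, b) n st / m\<bar>
      + alpha2 N p r q * \<bar>of_int b - 1\<bar> * \<bar>type_dev (d, a, b - 1) n st / m\<bar>
      + beta1 p r q * \<bar>type_dev (d - (int N - 1), a - 1, b) n st / m\<bar>
      + beta2 N p r q * \<bar>type_dev (d - 1, a, b - 1) n st / m\<bar>
      + (2 * beta N p r q + 2 * real (nat d) * (real N)\<^sup>2 / p) * \<bar>vertex_dev n st / m\<bar>
      + (2 * real (nat d) * (real N)\<^sup>2 / p) * (1 / m)"
proof -
  define V W where "V = fst st" and "W = snd st"
  interpret reachable_state N n V W unfolding V_def W_def by (rule reachable_state_law[OF st])
  have m: "m > 0" by (simp add: m_def)
  have V: "real V \<ge> 1" using V_ge N3 by linarith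
  define T where "T = tcount V W"
  define x where "x = limit_freq d a b"
  define x1 where "x1 = limit_freq (d - 1) (a - 1) b"
  define x2 where "x2 = limit_freq d (a - 1) b"
  define x3 where "x3 = limit_freq d a (b - 1)"
  define x4 where "x4 = limit_freq (d - (int N - 1)) (a - 1) b"
  define x5 where "x5 = limit_freq (d - 1) a (b - 1)"
  define y where "y = type_dev (d, a, b) n st / m"
  define y1 where "y1 = type_dev (d - 1, a - 1, b) n st / m"
  define y2 where "y2 = type_dev (d, a - 1, b) n st / m"
  define y3 where "y3 = type_dev (d, a, b - 1) n st / m"
  define y4 where "y4 = type_dev (d - (int N - 1), a - 1, b) n st / m"
  define y5 where "y5 = type_dev (d - 1, a, b - 1) n st / m"
  define v where "v = vertex_dev n st / m"
  define A11 A12 A2 B1 B2 where "A11 = alpha11 p r q" and "A12 = alpha12 p r q" and "A2 = alpha2 N p r q"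
    and "B1 = beta1 p r q" and "B2 = beta2 N p r q"
  define A where "A = A11 + A12"
  define B where "B = B1 + B2"
  define src where "src = (1 - r) * of_bool ((d, a, b) = (int N - 1, 1, 0)) + r * of_bool ((d, a, b) = (1, 0, 1))"
  have folds: "alpha11 p r q = A11" "alpha12 p r q = A12" "alpha2 N p r q = A2" "beta1 p r q = B1" "beta2 N p r q = B2"
    "alpha1 p r q = A" "beta N p r q = B"
    by (simp_all add: A11_def A12_def A2_def B1_def B2_def A_def B_def alpha1_def beta_def)
  have nonneg: "0 \<le> A11" "0 \<le> A12" "0 \<le> A2" "0 \<le> B1" "0 \<le> B2" "0 \<le> A" "0 \<le> B"
    using params_nonneg unfolding folds by auto
  have Tm: "T (d, a, b) / m = y + p * x" "T (d - 1, a - 1, b) / m = y1 + p * x1" "T (d, a - 1, b) / m = y2 + p * x2"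
    "T (d, a, b - 1) / m = y3 + p * x3" "T (d - (int N - 1), a - 1, b) / m = y4 + p * x4" "T (d - 1, a, b - 1) / m = y5 + p * x5"
    unfolding T_def V_def W_def type_dev_def y_def y1_def y2_def y3_def y4_def y5_def x_def x1_def x2_def x3_def x4_def x5_def
      prod.case m_def[symmetric]
    using m by (simp_all add: field_simps)
  \<comment> \<open>The defining equation with its positive denominator cleared. The summand 1
    accounts for the growth of \<open>p * x * m\<close> in one step.\<close>
  have stationary: "x * (A * of_int a + A2 * of_int b + B + 1) = src + A11 * (of_int a - 1) * x1 + A12 * (of_int a - 1) * x2
      + A2 * (of_int b - 1) * x3 + B1 * x4 + B2 * x5"
  proof -
    have "A * of_int a + A2 * of_int b + B + 1 > 0"
      using nonneg ab by (intro add_nonneg_pos add_nonneg_nonneg mult_nonneg_nonneg) auto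
    then show ?thesis
      using ab unfolding x_def src_def x1_def x2_def x3_def x4_def x5_def
      by (subst limit_freq.simps) (simp add: folds)
  qed
  \<comment> \<open>Since \<open>V / m = p + v\<close>, exchanging \<open>p / V\<close> for
    \<open>1 / m\<close> costs the factor \<open>T k / V\<close>, at most 1, times
    \<open>v\<close>.\<close>
  have pV: "\<bar>p * T k / real V - T k / m\<bar> \<le> \<bar>v\<bar>" for k
  proof -
    have "p * T k / real V - T k / m = (T k / real V) * (- v)"
      using m V unfolding v_def vertex_dev_def V_def[symmetric] m_def[symmetric] by (simp add: field_simps)
    moreover have "\<bar>T k / real V\<bar> \<le> 1"
      using V tcount_nonneg[of V W k] tcount_le[of V W k] by (simp add: T_def)
    ultimately show ?thesis using mult_right_mono[of "\<bar>T k / real V\<bar>" 1 "\<bar>v\<bar>"] by (simp add: abs_mult)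
  qed
  define e4 where "e4 = p * T (d - (int N - 1), a - 1, b) / real V - T (d - (int N - 1), a - 1, b) / m"
  define e5 where "e5 = p * T (d - 1, a, b - 1) / real V - T (d - 1, a, b - 1) / m"
  define e where "e = p * T (d, a, b) / real V - T (d, a, b) / m"
  \<comment> \<open>The same identity turns the random error \<open>1 / V\<close> into the
    deterministic \<open>1 / m\<close> plus a multiple of \<open>v\<close>. No lower bound on
    \<open>V\<close> of linear order is available here, only \<open>V \<ge> 1\<close>.\<close>
  have inv_V: "1 / real V \<le> (1 / m + \<bar>v\<bar>) / p"
  proof -
    have "1 / real V = 1 / m / p - v / (p * real V)"
      using m V p unfolding v_def vertex_dev_def V_def[symmetric] m_def[symmetric] by (simp add: field_simps)
    moreover have "\<bar>v / (p * real V)\<bar> \<le> \<bar>v\<bar> / (p * 1)"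
      unfolding abs_divide using V p by (intro frac_le) auto
    ultimately show ?thesis unfolding add_divide_distrib mult_1_right by linarith
  qed
  define Ek where "Ek = measure_pmf.expectation (step_kernel N p r q (V, W)) (\<lambda>st. tcount (fst st) (snd st) (d, a, b))"
  have Ek: "measure_pmf.expectation (step_kernel N p r q st) (type_dev (d, a, b) (Suc n)) = Ek - p * x * (m + 1)"
  proof -
    have "measure_pmf.expectation (step_kernel N p r q st) (\<lambda>st. tcount (fst st) (snd st) (d, a, b) - p * x * (m + 1))
      = measure_pmf.expectation (step_kernel N p r q st) (\<lambda>st. tcount (fst st) (snd st) (d, a, b)) - p * x * (m + 1)"
      using finite_K[OF st] by (subst Bochner_Integration.integral_diff) (auto intro: integrable_measure_pmf_finite)
    then show ?thesis by (simp add: type_dev_def[abs_def] x_def m_def Ek_def V_def W_def add_ac)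
  qed
  define D where "D = Ek - (T (d, a, b) + p * src
      + (A11 * (of_int a - 1) * T (d - 1, a - 1, b) + A12 * (of_int a - 1) * T (d, a - 1, b)
         + A2 * (of_int b - 1) * T (d, a, b - 1) - (A * of_int a + A2 * of_int b) * T (d, a, b)) / m
      + p * (B1 * T (d - (int N - 1), a - 1, b) + B2 * T (d - 1, a, b - 1) - B * T (d, a, b)) / real V)"
  have D: "\<bar>D\<bar> \<le> 2 * real (nat d) * (real N)\<^sup>2 * (1 / real V)"
    using expected_tcount_step[OF p r q, of d a b] unfolding D_def T_def Ek_def src_def m_def folds by simp
  also have "\<dots> \<le> 2 * real (nat d) * (real N)\<^sup>2 * ((1 / m + \<bar>v\<bar>) / p)"
    by (rule mult_left_mono[OF inv_V]) simp
  finally have D': "\<bar>D\<bar> \<le> 2 * real (nat d) * (real N)\<^sup>2 / p * \<bar>v\<bar> + 2 * real (nat d) * (real N)\<^sup>2 / p * (1 / m)"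
    by (simp add: algebra_simps add_divide_distrib)
  have "Ek = D + T (d, a, b) + p * src
      + (A11 * (of_int a - 1) * (T (d - 1, a - 1, b) / m) + A12 * (of_int a - 1) * (T (d, a - 1, b) / m)
         + A2 * (of_int b - 1) * (T (d, a, b - 1) / m) - (A * of_int a + A2 * of_int b) * (T (d, a, b) / m))
      + (B1 * (e4 + T (d - (int N - 1), a - 1, b) / m) + B2 * (e5 + T (d - 1, a, b - 1) / m) - B * (e + T (d, a, b) / m))"
    unfolding D_def e4_def e5_def e_def by (simp add: add_divide_distrib diff_divide_distrib algebra_simps)
  then have Ek_eq: "Ek = D + T (d, a, b) + p * src
      + (A11 * (of_int a - 1) * (y1 + p * x1) + A12 * (of_int a - 1) * (y2 + p * x2)
         + A2 * (of_int b - 1) * (y3 + p * x3) - (A * of_int a + A2 * of_int b) * (y + p * x))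
      + (B1 * (e4 + (y4 + p * x4)) + B2 * (e5 + (y5 + p * x5)) - B * (e + (y + p * x)))"
    unfolding Tm .
  have T_eq: "type_dev (d, a, b) n st = T (d, a, b) - p * x * m" "type_dev (d, a, b) n st / m = y"
    by (simp_all add: type_dev_def T_def V_def W_def x_def m_def y_def)
  have "measure_pmf.expectation (step_kernel N p r q st) (type_dev (d, a, b) (Suc n)) - type_dev (d, a, b) n st
      + (A * of_int a + A2 * of_int b + B) / m * type_dev (d, a, b) n st
     = Ek - p * x - T (d, a, b) + (A * of_int a + A2 * of_int b + B) * y"
    unfolding Ek T_eq(2)[symmetric] by (simp add: T_eq(1) algebra_simps)
  also have "\<dots> = A11 * (of_int a - 1) * y1 + A12 * (of_int a - 1) * y2 + A2 * (of_int b - 1) * y3 + B1 * y4 + B2 * y5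
      + (B1 * e4 + B2 * e5 - B * e) + D
      + p * (src + A11 * (of_int a - 1) * x1 + A12 * (of_int a - 1) * x2 + A2 * (of_int b - 1) * x3 + B1 * x4 + B2 * x5
          - x * (A * of_int a + A2 * of_int b + B + 1))"
    unfolding Ek_eq by (simp add: algebra_simps)
  also have "\<dots> = A11 * (of_int a - 1) * y1 + A12 * (of_int a - 1) * y2 + A2 * (of_int b - 1) * y3 + B1 * y4 + B2 * y5
      + (B1 * e4 + B2 * e5 - B * e) + D"
    unfolding stationary by simp
  finally have eq: "measure_pmf.expectation (step_kernel N p r q st) (type_dev (d, a, b) (Suc n)) - type_dev (d, a, b) n st
      + (A * of_int a + A2 * of_int b + B) / m * type_dev (d, a, b) n st = \<dots>" .
  have es: "\<bar>B1 * e4\<bar> \<le> B1 * \<bar>v\<bar>" "\<bar>B2 * e5\<bar> \<le> B2 * \<bar>v\<bar>" "\<bar>B * e\<bar> \<le> B * \<bar>v\<bar>"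
    using pV nonneg by (simp_all add: abs_mult e4_def e5_def e_def mult_left_mono)
  have ts: "\<bar>A11 * (of_int a - 1) * y1\<bar> \<le> A11 * \<bar>of_int a - 1\<bar> * \<bar>y1\<bar>"
     "\<bar>A12 * (of_int a - 1) * y2\<bar> \<le> A12 * \<bar>of_int a - 1\<bar> * \<bar>y2\<bar>"
     "\<bar>A2 * (of_int b - 1) * y3\<bar> \<le> A2 * \<bar>of_int b - 1\<bar> * \<bar>y3\<bar>"
     "\<bar>B1 * y4\<bar> \<le> B1 * \<bar>y4\<bar>" "\<bar>B2 * y5\<bar> \<le> B2 * \<bar>y5\<bar>"
    using nonneg by (simp_all add: abs_mult)
  have triangle: "\<bar>t1 + t2 + t3 + t4 + t5 + (s1 + s2 - s3) + D\<bar> \<le> c1 + c2 + c3 + c4 + c5 + (u1 + u2 + u3) + c6"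
    if "\<bar>s1\<bar> \<le> u1" "\<bar>s2\<bar> \<le> u2" "\<bar>s3\<bar> \<le> u3"
      "\<bar>t1\<bar> \<le> c1" "\<bar>t2\<bar> \<le> c2" "\<bar>t3\<bar> \<le> c3" "\<bar>t4\<bar> \<le> c4" "\<bar>t5\<bar> \<le> c5" "\<bar>D\<bar> \<le> c6"
    for t1 t2 t3 t4 t5 s1 s2 s3 D c1 c2 c3 c4 c5 c6 u1 u2 u3 :: real
    using that unfolding abs_le_iff by linarith
  have "\<bar>A11 * (of_int a - 1) * y1 + A12 * (of_int a - 1) * y2 + A2 * (of_int b - 1) * y3 + B1 * y4 + B2 * y5
      + (B1 * e4 + B2 * e5 - B * e) + D\<bar>
    \<le> A11 * \<bar>of_int a - 1\<bar> * \<bar>y1\<bar> + A12 * \<bar>of_int a - 1\<bar> * \<bar>y2\<bar> + A2 * \<bar>of_int b - 1\<bar> * \<bar>y3\<bar>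
      + B1 * \<bar>y4\<bar> + B2 * \<bar>y5\<bar> + (B1 * \<bar>v\<bar> + B2 * \<bar>v\<bar> + B * \<bar>v\<bar>)
      + (2 * real (nat d) * (real N)\<^sup>2 / p * \<bar>v\<bar> + 2 * real (nat d) * (real N)\<^sup>2 / p * (1 / m))"
    by (rule triangle[OF es ts D'])
  also have "\<dots> = A11 * \<bar>of_int a - 1\<bar> * \<bar>y1\<bar> + A12 * \<bar>of_int a - 1\<bar> * \<bar>y2\<bar> + A2 * \<bar>of_int b - 1\<bar> * \<bar>y3\<bar>
      + B1 * \<bar>y4\<bar> + B2 * \<bar>y5\<bar> + (2 * B + 2 * real (nat d) * (real N)\<^sup>2 / p) * \<bar>v\<bar>
      + (2 * real (nat d) * (real N)\<^sup>2 / p) * (1 / m)"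
    by (simp add: B_def distrib_right)
  finally show ?thesis
    unfolding folds eq y1_def[symmetric] y2_def[symmetric] y3_def[symmetric] y4_def[symmetric] y5_def[symmetric] v_def[symmetric] .
qed

text \<open>Every other type in the drift has total weight smaller by one, whatever its degree, so
  the induction on \<open>a + b\<close> must hold for all \<open>d\<close> at once. The exponent
  shrinks with the weight but stays positive, as there are only five predecessors.\<close>

lemma l2_bounded_type_dev: "\<exists>\<epsilon>>0. \<epsilon> \<le> 1 \<and> l2_bounded (type_dev (d, a, b)) \<epsilon>"
proof (induction "nat (a + b)" arbitrary: d a b rule: less_induct)
  case less
  show ?case
  proof (cases "a < 0 \<or> b < 0 \<or> a + b < 1")
    case True
    have "E n (\<lambda>st. (type_dev (d, a, b) n st)\<^sup>2) = E n (\<lambda>_. 0)" for n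
    proof (rule expectation_cong_pmf)
      fix st assume "st \<in> set_pmf (state_law n)"
      then interpret reachable_state N n "fst st" "snd st" by (rule reachable_state_law)
      show "(type_dev (d, a, b) n st)\<^sup>2 = 0"
        using tcount_eq_0[OF reach True] True by (simp add: type_dev_def limit_freq.simps)
    qed
    then have "l2_bounded (type_dev (d, a, b)) 1"
      unfolding l2_bounded_def by (intro exI[of _ 0]) simp
    then show ?thesis by (intro exI[of _ 1]) simp
  next
    case False
    then have "nat (a - 1 + b) < nat (a + b)" "nat (a + (b - 1)) < nat (a + b)" by auto
    note IH = less[OF this(1)] less[OF this(2)]
    have dec: "\<exists>\<eta>>0. decays (\<lambda>n st. type_dev k n st / (real n + 1)) \<eta>"
      if bounded: "\<exists>\<epsilon>>0. \<epsilon> \<le> 1 \<and> l2_bounded (type_dev k) \<epsilon>" for k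
    proof -
      obtain \<epsilon> where "0 < \<epsilon>" "l2_bounded (type_dev k) \<epsilon>" using bounded by blast
      then show ?thesis using l2_bounded_decays[of "type_dev k" \<epsilon>] by (intro exI[of _ "\<epsilon> / 2"]) simp
    qed
    obtain h1 where h1: "h1 > 0" "decays (\<lambda>n st. type_dev (d - 1, a - 1, b) n st / (real n + 1)) h1"
      using dec[OF IH(1)[of "d - 1"]] by blast
    obtain h2 where h2: "h2 > 0" "decays (\<lambda>n st. type_dev (d, a - 1, b) n st / (real n + 1)) h2"
      using dec[OF IH(1)[of d]] by blast
    obtain h3 where h3: "h3 > 0" "decays (\<lambda>n st. type_dev (d, a, b - 1) n st / (real n + 1)) h3"
      using dec[OF IH(2)[of d]] by blast
    obtain h4 where h4: "h4 > 0" "decays (\<lambda>n st. type_dev (d - (int N - 1), a - 1, b) n st / (real n + 1)) h4"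
      using dec[OF IH(1)[of "d - (int N - 1)"]] by blast
    obtain h5 where h5: "h5 > 0" "decays (\<lambda>n st. type_dev (d - 1, a, b - 1) n st / (real n + 1)) h5"
      using dec[OF IH(2)[of "d - 1"]] by blast
    \<comment> \<open>The entry \<open>1 / 2\<close> is the decay exponent of the vertex deviation;
      it also keeps \<open>h\<close> below 1.\<close>
    define h where "h = min h1 (min h2 (min h3 (min h4 (min h5 (1 / 2)))))"
    have hpos: "0 < h" unfolding h_def using h1(1) h2(1) h3(1) h4(1) h5(1) by simp
    have hle: "h \<le> h1" "h \<le> h2" "h \<le> h3" "h \<le> h4" "h \<le> h5" "h \<le> 1 / 2"
      unfolding h_def by linarith+
    have decv: "decays (\<lambda>n st. vertex_dev n st / (real n + 1)) h"
      using decays_mono[OF l2_bounded_decays[OF l2_bounded_vertex_dev]] hle by simp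
    have "l2_bounded (type_dev (d, a, b)) h"
    proof (rule l2_bounded_of_drift[where C = "dev_bound (d, a, b)"])
      show "0 \<le> (alpha1 p r q * of_int a + alpha2 N p r q * of_int b + beta N p r q) / (real n + 1)" for n
        using params_nonneg False by (intro divide_nonneg_pos add_nonneg_nonneg mult_nonneg_nonneg) auto
      show "h \<le> 1" using hle by simp
      show "decays (\<lambda>n st.
          alpha11 p r q * \<bar>of_int a - 1\<bar> * \<bar>type_dev (d - 1, a - 1, b) n st / (real n + 1)\<bar>
          + alpha12 p r q * \<bar>of_int a - 1\<bar> * \<bar>type_dev (d, a - 1, b) n st / (real n + 1)\<bar>
          + alpha2 N p r q * \<bar>of_int b - 1\<bar> * \<bar>type_dev (d, a, b - 1) n st / (real n + 1)\<bar>
          + beta1 p r q * \<bar>type_dev (d - (int N - 1), a - 1, b) n st / (real n + 1)\<bar>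
          + beta2 N p r q * \<bar>type_dev (d - 1, a, b - 1) n st / (real n + 1)\<bar>
          + (2 * beta N p r q + 2 * real (nat d) * (real N)\<^sup>2 / p) * \<bar>vertex_dev n st / (real n + 1)\<bar>
          + (2 * real (nat d) * (real N)\<^sup>2 / p) * (1 / (real n + 1))) h"
        by (intro decays_add decays_cmult decays_abs decays_mono[OF h1(2)] decays_mono[OF h2(2)] decays_mono[OF h3(2)]
            decays_mono[OF h4(2)] decays_mono[OF h5(2)] decv decays_mono[OF decays_inverse]) (use hle in auto)
      show "\<bar>type_dev (d, a, b) n s\<bar> \<le> dev_bound (d, a, b) * (real n + 1)" if "s \<in> set_pmf (state_law n)" for n s
        using that by (rule type_dev_le)
      show "\<bar>type_dev (d, a, b) (Suc n) t - type_dev (d, a, b) n s\<bar> \<le> dev_bound (d, a, b)"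
        if "s \<in> set_pmf (state_law n)" "t \<in> set_pmf (step_kernel N p r q s)" for n s t
        using that by (rule type_dev_lipschitz)
    qed (rule type_dev_drift, assumption, use False in auto)
    then show ?thesis using hpos hle by (intro exI[of _ h]) auto
  qed
qed

end

section \<open>From second moments to almost sure bounds\<close>

text \<open>This controls the gap between consecutive sampling times, which are \<open>L\<close>-th
  powers.\<close>

lemma power_Suc_diff_le: "(x + 1) ^ L \<le> x ^ L + real L * (x + 1) ^ (L - 1)" if "0 \<le> (x :: real)"
proof (induction L)
  case (Suc L)
  have "(x + 1) ^ Suc L \<le> (x + 1) * (x ^ L + real L * (x + 1) ^ (L - 1))"
    using Suc that by (simp add: mult_left_mono)
  also have "\<dots> = x ^ Suc L + x ^ L + real L * ((x + 1) * (x + 1) ^ (L - 1))"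
    by (simp add: algebra_simps)
  also have "real L * ((x + 1) * (x + 1) ^ (L - 1)) = real L * (x + 1) ^ L"
    by (cases L) simp_all
  also have "x ^ L \<le> (x + 1) ^ L" using that by (intro power_mono) auto
  finally show ?case by (simp add: algebra_simps)
qed simp

text \<open>The gap after the sampling time with \<open>m = (j + 1) ^ L\<close> has order
  \<open>m powr (1 - 1 / L)\<close>, so bounded increments carry the bound across it whenever
  \<open>a \<le> 1 / L\<close>. Times are shifted by one because \<open>n + 1\<close> is compared
  with the powers.\<close>

lemma bound_between_powers:
  fixes y :: "nat \<Rightarrow> real"
  assumes L: "1 \<le> L" and lip: "\<And>n. \<bar>y (Suc n) - y n\<bar> \<le> C" and B: "0 \<le> B"
    and sub: "\<And>j. \<bar>y (Suc j ^ L - 1)\<bar> \<le> B * real (Suc j ^ L) powr (1 - b)"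
    and a: "a \<le> b" "a \<le> 1 / real L"
  shows "\<bar>y n\<bar> \<le> (B + C * (real L * 2 ^ (L - 1))) * (real n + 1) powr (1 - a)"
proof -
  have C: "0 \<le> C" using lip[of 0] by linarith
  have lip': "\<bar>y (i + k) - y i\<bar> \<le> C * real k" for i k
  proof (induction k)
    case (Suc k)
    then show ?case using lip[of "i + k"] by (simp add: algebra_simps)
  qed simp
  have "Suc n < Suc (Suc n) ^ L"
    using L power_increasing[of 1 L "Suc (Suc n)"] by simp
  \<comment> \<open>The last sampling time not after \<open>n\<close>:
    \<open>(j + 1) ^ L \<le> n + 1 < (j + 2) ^ L\<close>.\<close>
  then obtain j where j: "\<not> Suc n < Suc j ^ L" "Suc n < Suc (Suc j) ^ L"
    using ex_least_nat_less[of "\<lambda>k. Suc n < Suc k ^ L" "Suc n"] by auto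
  define m where "m = real (Suc j ^ L)"
  have m1: "1 \<le> m" unfolding m_def by simp
  have mn: "m \<le> real n + 1"
  proof -
    have "real (Suc j ^ L) \<le> real (Suc n)" using j(1) by (intro of_nat_mono) simp
    then show ?thesis unfolding m_def by linarith
  qed
  have one: "1 \<le> Suc j ^ L" by simp
  define k where "k = n - (Suc j ^ L - 1)"
  have nk: "n = (Suc j ^ L - 1) + k" using j(1) one unfolding k_def by linarith
  have "real k \<le> real (Suc (Suc j) ^ L) - real (Suc j ^ L)"
  proof -
    have "Suc j ^ L + k \<le> Suc (Suc j) ^ L" using j(2) nk one by linarith
    from of_nat_mono[OF this, where 'a = real] show ?thesis unfolding of_nat_add by linarith
  qed
  also have "\<dots> \<le> real L * (real j + 2) ^ (L - 1)"
    using power_Suc_diff_le[of "real j + 1" L] by (simp add: add_ac)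
  \<comment> \<open>From \<open>j + 2 \<le> 2 * (j + 1)\<close>; this is the source of
    \<open>2 ^ (L - 1)\<close> in the constant.\<close>
  also have "\<dots> \<le> real L * (2 * (real j + 1)) ^ (L - 1)"
    by (intro mult_left_mono power_mono) auto
  also have "\<dots> = real L * 2 ^ (L - 1) * m powr (1 - 1 / real L)"
  proof -
    have "m powr (1 - 1 / real L) = (real j + 1) powr (real L * (1 - 1 / real L))"
      unfolding m_def by (simp add: powr_powr add.commute flip: powr_realpow)
    also have "real L * (1 - 1 / real L) = real (L - 1)"
      using L by (simp add: algebra_simps of_nat_diff)
    finally have e: "m powr (1 - 1 / real L) = (real j + 1) ^ (L - 1)"
      by (simp add: powr_realpow)
    show ?thesis unfolding e power_mult_distrib by (simp only: mult.assoc)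
  qed
  finally have k': "real k \<le> real L * 2 ^ (L - 1) * m powr (1 - 1 / real L)" .
  have "m powr (1 - 1 / real L) \<le> (real n + 1) powr (1 - a)"
  proof -
    have "m powr (1 - 1 / real L) \<le> (real n + 1) powr (1 - 1 / real L)"
      using m1 mn L by (intro powr_mono2) auto
    also have "\<dots> \<le> (real n + 1) powr (1 - a)" using a by (intro powr_mono) auto
    finally show ?thesis .
  qed
  then have k: "real k \<le> real L * 2 ^ (L - 1) * (real n + 1) powr (1 - a)"
    by (intro order_trans[OF k'] mult_left_mono) auto
  have "m powr (1 - b) \<le> (real n + 1) powr (1 - a)"
  proof -
    have "m powr (1 - b) \<le> m powr (1 - a)" using m1 a by (intro powr_mono) auto
    also have "\<dots> \<le> (real n + 1) powr (1 - a)"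
    proof (rule powr_mono2)
      have "1 / real L \<le> 1" using L by simp
      then show "0 \<le> 1 - a" using a by linarith
    qed (use m1 mn in auto)
    finally show ?thesis .
  qed
  then have "\<bar>y (Suc j ^ L - 1)\<bar> \<le> B * (real n + 1) powr (1 - a)"
    using sub[of j] B unfolding m_def by (meson mult_left_mono order_trans)
  moreover have "\<bar>y n - y (Suc j ^ L - 1)\<bar> \<le> C * (real L * 2 ^ (L - 1) * (real n + 1) powr (1 - a))"
    using lip'[of "Suc j ^ L - 1" k] mult_left_mono[OF k C] nk by simp
  ultimately show ?thesis by (simp add: algebra_simps)
qed

section \<open>The process on its probability space: transitions and marginal laws\<close>

locale star_process = star_params N p r q + prob_space M
  for N p r q and M :: "'w measure" +
  fixes G :: "nat \<Rightarrow> 'w \<Rightarrow> sstate"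
  assumes process: "is_star_process N p r q M G"
begin

lemma G_measurable [measurable]: "G n \<in> measurable M (count_space UNIV)"
  using process by (simp add: is_star_process_def)

lemma prob_path_Suc:
  "prob {\<omega> \<in> space M. \<forall>i \<le> Suc n. G i \<omega> = h i} =
     prob {\<omega> \<in> space M. \<forall>i \<le> n. G i \<omega> = h i} * pmf (step_kernel N p r q (h n)) (h (Suc n))"
  using process unfolding is_star_process_def by blast

lemma sets_path [measurable]: "{\<omega> \<in> space M. \<forall>i \<le> n. G i \<omega> = h i} \<in> sets M"
  by measurable

lemma AE_initial: "AE \<omega> in M. G 0 \<omega> = initial_state N"
proof -
  have "prob {\<omega> \<in> space M. G 0 \<omega> = initial_state N} = 1"
    using process by (simp add: is_star_process_def)
  moreover have "{\<omega> \<in> space M. G 0 \<omega> = initial_state N} \<in> sets M" by measurable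
  ultimately show ?thesis by (subst (asm) prob_Collect_eq_1)
qed

text \<open>The process is specified through complete histories, so a transition from the present
  state alone is obtained by summing over all histories that end in \<open>s\<close>. The support
  hypothesis makes finitely many of them exhaust the event up to a null set.\<close>

lemma prob_joint:
  assumes support: "AE \<omega> in M. \<forall>i\<le>n. G i \<omega> \<in> set_pmf (state_law i)"
  shows "prob {\<omega> \<in> space M. G n \<omega> = s \<and> G (Suc n) \<omega> = t}
      = prob {\<omega> \<in> space M. G n \<omega> = s} * pmf (step_kernel N p r q s) t"
proof -
  \<comment> \<open>Histories are extensional functions on \<open>{..n}\<close>: two different ones
    differ at a time up to \<open>n\<close>, which makes their events disjoint.\<close>
  define H where "H = {h \<in> (\<Pi>\<^sub>E i\<in>{..n}. set_pmf (state_law i)). h n = s}"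
  have finH: "finite H" unfolding H_def by (auto intro!: finite_PiE finite_law)
  define A where "A h = {\<omega> \<in> space M. \<forall>i \<le> n. G i \<omega> = h i}" for h
  \<comment> \<open>A history is undefined after time \<open>n\<close>, so the next state is
    appended by an update.\<close>
  define A' where "A' h = {\<omega> \<in> space M. \<forall>i \<le> Suc n. G i \<omega> = (h(Suc n := t)) i}" for h
  have A'_eq: "A' h = A h \<inter> {\<omega> \<in> space M. G (Suc n) \<omega> = t}" for h
    unfolding A_def A'_def by (auto simp: le_Suc_eq)
  have meas: "A h \<in> sets M" "A' h \<in> sets M" for h
    unfolding A_def A'_def by (rule sets_path)+
  have "A h \<inter> A h' = {}" if "h \<in> H" "h' \<in> H" "h \<noteq> h'" for h h'
  proof -
    have "\<exists>i\<le>n. h i \<noteq> h' i"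
      using that unfolding H_def by (metis (no_types, lifting) PiE_ext atMost_iff mem_Collect_eq)
    then show ?thesis unfolding A_def by auto
  qed
  then have disj: "disjoint_family_on A H" "disjoint_family_on A' H"
    unfolding disjoint_family_on_def A'_eq by blast+
  have ae: "AE \<omega> in M. (G n \<omega> = s) = (\<omega> \<in> (\<Union>h\<in>H. A h))"
    using support AE_space
  proof eventually_elim
    case (elim \<omega>)
    define h where "h = restrict (\<lambda>i. G i \<omega>) {..n}"
    have "\<omega> \<in> A h" using elim by (simp add: A_def h_def)
    moreover have "h \<in> H" if "G n \<omega> = s" using elim that by (simp add: H_def h_def)
    ultimately show ?case by (auto simp: A_def H_def)
  qed
  have "prob {\<omega> \<in> space M. G n \<omega> = s} = prob (\<Union>h\<in>H. A h)"
    using ae by (intro measure_eq_AE) (auto intro!: sets.finite_UN finH meas)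
  also have "\<dots> = (\<Sum>h\<in>H. prob (A h))"
    using meas by (intro finite_measure_finite_Union finH disj) auto
  finally have 1: "prob {\<omega> \<in> space M. G n \<omega> = s} = (\<Sum>h\<in>H. prob (A h))" .
  have "prob {\<omega> \<in> space M. G n \<omega> = s \<and> G (Suc n) \<omega> = t} = prob (\<Union>h\<in>H. A' h)"
    using ae by (intro measure_eq_AE) (auto intro!: sets.finite_UN finH meas simp: A'_eq)
  also have "\<dots> = (\<Sum>h\<in>H. prob (A' h))"
    using meas by (intro finite_measure_finite_Union finH disj) auto
  also have "\<dots> = (\<Sum>h\<in>H. prob (A h) * pmf (step_kernel N p r q s) t)"
  proof (rule sum.cong[OF refl])
    fix h assume "h \<in> H"
    then have "h n = s" by (simp add: H_def)
    moreover have "{\<omega> \<in> space M. \<forall>i\<le>n. G i \<omega> = (h(Suc n := t)) i} = A h" by (auto simp: A_def)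
    ultimately show "prob (A' h) = prob (A h) * pmf (step_kernel N p r q s) t"
      using prob_path_Suc[of n "h(Suc n := t)"] unfolding A'_def by simp
  qed
  finally show ?thesis unfolding 1 by (simp add: sum_distrib_right)
qed

text \<open>Summing the joint probabilities over the support of the kernel recovers the whole
  probability of \<open>G n = s\<close>. The support hypothesis stays explicit because
  \<open>AE_support\<close> is proved from this lemma by induction.\<close>

lemma AE_step_of_support:
  assumes support: "AE \<omega> in M. \<forall>i\<le>n. G i \<omega> \<in> set_pmf (state_law i)"
  shows "AE \<omega> in M. G (Suc n) \<omega> \<in> set_pmf (step_kernel N p r q (G n \<omega>))"
proof -
  have "AE \<omega> in M. G n \<omega> = s \<longrightarrow> G (Suc n) \<omega> \<in> set_pmf (step_kernel N p r q s)"
    if s: "s \<in> set_pmf (state_law n)" for s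
  proof -
    let ?S = "set_pmf (step_kernel N p r q s)"
    let ?U = "\<lambda>t. {\<omega> \<in> space M. G n \<omega> = s \<and> G (Suc n) \<omega> = t}"
    have fin: "finite ?S" by (rule finite_K[OF s])
    have "prob {\<omega> \<in> space M. G n \<omega> = s \<and> G (Suc n) \<omega> \<in> ?S} = prob (\<Union>t\<in>?S. ?U t)"
      by (rule arg_cong[of _ _ prob]) auto
    also have "\<dots> = (\<Sum>t\<in>?S. prob (?U t))"
      by (intro finite_measure_finite_Union fin) (auto simp: disjoint_family_on_def)
    also have "\<dots> = (\<Sum>t\<in>?S. prob {\<omega> \<in> space M. G n \<omega> = s} * pmf (step_kernel N p r q s) t)"
      by (simp only: prob_joint[OF support])
    also have "\<dots> = prob {\<omega> \<in> space M. G n \<omega> = s}"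
      using sum_pmf_eq_1[OF fin] by (simp flip: sum_distrib_left)
    finally have eq: "prob {\<omega> \<in> space M. G n \<omega> = s \<and> G (Suc n) \<omega> \<in> ?S} = prob {\<omega> \<in> space M. G n \<omega> = s}" .
    have "prob ({\<omega> \<in> space M. G n \<omega> = s} - {\<omega> \<in> space M. G n \<omega> = s \<and> G (Suc n) \<omega> \<in> ?S}) = 0"
      by (subst finite_measure_Diff) (auto simp: eq)
    also have "{\<omega> \<in> space M. G n \<omega> = s} - {\<omega> \<in> space M. G n \<omega> = s \<and> G (Suc n) \<omega> \<in> ?S}
       = {\<omega> \<in> space M. \<not> (G n \<omega> = s \<longrightarrow> G (Suc n) \<omega> \<in> ?S)}" by auto
    finally show ?thesis
      by (subst AE_iff_measurable[OF _ refl]) (auto simp: emeasure_eq_measure)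
  qed
  then have "AE \<omega> in M. \<forall>s\<in>set_pmf (state_law n). G n \<omega> = s \<longrightarrow> G (Suc n) \<omega> \<in> set_pmf (step_kernel N p r q s)"
    by (intro AE_finite_allI finite_law)
  then show ?thesis using support by eventually_elim auto
qed

lemma AE_support: "AE \<omega> in M. \<forall>i\<le>n. G i \<omega> \<in> set_pmf (state_law i)"
proof (induction n)
  case 0
  then show ?case using AE_initial by eventually_elim simp
next
  case (Suc n)
  from Suc AE_step_of_support[OF Suc] show ?case
    by eventually_elim (auto simp: le_Suc_eq)
qed

lemma AE_path: "AE \<omega> in M. \<forall>n. G n \<omega> \<in> set_pmf (state_law n) \<and> G (Suc n) \<omega> \<in> set_pmf (step_kernel N p r q (G n \<omega>))"
  unfolding AE_all_countable
proof
  fix n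
  show "AE \<omega> in M. G n \<omega> \<in> set_pmf (state_law n) \<and> G (Suc n) \<omega> \<in> set_pmf (step_kernel N p r q (G n \<omega>))"
    using AE_support[of n] AE_step_of_support[OF AE_support] by eventually_elim auto
qed

lemma prob_eq_pmf: "prob {\<omega> \<in> space M. G n \<omega> = s} = pmf (state_law n) s"
proof (induction n arbitrary: s)
  case 0
  show ?case
  proof (cases "s = initial_state N")
    case True
    then show ?thesis using process by (simp add: is_star_process_def)
  next
    case False
    have "prob {\<omega> \<in> space M. G 0 \<omega> = s} = prob {}"
      using AE_initial False by (intro measure_eq_AE) auto
    then show ?thesis using False by simp
  qed
next
  case (Suc n)
  let ?S = "set_pmf (state_law n)"
  let ?U = "\<lambda>t. {\<omega> \<in> space M. G n \<omega> = t \<and> G (Suc n) \<omega> = s}"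
  have "prob {\<omega> \<in> space M. G (Suc n) \<omega> = s} = prob (\<Union>t\<in>?S. ?U t)"
    using AE_support[of n] by (intro measure_eq_AE) (auto intro!: sets.finite_UN finite_law)
  also have "\<dots> = (\<Sum>t\<in>?S. prob (?U t))"
    by (intro finite_measure_finite_Union finite_law) (auto simp: disjoint_family_on_def)
  also have "\<dots> = (\<Sum>t\<in>?S. pmf (state_law n) t * pmf (step_kernel N p r q t) s)"
    by (simp only: prob_joint[OF AE_support] Suc)
  also have "\<dots> = pmf (state_law (Suc n)) s"
    by (simp add: pmf_bind integral_measure_pmf[OF finite_law])
  finally show ?case .
qed

lemma distr_G: "distr M (count_space UNIV) (G n) = measure_pmf (state_law n)"
proof (rule measure_eqI_countable_AE)
  show "AE x in distr M (count_space UNIV) (G n). x \<in> set_pmf (state_law n)"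
    using AE_support[of n] by (subst AE_distr_iff) auto
  show "countable (set_pmf (state_law n))" by (rule countable_finite[OF finite_law])
  show "emeasure (distr M (count_space UNIV) (G n)) {x} = emeasure (measure_pmf (state_law n)) {x}" for x
  proof -
    have "G n -` {x} \<inter> space M = {\<omega> \<in> space M. G n \<omega> = x}" by auto
    then show ?thesis using prob_eq_pmf[of n x] by (simp add: emeasure_distr emeasure_eq_measure emeasure_pmf_single)
  qed
qed (auto simp: AE_measure_pmf)

text \<open>Markov's inequality for the square, carried out in the law of \<open>G n\<close>, where
  every function is integrable.\<close>

lemma prob_large_le:
  assumes "0 < c"
  shows "prob {\<omega> \<in> space M. c < \<bar>Y (G n \<omega>)\<bar>} \<le> E n (\<lambda>s. (Y s)\<^sup>2) / c\<^sup>2"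
proof -
  have "G n -` {s. c < \<bar>Y s\<bar>} \<inter> space M = {\<omega> \<in> space M. c < \<bar>Y (G n \<omega>)\<bar>}" by auto
  then have "prob {\<omega> \<in> space M. c < \<bar>Y (G n \<omega>)\<bar>} = measure (distr M (count_space UNIV) (G n)) {s. c < \<bar>Y s\<bar>}"
    by (subst measure_distr) auto
  also have "\<dots> = E n (indicator {s. c < \<bar>Y s\<bar>})"
    unfolding distr_G by simp
  also have "\<dots> \<le> E n (\<lambda>s. (Y s)\<^sup>2 / c\<^sup>2)"
  proof (rule expectation_mono_pmf[OF finite_law])
    fix s
    have "1 \<le> (Y s)\<^sup>2 / c\<^sup>2" if "c < \<bar>Y s\<bar>"
      using power_mono[of c "\<bar>Y s\<bar>" 2] that assms by simp
    then show "indicator {s. c < \<bar>Y s\<bar>} s \<le> (Y s)\<^sup>2 / c\<^sup>2" by (auto simp: indicator_def)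
  qed
  finally show ?thesis by simp
qed

text \<open>Along the times \<open>(j + 1) ^ L - 1\<close> the second moments are summable; between them the Lipschitz
  bound suffices because \<open>(j + 2) ^ L - (j + 1) ^ L\<close> is of smaller order.\<close>
lemma AE_bound_of_l2_bounded:
  assumes l2: "l2_bounded Y \<epsilon>" and \<epsilon>: "0 < \<epsilon>" "\<epsilon> \<le> 1"
    and lip: "\<And>n s t. s \<in> set_pmf (state_law n) \<Longrightarrow> t \<in> set_pmf (step_kernel N p r q s) \<Longrightarrow> \<bar>Y (Suc n) t - Y n s\<bar> \<le> C"
  shows "\<exists>a>0. AE \<omega> in M. \<exists>B. \<forall>n. \<bar>Y n (G n \<omega>)\<bar> \<le> B * (real n + 1) powr (1 - a)"
proof -
  obtain B where B: "\<And>n. E n (\<lambda>s. (Y n s)\<^sup>2) \<le> B * (real n + 1) powr (2 - \<epsilon>)"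
    using l2 unfolding l2_bounded_def by blast
  \<comment> \<open>Chosen such that \<open>L * (\<epsilon> / 2) \<ge> 2\<close>, which makes the
    exceptional probabilities at most of order \<open>1 / (j + 1)\<^sup>2\<close>.\<close>
  define L where "L = nat \<lceil>4 / \<epsilon>\<rceil>"
  have L4: "4 / \<epsilon> \<le> real L" unfolding L_def by (rule real_nat_ceiling_ge)
  have "4 \<le> 4 / \<epsilon>" using \<epsilon> by (simp add: field_simps)
  with L4 have L1: "1 \<le> L" by linarith
  have L\<epsilon>: "2 \<le> real L * (\<epsilon> / 2)" using L4 \<epsilon> by (simp add: field_simps)
  define t where "t j = Suc j ^ L - 1" for j
  have t: "real (t j) + 1 = real (Suc j) ^ L" for j
    unfolding t_def by (simp add: of_nat_diff)
  \<comment> \<open>Half of the available exponent is spent on the threshold: its square has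
    exponent \<open>2 - \<epsilon> / 2\<close>, so the quotient with the second moment still decays
    like the power \<open>- (\<epsilon> / 2)\<close>.\<close>
  define c where "c j = (real (t j) + 1) powr (1 - \<epsilon> / 4)" for j
  define A where "A j = {\<omega> \<in> space M. c j < \<bar>Y (t j) (G (t j) \<omega>)\<bar>}" for j
  have sets_A: "A j \<in> sets M" for j
  proof -
    have "A j = G (t j) -` {s. c j < \<bar>Y (t j) s\<bar>} \<inter> space M" by (auto simp: A_def)
    then show ?thesis by (simp add: measurable_sets[OF G_measurable])
  qed
  have prob_A: "prob (A j) \<le> B * (1 / real (Suc j) ^ 2)" for j
  proof -
    let ?m = "real (t j) + 1"
    have B0: "0 \<le> B"
    proof -
      have "0 \<le> E 0 (\<lambda>s. (Y 0 s)\<^sup>2)" by (rule integral_nonneg_AE) simp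
      from order_trans[OF this B[of 0]] show ?thesis by simp
    qed
    have "prob (A j) \<le> E (t j) (\<lambda>s. (Y (t j) s)\<^sup>2) / (c j)\<^sup>2"
      unfolding A_def by (rule prob_large_le) (simp add: c_def)
    also have "\<dots> \<le> B * ?m powr (2 - \<epsilon>) / (c j)\<^sup>2"
      by (intro divide_right_mono B) simp
    also have "(c j)\<^sup>2 = ?m powr (2 - \<epsilon> / 2)"
      unfolding c_def power2_eq_square by (simp flip: powr_add)
    also have "B * ?m powr (2 - \<epsilon>) / ?m powr (2 - \<epsilon> / 2) = B * ?m powr (- (\<epsilon> / 2))"
      using powr_diff[of ?m "2 - \<epsilon>" "2 - \<epsilon> / 2"] by simp
    also have "?m powr (- (\<epsilon> / 2)) = real (Suc j) powr (- (real L * (\<epsilon> / 2)))"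
      unfolding t by (simp add: powr_powr del: of_nat_Suc flip: powr_realpow)
    also have "B * real (Suc j) powr (- (real L * (\<epsilon> / 2))) \<le> B * real (Suc j) powr (- 2)"
      using L\<epsilon> B0 by (intro mult_left_mono powr_mono) auto
    also have "real (Suc j) powr (- 2) = 1 / real (Suc j) ^ 2"
      by (simp add: powr_minus_divide del: of_nat_Suc)
    finally show ?thesis .
  qed
  have "summable (\<lambda>j. 1 / real (Suc j) ^ 2)"
    using inverse_power_summable[of 2, where 'a = real] by (subst summable_Suc_iff) (simp add: divide_inverse)
  then have "summable (\<lambda>j. B * (1 / real (Suc j) ^ 2))"
    by (rule summable_mult)
  then have "summable (\<lambda>j. prob (A j))"
    by (rule summable_comparison_test'[where N = 0]) (unfold real_norm_def abs_of_nonneg[OF measure_nonneg], rule prob_A)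
  then have "AE \<omega> in M. eventually (\<lambda>j. \<omega> \<in> space M - A j) sequentially"
    using sets_A by (intro borel_cantelli_AE1) (auto simp: emeasure_eq_measure)
  \<comment> \<open>The first entry is the rate at the sampling times, the second the cost of the
    gaps between them.\<close>
  define a where "a = min (\<epsilon> / 4) (1 / real L)"
  have a: "0 < a" "a \<le> \<epsilon> / 4" "a \<le> 1 / real L" unfolding a_def using \<epsilon> L1 by auto
  have "AE \<omega> in M. \<exists>B. \<forall>n. \<bar>Y n (G n \<omega>)\<bar> \<le> B * (real n + 1) powr (1 - a)"
    using AE_path \<open>AE \<omega> in M. eventually (\<lambda>j. \<omega> \<in> space M - A j) sequentially\<close>
  proof eventually_elim
    case (elim \<omega>)
    obtain j0 where j0: "\<And>j. j \<ge> j0 \<Longrightarrow> \<omega> \<in> space M - A j"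
      using elim(2) unfolding eventually_sequentially by blast
    \<comment> \<open>The finitely many sampling times before \<open>j0\<close> are absorbed into a
      constant that depends on the path.\<close>
    define B' where "B' = 1 + (\<Sum>j<j0. \<bar>Y (t j) (G (t j) \<omega>)\<bar>)"
    have B': "1 \<le> B'" unfolding B'_def by (simp add: sum_nonneg)
    have sub: "\<bar>Y (Suc j ^ L - 1) (G (Suc j ^ L - 1) \<omega>)\<bar> \<le> B' * real (Suc j ^ L) powr (1 - \<epsilon> / 4)" for j
    proof -
      have c: "real (Suc j ^ L) powr (1 - \<epsilon> / 4) = c j" unfolding c_def t by simp
      have c1: "1 \<le> c j" unfolding c_def using \<epsilon> by (intro ge_one_powr_ge_zero) auto
      have "\<bar>Y (t j) (G (t j) \<omega>)\<bar> \<le> B' * c j"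
      proof (cases "j < j0")
        case True
        then have "\<bar>Y (t j) (G (t j) \<omega>)\<bar> \<le> (\<Sum>j<j0. \<bar>Y (t j) (G (t j) \<omega>)\<bar>)"
          by (intro member_le_sum) auto
        also have "\<dots> \<le> B' * 1" by (simp add: B'_def)
        also have "\<dots> \<le> B' * c j" using B' c1 by (intro mult_left_mono) auto
        finally show ?thesis .
      next
        case False
        then have "\<bar>Y (t j) (G (t j) \<omega>)\<bar> \<le> 1 * c j" using j0[of j] by (simp add: A_def not_less)
        also have "\<dots> \<le> B' * c j" using B' c1 by (intro mult_right_mono) auto
        finally show ?thesis .
      qed
      then show ?thesis unfolding c by (simp only: t_def)
    qed
    have "\<bar>Y n (G n \<omega>)\<bar> \<le> (B' + C * (real L * 2 ^ (L - 1))) * (real n + 1) powr (1 - a)" for n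
    proof (rule bound_between_powers[OF L1, where y = "\<lambda>n. Y n (G n \<omega>)"])
      show "\<bar>Y (Suc n) (G (Suc n) \<omega>) - Y n (G n \<omega>)\<bar> \<le> C" for n
        using lip elim(1) by blast
      show "0 \<le> B'" using B' by simp
    qed (rule sub a(2) a(3))+
    then show ?case by blast
  qed
  then show ?thesis using a(1) by blast
qed

end

lemma tendsto_of_powr_bound:
  assumes a: "0 < a" and f: "\<And>n. \<bar>f n\<bar> \<le> B * (real n + 1) powr (- a)"
  shows "f \<longlonglongrightarrow> 0"
proof (rule Lim_null_comparison)
  show "\<forall>\<^sub>F n in sequentially. norm (f n) \<le> B * (real n + 1) powr (- a)"
    using f by simp
  have "filterlim (\<lambda>n. real n + 1) at_top sequentially"
    by (rule filterlim_at_top_mono[OF filterlim_real_sequentially]) simp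
  then have "(\<lambda>n. B * (real n + 1) powr (- a)) \<longlonglongrightarrow> B * 0"
    using a by (intro tendsto_mult tendsto_const tendsto_neg_powr) auto
  then show "(\<lambda>n. B * (real n + 1) powr (- a)) \<longlonglongrightarrow> 0" by simp
qed

lemma dev_bound_divide:
  assumes "\<bar>y\<bar> \<le> B * (real n + 1) powr (1 - a)"
  shows "\<bar>y / (real n + 1)\<bar> \<le> B * (real n + 1) powr (- a)"
proof -
  have "(real n + 1) powr (1 - a) = (real n + 1) * (real n + 1) powr (- a)"
    using powr_add[of "real n + 1" 1 "- a"] by simp
  then show ?thesis using assms by (simp add: abs_divide divide_le_eq mult_ac)
qed

text \<open>Giving up half of the exponent turns a bound of this order into a little-o statement,
  whatever the constant.\<close>

lemma smallo_of_powr_bound: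
  assumes a: "0 < a" and f: "\<forall>\<^sub>F n in sequentially. \<bar>f n\<bar> \<le> B * (real n + 1) powr (- a)"
  shows "f \<in> o(\<lambda>n. real n powr (- (a / 2)))"
proof (rule smalloI_tendsto)
  show "\<forall>\<^sub>F n in sequentially. real n powr (- (a / 2)) \<noteq> 0"
    using eventually_gt_at_top[of 0] by eventually_elim simp
  have "(\<lambda>n. \<bar>B\<bar> * real n powr (- (a / 2))) \<longlonglongrightarrow> \<bar>B\<bar> * 0"
    using a by (intro tendsto_mult tendsto_const tendsto_neg_powr filterlim_real_sequentially) auto
  then have "(\<lambda>n. \<bar>B\<bar> * real n powr (- (a / 2))) \<longlonglongrightarrow> 0" by simp
  moreover have "\<forall>\<^sub>F n in sequentially. norm (f n / real n powr (- (a / 2))) \<le> \<bar>B\<bar> * real n powr (- (a / 2))"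
    using f eventually_gt_at_top[of 0]
  proof eventually_elim
    case (elim n)
    have "\<bar>f n\<bar> \<le> \<bar>B\<bar> * real n powr (- a)"
    proof -
      have "\<bar>f n\<bar> \<le> \<bar>B\<bar> * (real n + 1) powr (- a)"
        by (rule order_trans[OF elim(1)]) (intro mult_right_mono, auto)
      also have "\<dots> \<le> \<bar>B\<bar> * real n powr (- a)"
        using elim a by (intro mult_left_mono powr_mono2') auto
      finally show ?thesis .
    qed
    moreover have "real n powr (- a) = real n powr (- (a / 2)) * real n powr (- (a / 2))"
      by (simp flip: powr_add)
    ultimately show ?case using elim(2) by (simp add: abs_divide divide_le_eq mult.assoc)
  qed
  ultimately show "(\<lambda>n. f n / real n powr (- (a / 2))) \<longlonglongrightarrow> 0"
    by (rule Lim_null_comparison[rotated])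
qed

section \<open>Sign, support and recursion of the limiting frequencies\<close>

context star_params
begin

lemma limit_freq_degenerate: "a < 0 \<or> b < 0 \<or> a + b < 1 \<Longrightarrow> limit_freq d a b = 0"
  by (simp add: limit_freq.simps)

lemma limit_freq_nonneg: "0 \<le> limit_freq d a b"
proof (induction d a b rule: limit_freq.induct)
  case (1 d a b)
  show ?case
  proof (cases "a < 0 \<or> b < 0 \<or> a + b < 1")
    case True
    then show ?thesis by (simp add: limit_freq_degenerate)
  next
    case False
    note IH = 1[OF False]
    \<comment> \<open>The coefficient is negative only for \<open>a = 0\<close>, and then the
      frequency beside it has a negative index and vanishes.\<close>
    have A: "0 \<le> (of_int a - 1) * limit_freq d' (a - 1) b" if "0 \<le> limit_freq d' (a - 1) b" for d'
      using that False limit_freq_degenerate[of "a - 1" b d'] by (cases "a = 0") auto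
    have B: "0 \<le> (of_int b - 1) * limit_freq d a (b - 1)"
      using IH(3) False limit_freq_degenerate[of a "b - 1" d] by (cases "b = 0") auto
    show ?thesis
      using False params_nonneg r IH A[OF IH(1)] A[OF IH(2)] B
      by (subst limit_freq.simps) (auto intro!: divide_nonneg_nonneg add_nonneg_nonneg mult_nonneg_nonneg simp: mult.assoc)
  qed
qed

text \<open>Every transition with a nonzero coefficient leads from the domain into the domain, and
  both source types lie in it. So outside the domain all terms of the recursion vanish by
  induction.\<close>

lemma limit_freq_outside_domain: "\<not> in_domain N d a b \<Longrightarrow> limit_freq d a b = 0"
proof (induction d a b rule: limit_freq.induct)
  case (1 d a b)
  show ?case
  proof (cases "a < 0 \<or> b < 0 \<or> a + b < 1")
    case True
    then show ?thesis by (simp add: limit_freq_degenerate)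
  next
    case False
    note IH = 1(1-5)[OF False]
    have dom: "\<not> (a = 0 \<and> 1 \<le> d \<and> d \<le> b)" "\<not> (1 \<le> a \<and> int N - 1 \<le> d \<and> d \<le> a * (int N - 1) + b)"
      using 1(6) False by (auto simp: in_domain_def)
    have split: "(a - 1) * (int N - 1) = a * (int N - 1) - (int N - 1)" by (simp add: algebra_simps)
    have N1: "2 \<le> int N - 1" using N3 by simp
    \<comment> \<open>For \<open>a = 1\<close> the vanishing coefficient is essential: a predecessor
      of central weight 0 can lie in the domain with a degree too small for a vertex that has been a
      centre.\<close>
    have c1: "(of_int a - 1) * limit_freq d' (a - 1) b = 0" if "d' = d \<or> d' = d - 1"
      and IH': "\<not> in_domain N d' (a - 1) b \<Longrightarrow> limit_freq d' (a - 1) b = 0" for d'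
    proof -
      consider "a = 0" | "a = 1" | "2 \<le> a" using False by linarith
      then show ?thesis
      proof cases
        case 3
        then have "\<not> in_domain N d' (a - 1) b"
          using that(1) dom(2) N1 False unfolding in_domain_def split by auto
        then show ?thesis using IH' by simp
      qed (auto simp: limit_freq_degenerate)
    qed
    have c3: "(of_int b - 1) * limit_freq d a (b - 1) = 0"
    proof -
      consider "b = 0" | "b = 1" | "2 \<le> b" using False by linarith
      then show ?thesis
      proof cases
        case 3
        then have "\<not> in_domain N d a (b - 1)" using dom False unfolding in_domain_def by auto
        then show ?thesis using IH(3) by simp
      qed (auto simp: limit_freq_degenerate)
    qed
    have c4: "limit_freq (d - (int N - 1)) (a - 1) b = 0"
    proof (cases "a = 0")
      case False
      then have "\<not> in_domain N (d - (int N - 1)) (a - 1) b"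
        using dom(2) N1 \<open>\<not> (a < 0 \<or> b < 0 \<or> a + b < 1)\<close> unfolding in_domain_def split by (auto simp: le_diff_eq)
      then show ?thesis by (rule IH(4))
    qed (simp add: limit_freq_degenerate)
    have c5: "limit_freq (d - 1) a (b - 1) = 0"
    proof (cases "b = 0")
      case False
      then have "\<not> in_domain N (d - 1) a (b - 1)"
        using dom N1 \<open>\<not> (a < 0 \<or> b < 0 \<or> a + b < 1)\<close> unfolding in_domain_def by auto
      then show ?thesis by (rule IH(5))
    qed (simp add: limit_freq_degenerate)
    have src: "(d, a, b) \<noteq> (int N - 1, 1, 0)" "(d, a, b) \<noteq> (1, 0, 1)" using dom by auto
    show ?thesis
      unfolding limit_freq.simps[of d a b]
      by (simp only: mult.assoc c1[of "d - 1", OF disjI2[OF refl] IH(1)] c1[of d, OF disjI1[OF refl] IH(2)]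
          c3 c4 c5 src of_bool_eq mult_zero_right add_0_right div_0 if_cancel simp_thms)
  qed
qed

lemma limit_freq_rec:
  assumes "2 \<le> w1 + w2"
  shows "limit_freq d (int w1) (int w2) =
     (alpha11 p r q * (real w1 - 1) * limit_freq (d - 1) (int w1 - 1) (int w2)
      + alpha12 p r q * (real w1 - 1) * limit_freq d (int w1 - 1) (int w2)
      + alpha2 N p r q * (real w2 - 1) * limit_freq d (int w1) (int w2 - 1)
      + beta1 p r q * limit_freq (d - (int N - 1)) (int w1 - 1) (int w2)
      + beta2 N p r q * limit_freq (d - 1) (int w1) (int w2 - 1))
     / (alpha1 p r q * real w1 + alpha2 N p r q * real w2 + beta N p r q + 1)"
  using assms by (subst limit_freq.simps) auto

lemma limit_freq_central_one:
  "limit_freq (int N - 1) 1 0 = (1 - r) / (alpha1 p r q + beta N p r q + 1)"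
  by (subst limit_freq.simps) (simp add: limit_freq_degenerate)

lemma limit_freq_peripheral_one:
  "limit_freq 1 0 1 = r / (alpha2 N p r q + beta N p r q + 1)"
  by (subst limit_freq.simps) (simp add: limit_freq_degenerate)

end

section \<open>Almost sure convergence and rates\<close>

context star_process
begin

lemma AE_num_vertices:
  "AE \<omega> in M. (\<lambda>n. real (num_vertices (G n \<omega>)) / (real n + 1)) \<longlonglongrightarrow> p"
proof -
  obtain a where a: "0 < a" and bound: "AE \<omega> in M. \<exists>B. \<forall>n. \<bar>vertex_dev n (G n \<omega>)\<bar> \<le> B * (real n + 1) powr (1 - a)"
    using AE_bound_of_l2_bounded[OF l2_bounded_vertex_dev _ _ vertex_dev_lipschitz] by auto
  show ?thesis using bound
  proof eventually_elim
    case (elim \<omega>)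
    then obtain B where B: "\<And>n. \<bar>vertex_dev n (G n \<omega>)\<bar> \<le> B * (real n + 1) powr (1 - a)" by blast
    have "(\<lambda>n. real (num_vertices (G n \<omega>)) / (real n + 1) - p) \<longlonglongrightarrow> 0"
    proof (rule tendsto_of_powr_bound[OF a])
      have "real (num_vertices (G n \<omega>)) / (real n + 1) - p = vertex_dev n (G n \<omega>) / (real n + 1)" for n
        by (simp add: vertex_dev_def num_vertices_def field_simps)
      then show "\<bar>real (num_vertices (G n \<omega>)) / (real n + 1) - p\<bar> \<le> B * (real n + 1) powr (- a)" for n
        using dev_bound_divide[OF B] by simp
    qed
    then show ?case by (simp add: LIM_zero_iff)
  qed
qed

text \<open>The order of quantifiers matters: the exponent is deterministic, while the constant may
  depend on the path.\<close>

lemma AE_type_count: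
  "\<exists>a>0. AE \<omega> in M. \<exists>B. \<forall>n. \<bar>real (Xcount (G n \<omega>) d w1 w2) / (real n + 1) - p * limit_freq (int d) (int w1) (int w2)\<bar>
      \<le> B * (real n + 1) powr (- a)"
proof -
  let ?k = "(int d, int w1, int w2)"
  obtain \<epsilon> where \<epsilon>: "0 < \<epsilon>" "\<epsilon> \<le> 1" "l2_bounded (type_dev ?k) \<epsilon>" using l2_bounded_type_dev by blast
  have "\<exists>a>0. AE \<omega> in M. \<exists>B. \<forall>n. \<bar>type_dev ?k n (G n \<omega>)\<bar> \<le> B * (real n + 1) powr (1 - a)"
    by (rule AE_bound_of_l2_bounded[OF \<epsilon>(3,1,2)]) (rule type_dev_lipschitz)
  then obtain a where a: "0 < a" and bound: "AE \<omega> in M. \<exists>B. \<forall>n. \<bar>type_dev ?k n (G n \<omega>)\<bar> \<le> B * (real n + 1) powr (1 - a)"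
    by blast
  have "AE \<omega> in M. \<exists>B. \<forall>n. \<bar>real (Xcount (G n \<omega>) d w1 w2) / (real n + 1) - p * limit_freq (int d) (int w1) (int w2)\<bar>
      \<le> B * (real n + 1) powr (- a)"
    using bound
  proof eventually_elim
    case (elim \<omega>)
    then obtain B where B: "\<And>n. \<bar>type_dev ?k n (G n \<omega>)\<bar> \<le> B * (real n + 1) powr (1 - a)" by blast
    have "real (Xcount (G n \<omega>) d w1 w2) / (real n + 1) - p * limit_freq (int d) (int w1) (int w2) = type_dev ?k n (G n \<omega>) / (real n + 1)" for n
      using Xcount_eq_tcount[of "fst (G n \<omega>)" "snd (G n \<omega>)" d w1 w2] by (simp add: type_dev_def field_simps)
    then show ?case using dev_bound_divide[OF B] by auto
  qed
  then show ?thesis using a by blast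
qed

lemma AE_frequency_tendsto:
  "AE \<omega> in M. (\<lambda>n. real (Xcount (G n \<omega>) d w1 w2) / real (num_vertices (G n \<omega>))) \<longlonglongrightarrow> limit_freq (int d) (int w1) (int w2)"
proof -
  let ?x = "limit_freq (int d) (int w1) (int w2)"
  obtain a where a: "0 < a" and bound: "AE \<omega> in M. \<exists>B. \<forall>n. \<bar>real (Xcount (G n \<omega>) d w1 w2) / (real n + 1) - p * ?x\<bar>
      \<le> B * (real n + 1) powr (- a)"
    using AE_type_count by blast
  show ?thesis using bound AE_num_vertices
  proof eventually_elim
    case (elim \<omega>)
    then obtain B where B: "\<And>n. \<bar>real (Xcount (G n \<omega>) d w1 w2) / (real n + 1) - p * ?x\<bar> \<le> B * (real n + 1) powr (- a)"
      by blast
    have "(\<lambda>n. real (Xcount (G n \<omega>) d w1 w2) / (real n + 1) - p * ?x) \<longlonglongrightarrow> 0"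
      by (rule tendsto_of_powr_bound[OF a B])
    then have "(\<lambda>n. real (Xcount (G n \<omega>) d w1 w2) / (real n + 1)) \<longlonglongrightarrow> p * ?x"
      by (simp add: LIM_zero_iff)
    then have "(\<lambda>n. (real (Xcount (G n \<omega>) d w1 w2) / (real n + 1)) / (real (num_vertices (G n \<omega>)) / (real n + 1))) \<longlonglongrightarrow> p * ?x / p"
      using elim(2) p by (intro tendsto_divide) auto
    then show ?case using p by (simp add: add_eq_0_iff_both_eq_0 nonzero_mult_div_cancel_left)
  qed
qed

lemma AE_frequency_smallo:
  assumes "limit_freq (int d) (int w1) (int w2) = 0"
  shows "\<exists>a>0. AE \<omega> in M. (\<lambda>n. real (Xcount (G n \<omega>) d w1 w2) / real (num_vertices (G n \<omega>))) \<in> o(\<lambda>n. real n powr (- a))"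
proof -
  obtain a where a: "0 < a" and bound: "AE \<omega> in M. \<exists>B. \<forall>n. \<bar>real (Xcount (G n \<omega>) d w1 w2) / (real n + 1) - p * 0\<bar>
      \<le> B * (real n + 1) powr (- a)"
    using AE_type_count[of d w1 w2] unfolding assms by blast
  have "AE \<omega> in M. (\<lambda>n. real (Xcount (G n \<omega>) d w1 w2) / real (num_vertices (G n \<omega>))) \<in> o(\<lambda>n. real n powr (- (a / 2)))"
    using bound AE_num_vertices
  proof eventually_elim
    case (elim \<omega>)
    then obtain B where B: "\<And>n. \<bar>real (Xcount (G n \<omega>) d w1 w2) / (real n + 1)\<bar> \<le> B * (real n + 1) powr (- a)"
      by auto
    \<comment> \<open>Eventually \<open>V\<close> exceeds \<open>p / 2\<close> times the number of
      interactions, so division by \<open>V\<close> changes only the constant.\<close>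
    have "\<forall>\<^sub>F n in sequentially. p / 2 < real (num_vertices (G n \<omega>)) / (real n + 1)"
      using elim(2) p by (intro order_tendstoD(1)) auto
    then have "\<forall>\<^sub>F n in sequentially. \<bar>real (Xcount (G n \<omega>) d w1 w2) / real (num_vertices (G n \<omega>))\<bar> \<le> (2 * B / p) * (real n + 1) powr (- a)"
    proof eventually_elim
      case (elim n)
      let ?X = "real (Xcount (G n \<omega>) d w1 w2)" and ?V = "real (num_vertices (G n \<omega>))" and ?m = "real n + 1"
      have XB: "?X / ?m \<le> B * ?m powr (- a)" using B[of n] by simp
      have "?X / ?V = (?X / ?m) / (?V / ?m)" by simp
      also have "\<dots> \<le> (B * ?m powr (- a)) / (p / 2)"
      proof (rule frac_le)
        show "0 \<le> B * ?m powr (- a)" by (rule order_trans[OF _ XB]) simp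
      qed (use XB elim p in linarith)+
      finally show ?case by (simp add: mult_ac)
    qed
    then show ?case by (rule smallo_of_powr_bound[OF a])
  qed
  then show ?thesis using a by (intro exI[of _ "a / 2"]) simp
qed

end

theorem theorem3p2:
  fixes N :: nat and p r q :: real
    and M :: "'w measure" and G :: "nat \<Rightarrow> 'w \<Rightarrow> sstate"
  assumes N: "N \<ge> 3"
    and p: "0 < p" "p < 1" and q: "0 < q" "q < 1" and r: "0 < r" "r < 1"
    and proc: "is_star_process N p r q M G"
  shows "\<exists>x :: int \<Rightarrow> int \<Rightarrow> int \<Rightarrow> real.
     (\<forall>d w1 w2. \<not> in_domain N d w1 w2 \<longrightarrow> x d w1 w2 = 0) \<and>
     (\<forall>d w1 w2 :: nat. in_domain N (int d) (int w1) (int w2) \<longrightarrow>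
        x (int d) (int w1) (int w2) \<ge> 0 \<and>
        (AE \<omega> in M. (\<lambda>n. real (Xcount (G n \<omega>) d w1 w2) / real (num_vertices (G n \<omega>)))
                        \<longlonglongrightarrow> x (int d) (int w1) (int w2))) \<and>
     x (int N - 1) 1 0 = (1 - r) / (alpha1 p r q + beta N p r q + 1) \<and>
     x (int N - 1) 1 0 > 0 \<and>
     (\<forall>d. d \<noteq> int N - 1 \<longrightarrow> x d 1 0 = 0) \<and>
     x 1 0 1 = r / (alpha2 N p r q + beta N p r q + 1) \<and>
     x 1 0 1 > 0 \<and>
     (\<forall>d. d \<noteq> 1 \<longrightarrow> x d 0 1 = 0) \<and>
     (\<forall>(d :: int) (w1 :: nat) (w2 :: nat). w1 + w2 \<ge> 2 \<longrightarrow>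
        x d (int w1) (int w2) =
          (alpha11 p r q * (real w1 - 1) * x (d - 1) (int w1 - 1) (int w2)
           + alpha12 p r q * (real w1 - 1) * x d (int w1 - 1) (int w2)
           + alpha2 N p r q * (real w2 - 1) * x d (int w1) (int w2 - 1)
           + beta1 p r q * x (d - (int N - 1)) (int w1 - 1) (int w2)
           + beta2 N p r q * x (d - 1) (int w1) (int w2 - 1))
          / (alpha1 p r q * real w1 + alpha2 N p r q * real w2 + beta N p r q + 1)) \<and>
     (\<forall>d w1 w2 :: nat. in_domain N (int d) (int w1) (int w2) \<and> x (int d) (int w1) (int w2) = 0
        \<longrightarrow> (\<exists>a > 0. AE \<omega> in M.
              (\<lambda>n. real (Xcount (G n \<omega>) d w1 w2) / real (num_vertices (G n \<omega>)))
                \<in> o(\<lambda>n. real n powr (- a))))"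
proof -
  \<comment> \<open>The strict bounds give positivity of the two start values. They are saved under
    another name because the locale has its own fact \<open>r\<close> with weak bounds.\<close>
  have r01: "0 < r" "r < 1" by (rule r)+
  interpret prob_space M using proc by (simp add: is_star_process_def)
  interpret star_process N p r q M G
    by unfold_locales (use N p q r proc in auto)
  have pos: "0 < alpha1 p r q + beta N p r q + 1" "0 < alpha2 N p r q + beta N p r q + 1"
    using params_nonneg(3,4,7) by linarith+
  show ?thesis
  proof (intro exI[of _ limit_freq] conjI allI impI)
    show "limit_freq (int N - 1) 1 0 > 0" "limit_freq 1 0 1 > 0"
      unfolding limit_freq_central_one limit_freq_peripheral_one using r01 pos by simp_all
    show "limit_freq d 1 0 = 0" if "d \<noteq> int N - 1" for d
      using that by (intro limit_freq_outside_domain) (auto simp: in_domain_def)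
    show "limit_freq d 0 1 = 0" if "d \<noteq> 1" for d
      using that by (intro limit_freq_outside_domain) (auto simp: in_domain_def)
    show "\<exists>a>0. AE \<omega> in M. (\<lambda>n. real (Xcount (G n \<omega>) d w1 w2) / real (num_vertices (G n \<omega>))) \<in> o(\<lambda>n. real n powr (- a))"
      if "in_domain N (int d) (int w1) (int w2) \<and> limit_freq (int d) (int w1) (int w2) = 0" for d w1 w2
      using that by (intro AE_frequency_smallo) simp
  qed (rule limit_freq_outside_domain limit_freq_nonneg AE_frequency_tendsto limit_freq_central_one
      limit_freq_peripheral_one limit_freq_rec, assumption?)+
qed

end
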